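(* Let $B=\{B(x),x\in[0,1]\}$ be a Brownian motion, let $L$ be the random Schrödinger operator (symbolically $Lf=-f''+B'f$ on $[0,1]$ with boundary conditions $f(0)=f(1)=0$) defined weakly by $$\langle Lf,g\rangle:=\int_0^1 f'(x)g'(x)\,dx+\int_0^1 f(x)g(x)\,dB(x),\qquad f,g\in H_1,$$ and let $T$ be the stochastic Green operator $$[Tf](x):=\frac1\alpha\int_0^1 G(x,y)f(y)\,dy,\quad f\in H_1,\qquad G(x,y):=\begin{cases}u(y)v(x), & 0\le y\le x\le 1,\\ u(x)v(y), & 0\le x\le y\le 1,\end{cases}$$ where $H_1$, $u$, $v$ and $\alpha$ are as defined in the context. Then $T$ is an inverse of $L$ from the right, in the sense that (almost surely), for $f\in H_1$, $$\langle LTf,h\rangle=\langle f,h\rangle\quad\text{for all }h\in H_1,$$ where $\langle f,h\rangle=\int_0^1 f(x)h(x)\,dx$.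
   Context: All spaces are over $\mathbb R$. $H:=\{h\in L_2[0,1]: h(0)=h(1)=0\}$ and $H_1:=\{h\in H: h\text{ is absolutely continuous}\}$. $B$ is a Brownian motion supported by a filtered probability space $(\Omega,\mathcal F,P)$. By Itô's formula, for $f,g\in H_1$ one has alternatively $\langle Lf,g\rangle=\int_0^1 f'g'\,dx-\int_0^1(f'g+fg')B\,dx$. Let $K(x,y)=x(1-y)$ for $0\le x\le y\le1$ and $K(x,y)=y(1-x)$ for $0\le y\le x\le1$. The processes $u$ and $v$ are the unique solutions of the stochastic differential equations $$u(x)-x=-\int_0^1K(x,y)u(y)\,dB(y),\qquad v(x)+x-1=-\int_0^1K(x,y)v(y)\,dB(y);$$ they have differentiable paths, satisfy $u(0)=0$, $u(1)=1$, $v(0)=1$, $v(1)=0$, and are two linearly independent solutions of $Lf=0$, i.e. for all $h\in H_1$, almost surely $\int_0^1u'h'\,dx+\int_0^1uh\,dB=0$ and likewise for $v$, and for almost all $\omega\in\Omega$ the paths of $u$ and $v$ are linearly independent functions. The random variable $\alpha$ is $\alpha:=u'(x)v(x)-u(x)v'(x)$, which almost surely is a positive constant for all $x\in[0,1]$. *)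

theory Defs
  imports "HOL-Probability.Probability"
begin

section \<open>Function spaces on the unit interval\<close>

definition abs_cont_on :: "real \<Rightarrow> real \<Rightarrow> (real \<Rightarrow> real) \<Rightarrow> bool" where
  "abs_cont_on a b f \<longleftrightarrow>
     (\<forall>\<epsilon>>0. \<exists>\<delta>>0. \<forall>\<D>. \<D> division_of \<Union>\<D> \<and> \<Union>\<D> \<subseteq> {a..b} \<and> (\<Sum>k\<in>\<D>. Sup k - Inf k) < \<delta>
        \<longrightarrow> (\<Sum>k\<in>\<D>. \<bar>f (Sup k) - f (Inf k)\<bar>) < \<epsilon>)"

text \<open>The boundary conditions refer to point values, so elements are functions rather than
  equivalence classes; values outside the unit interval are irrelevant.\<close>

definition H :: "(real \<Rightarrow> real) set" where
  "H = {h. set_borel_measurable lebesgue {0..1} h \<and>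
           set_integrable lebesgue {0..1} (\<lambda>x. (h x)\<^sup>2) \<and> h 0 = 0 \<and> h 1 = 0}"

definition H1 :: "(real \<Rightarrow> real) set" where
  "H1 = {h \<in> H. abs_cont_on 0 1 h}"

definition inner01 :: "(real \<Rightarrow> real) \<Rightarrow> (real \<Rightarrow> real) \<Rightarrow> real" where
  "inner01 f h = (LINT x:{0..1}|lebesgue. f x * h x)"

text \<open>One-sided at the two end points.  For an absolutely continuous function the value is
  unspecified on the null set where the derivative does not exist.\<close>

definition D01 :: "(real \<Rightarrow> real) \<Rightarrow> real \<Rightarrow> real" where
  "D01 f x = vector_derivative f (at x within {0..1})"

section \<open>Brownian motion\<close>

definition brownian_motion ::
  "'w measure \<Rightarrow> (real \<Rightarrow> 'w measure) \<Rightarrow> (real \<Rightarrow> 'w \<Rightarrow> real) \<Rightarrow> bool" where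
  "brownian_motion M F B \<longleftrightarrow>
     prob_space M \<and>
     (\<forall>t\<in>{0..1}. subalgebra M (F t)) \<and>
     (\<forall>s\<in>{0..1}. \<forall>t\<in>{0..1}. s \<le> t \<longrightarrow> sets (F s) \<subseteq> sets (F t)) \<and>
     (\<forall>t\<in>{0..1}. B t \<in> borel_measurable (F t)) \<and>
     (AE \<omega> in M. B 0 \<omega> = 0) \<and>
     (AE \<omega> in M. continuous_on {0..1} (\<lambda>t. B t \<omega>)) \<and>
     (\<forall>s\<in>{0..1}. \<forall>t\<in>{0..1}. s < t \<longrightarrow>
        distributed M lborel (\<lambda>\<omega>. B t \<omega> - B s \<omega>) (normal_density 0 (sqrt (t - s))) \<and>
        prob_space.indep_set M (sets (F s))
          {(\<lambda>\<omega>. B t \<omega> - B s \<omega>) -` A \<inter> space M | A. A \<in> sets borel})"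

section \<open>Integration against a Brownian path\<close>

text \<open>Path by path, the integral of \<open>\<phi>\<close> against \<open>b\<close> over the unit interval is the limit of the
  Riemann sums of \<open>\<phi>(\<xi>) (b(t) - b(s))\<close>, \<open>s \<le> \<xi> \<le> t\<close>, as the mesh tends to zero.  For a
  deterministic absolutely continuous \<open>\<phi>\<close> it agrees almost surely with the Ito integral
  against Brownian motion, and it satisfies the integration by parts formula.  It is also
  meaningful for integrands that anticipate the path, as the solutions \<open>u\<close>, \<open>v\<close> of the
  boundary value problem do.\<close>

definition has_path_integral :: "(real \<Rightarrow> real) \<Rightarrow> (real \<Rightarrow> real) \<Rightarrow> real \<Rightarrow> bool" where
  "has_path_integral b \<phi> I \<longleftrightarrow>
     (\<forall>\<epsilon>>0. \<exists>\<delta>>0. \<forall>\<D>. \<D> tagged_division_of {0..1} \<and> (\<lambda>\<xi>. ball \<xi> \<delta>) fine \<D> \<longrightarrow>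
        \<bar>(\<Sum>(\<xi>, k)\<in>\<D>. \<phi> \<xi> * (b (Sup k) - b (Inf k))) - I\<bar> < \<epsilon>)"

section \<open>The operators\<close>

text \<open>\<open>has_L_form b f g l\<close> says that both integrals defining the weak form of the
  operator at the noise path \<open>b\<close> exist and that their sum is \<open>l\<close>.  (For arbitrary absolutely
  continuous \<open>f\<close> and \<open>g\<close> the product of the derivatives need not be integrable.)\<close>

definition has_L_form :: "(real \<Rightarrow> real) \<Rightarrow> (real \<Rightarrow> real) \<Rightarrow> (real \<Rightarrow> real) \<Rightarrow> real \<Rightarrow> bool" where
  "has_L_form b f g l \<longleftrightarrow>
     set_integrable lebesgue {0..1} (\<lambda>x. D01 f x * D01 g x) \<and>
     (\<exists>I. has_path_integral b (\<lambda>x. f x * g x) I \<and>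
          l = (LINT x:{0..1}|lebesgue. D01 f x * D01 g x) + I)"

definition K :: "real \<Rightarrow> real \<Rightarrow> real" where
  "K x y = (if x \<le> y then x * (1 - y) else y * (1 - x))"

definition wronskian :: "(real \<Rightarrow> real) \<Rightarrow> (real \<Rightarrow> real) \<Rightarrow> real \<Rightarrow> real" where
  "wronskian u v x = D01 u x * v x - u x * D01 v x"

text \<open>The common value of the Wronskian on the unit interval.\<close>

definition alpha :: "(real \<Rightarrow> real) \<Rightarrow> (real \<Rightarrow> real) \<Rightarrow> real" where
  "alpha u v = (THE a. \<forall>x\<in>{0..1}. wronskian u v x = a)"

definition G :: "(real \<Rightarrow> real) \<Rightarrow> (real \<Rightarrow> real) \<Rightarrow> real \<Rightarrow> real \<Rightarrow> real" where
  "G u v x y = (if y \<le> x then u y * v x else u x * v y)"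

definition T :: "(real \<Rightarrow> real) \<Rightarrow> (real \<Rightarrow> real) \<Rightarrow> (real \<Rightarrow> real) \<Rightarrow> real \<Rightarrow> real" where
  "T u v f x = 1 / alpha u v * (LINT y:{0..1}|lebesgue. G u v x y * f y)"

end

theory Submission
  imports Defs
begin

text \<open>
  Fix a continuous path \<open>b\<close> along which the equations hold at all rational \<open>x\<close>.  They force \<open>u\<close> to be
  continuously differentiable, and the quasi-derivative \<open>q = u' - u b\<close> satisfies the linear system
  \<open>u' = q + u b\<close>, \<open>q' = - b (q + u b)\<close> with continuous coefficients; likewise for \<open>v\<close>.  The Wronskian
  \<open>q\<^sub>u v - u q\<^sub>v\<close> is constant, and it is not zero since otherwise \<open>u\<close> would vanish by uniqueness.
  Variation of constants shows that \<open>w = T f\<close> solves \<open>w' = q + w b\<close>, \<open>q' = - b w' - f\<close>.  For an absolutely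
  continuous \<open>h\<close> vanishing at the end points, integration by parts turns the noise term into
  \<open>- \<integral> (w h)' b\<close>, and the weak form becomes \<open>\<integral> (q h)' + \<integral> f h = \<integral> f h\<close>.
  Absolutely continuous functions are differentiable almost everywhere by a Vitali covering argument
  applied to the total variation.
\<close>

section \<open>Functions of bounded variation\<close>

text \<open>Solutions of a boundary value problem anticipate the path, so the argument runs along
  one path at a time instead of using adapted stochastic calculus. Each equation holds off a null
  set that may depend on \<open>x\<close>, and only countably many such sets can be discarded
  together; this is why rational \<open>x\<close> are singled out. The obstacle is that a Brownian
  path has neither a derivative nor bounded variation: the tool for a Stieltjes integral against it
  is integration by parts, which asks for an integrand that is an indefinite integral, and
  \<open>u\<close> is not known to be one beforehand. The mere existence of the integrals of
  \<open>K x y * u y\<close> has to yield this regularity; it does so through an indefinite integral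
  \<open>R\<close> of a fixed multiple of \<open>u\<close>. The choice of \<open>q\<close> comes
  from the formal equation u'' = b' u: it gives (u' - u b)' = - b u', in which b' no longer occurs.
  The test functions are given by absolute continuity in the epsilon-delta sense, so almost
  everywhere differentiability and the fundamental theorem of calculus are derived for them from
  that condition.\<close>

lemma division_of_real_cases:
  fixes D :: "real set set"
  assumes "D division_of S" "k \<in> D"
  obtains s t where "s \<le> t" "k = {s..t}" "Sup k = t" "Inf k = s"
proof -
  obtain s t where k: "k = cbox s t" "k \<noteq> {}"
    using division_ofD(3,4)[OF assms] by blast
  then have "s \<le> t" by auto
  with k show ?thesis by (intro that[of s t]) auto
qed

lemma additive_division_1:
  fixes f :: "real \<Rightarrow> real"
  assumes "a \<le> b" "D division_of {a..b}"
  shows "(\<Sum>k\<in>D. f (Sup k) - f (Inf k)) = f b - f a"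
proof -
  let ?p = "(\<lambda>k. (Inf k, k)) ` D"
  have "?p tagged_division_of {a..b}"
  proof (rule tagged_division_ofI)
    show "finite ?p" using division_ofD(1)[OF assms(2)] by simp
    fix x k assume "(x, k) \<in> ?p"
    then have k: "k \<in> D" "x = Inf k" by auto
    obtain s t where "s \<le> t" "k = {s..t}" "Inf k = s"
      by (rule division_of_real_cases[OF assms(2) k(1)])
    with k show "x \<in> k" by simp
    show "k \<subseteq> {a..b}" "\<exists>a b. k = cbox a b"
      using division_ofD(2,4)[OF assms(2) k(1)] by auto
    fix x' k' assume "(x', k') \<in> ?p" "(x, k) \<noteq> (x', k')"
    then show "interior k \<inter> interior k' = {}"
      using division_ofD(5)[OF assms(2) k(1)] k by auto
  next
    show "\<Union> {k. \<exists>x. (x, k) \<in> ?p} = {a..b}"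
      using division_ofD(6)[OF assms(2)] by (auto simp: image_iff)
  qed
  then have "(\<Sum>(x,k)\<in>?p. f (Sup k) - f (Inf k)) = f b - f a"
    by (rule additive_tagged_division_1[OF assms(1)])
  then show ?thesis
    by (subst (asm) sum.reindex) (auto simp: inj_on_def)
qed

text \<open>Extending \<open>D\<close> to a division of all of \<open>{a..b}\<close> only adds
  nonnegative increments, and the full sum telescopes.\<close>

lemma sum_increments_mono_on_le:
  fixes W :: "real \<Rightarrow> real"
  assumes W: "mono_on {a..b} W" and "a \<le> b" and D: "D division_of \<Union>D" "\<Union>D \<subseteq> {a..b}"
  shows "(\<Sum>k\<in>D. W (Sup k) - W (Inf k)) \<le> W b - W a"
proof -
  have "{cbox a b} division_of {a..b}"
    using \<open>a \<le> b\<close> by (metis box_real(2) division_of_self atLeastatMost_empty_iff2 not_less)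
  then obtain r where r: "D \<subseteq> r" "r division_of {a..b}"
    using partial_division_extend[OF D(1) _ D(2)] by metis
  have "(\<Sum>k\<in>D. W (Sup k) - W (Inf k)) \<le> (\<Sum>k\<in>r. W (Sup k) - W (Inf k))"
  proof (rule sum_mono2)
    fix k assume "k \<in> r - D"
    then have k: "k \<in> r" by auto
    obtain s t where st: "s \<le> t" "k = {s..t}" "Sup k = t" "Inf k = s"
      by (rule division_of_real_cases[OF r(2) k])
    then have "s \<in> {a..b}" "t \<in> {a..b}"
      using division_ofD(2)[OF r(2) k] by auto
    then show "0 \<le> W (Sup k) - W (Inf k)"
      using mono_onD[OF W _ _ st(1)] st by simp
  qed (use r division_ofD(1) in auto)
  also have "\<dots> = W b - W a"
    using additive_division_1[OF \<open>a \<le> b\<close> r(2)] .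
  finally show ?thesis .
qed

text \<open>By Vitali, almost all of \<open>E\<close> is covered by disjoint intervals on which \<open>W\<close> has slope at
  least \<open>c\<close>; monotonicity bounds their total length.\<close>

lemma outer_measure_steep_mono_on:
  fixes W :: "real \<Rightarrow> real"
  assumes W: "mono_on {s..t} W" and "s \<le> t" and c: "c > 0"
    and E: "\<And>x d. x \<in> E \<Longrightarrow> d > 0 \<Longrightarrow>
      \<exists>p q. p < q \<and> p \<le> x \<and> x \<le> q \<and> q - p < d \<and> s \<le> p \<and> q \<le> t \<and> c * (q - p) \<le> W q - W p"
  obtains T where "E \<subseteq> T" "T \<in> lmeasurable" "measure lebesgue T \<le> (W t - W s) / c"
proof -
  define Q where "Q = {(p, q). p < q \<and> s \<le> p \<and> q \<le> t \<and> c * (q - p) \<le> W q - W p}"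
  \<comment> \<open>The covering theorem speaks of closed balls, so an interval is recoded by
    midpoint and radius.\<close>
  define m where "m i = (fst i + snd i) / 2" for i :: "real \<times> real"
  define r where "r i = (snd i - fst i) / 2" for i :: "real \<times> real"
  have cb: "cball (m i) (r i) = {fst i..snd i}" for i
    unfolding m_def r_def cball_eq_atLeastAtMost by (simp add: field_simps)
  have r0: "\<And>i. i \<in> Q \<Longrightarrow> 0 < r i" by (auto simp: Q_def r_def)
  have S: "\<exists>i. i \<in> Q \<and> x \<in> cball (m i) (r i) \<and> r i < d" if "x \<in> E" "0 < d" for x d
  proof -
    from E[OF that] obtain p q where "p < q" "p \<le> x" "x \<le> q" "q - p < d" "s \<le> p" "q \<le> t"
      "c * (q - p) \<le> W q - W p" by blast
    then show ?thesis unfolding cb by (intro exI[of _ "(p, q)"]) (auto simp: Q_def r_def)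
  qed
  obtain C where C: "countable C" "C \<subseteq> Q"
    "pairwise (\<lambda>i j. disjnt (cball (m i) (r i)) (cball (m j) (r j))) C"
    and neg: "negligible (E - (\<Union>i\<in>C. cball (m i) (r i)))"
    by (rule Vitali_covering_theorem_cballs[where K = Q and r = r and S = E and a = m, OF r0 S])
  let ?J = "\<lambda>i::real \<times> real. {fst i..snd i}"
  \<comment> \<open>A bound common to all finite subfamilies passes to the union of the countable
    family.\<close>
  have bound: "measure lebesgue (\<Union>i\<in>I. ?J i) \<le> (W t - W s) / c" if I: "I \<subseteq> C" "finite I" for I
  proof -
    have IQ: "fst i < snd i" "s \<le> fst i" "snd i \<le> t" "c * (snd i - fst i) \<le> W (snd i) - W (fst i)"
      if "i \<in> I" for i using that I C by (auto simp: Q_def)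
    have dj: "?J i \<inter> ?J j = {}" if "i \<in> I" "j \<in> I" "i \<noteq> j" for i j
      using pairwiseD[OF C(3), of i j] that I by (auto simp only: cb disjnt_def)
    have inj: "inj_on ?J I"
    proof (rule inj_onI, rule ccontr)
      fix i j assume "i \<in> I" "j \<in> I" "?J i = ?J j" "i \<noteq> j"
      with dj[of i j] IQ(1)[of i] show False by auto
    qed
    have div: "?J ` I division_of \<Union>(?J ` I)"
    proof (rule division_ofI)
      fix k assume "k \<in> ?J ` I"
      then obtain i where "i \<in> I" "k = cbox (fst i) (snd i)" by auto
      then show "k \<noteq> {}" "\<exists>a b. k = cbox a b" using IQ(1)[of i] by auto
      fix k' assume "k' \<in> ?J ` I" "k \<noteq> k'"
      with \<open>k \<in> ?J ` I\<close> have "k \<inter> k' = {}" using dj by (elim imageE) metis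
      then show "interior k \<inter> interior k' = {}" using interior_subset by blast
    qed (use I in auto)
    have "measure lebesgue (\<Union>(?J ` I)) = (\<Sum>k\<in>?J ` I. measure lebesgue k)"
      using content_division[OF div] by simp
    also have "\<dots> = (\<Sum>i\<in>I. snd i - fst i)"
      by (subst sum.reindex[OF inj]) (auto intro!: sum.cong dest: IQ(1))
    also have "\<dots> \<le> (\<Sum>i\<in>I. (W (snd i) - W (fst i)) / c)"
      using IQ c by (intro sum_mono) (auto simp: field_simps)
    also have "\<dots> = (\<Sum>i\<in>I. W (snd i) - W (fst i)) / c"
      by (simp add: sum_divide_distrib)
    also have "(\<Sum>i\<in>I. W (snd i) - W (fst i)) = (\<Sum>k\<in>?J ` I. W (Sup k) - W (Inf k))"
      using IQ(1) by (subst sum.reindex[OF inj]) (auto intro!: sum.cong simp: less_imp_le)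
    also have "\<dots> / c \<le> (W t - W s) / c"
    proof (intro divide_right_mono sum_increments_mono_on_le[OF W \<open>s \<le> t\<close> div])
      show "\<Union>(?J ` I) \<subseteq> {s..t}"
      proof
        fix x assume "x \<in> \<Union>(?J ` I)"
        then obtain i where "i \<in> I" "x \<in> ?J i" by blast
        with IQ[of i] show "x \<in> {s..t}" by auto
      qed
    qed (use c in auto)
    finally show ?thesis .
  qed
  have U: "(\<Union>i\<in>C. ?J i) \<in> lmeasurable" "measure lebesgue (\<Union>i\<in>C. ?J i) \<le> (W t - W s) / c"
    using fmeasurable_UN_bound[OF C(1) _ bound] measure_UN_bound[OF C(1) _ bound] by auto
  let ?N = "E - (\<Union>i\<in>C. ?J i)"
  have N: "negligible ?N" using neg unfolding cb .
  show ?thesis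
  proof (rule that)
    show "E \<subseteq> ?N \<union> (\<Union>i\<in>C. ?J i)" by blast
    show "?N \<union> (\<Union>i\<in>C. ?J i) \<in> lmeasurable"
      by (intro fmeasurable.Un U negligible_imp_measurable N)
    have "measure lebesgue (?N \<union> (\<Union>i\<in>C. ?J i)) = measure lebesgue (\<Union>i\<in>C. ?J i)"
      by (rule measure_negligible_symdiff[OF U(1)]) (rule negligible_subset[OF N], auto)
    then show "measure lebesgue (?N \<union> (\<Union>i\<in>C. ?J i)) \<le> (W t - W s) / c" using U by simp
  qed
qed

section \<open>Total variation and almost everywhere differentiability\<close>

definition bounded_variation_on :: "real \<Rightarrow> real \<Rightarrow> (real \<Rightarrow> real) \<Rightarrow> bool" where
  "bounded_variation_on a b f \<longleftrightarrow>
     (\<exists>M. \<forall>D. D division_of {a..b} \<longrightarrow> (\<Sum>k\<in>D. \<bar>f (Sup k) - f (Inf k)\<bar>) \<le> M)"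

text \<open>\<open>V x\<close> is the total variation on \<open>{a..x}\<close>, and appending the
  cell \<open>{x..y}\<close> to a division gives the first property. The second one provides almost
  optimal divisions; it distinguishes \<open>V\<close> from an arbitrary monotone majorant and is
  what rules out oscillating slopes later.\<close>

lemma bounded_variation_on_majorant:
  fixes f :: "real \<Rightarrow> real"
  assumes bv: "bounded_variation_on a b f" and "a \<le> b"
  obtains V where
    "\<forall>x y. a \<le> x \<longrightarrow> x \<le> y \<longrightarrow> y \<le> b \<longrightarrow> \<bar>f y - f x\<bar> \<le> V y - V x"
    "\<forall>e>0. \<exists>D. D division_of {a..b} \<and> V b - V a - e < (\<Sum>k\<in>D. \<bar>f (Sup k) - f (Inf k)\<bar>)"
proof -
  let ?s = "\<lambda>D. \<Sum>k\<in>D. \<bar>f (Sup k) - f (Inf k)\<bar>"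
  define S where "S x = ?s ` {D. D division_of {a..x}}" for x
  define V where "V x = Sup (S x)" for x
  obtain M where M: "\<And>D. D division_of {a..b} \<Longrightarrow> ?s D \<le> M"
    using bv unfolding bounded_variation_on_def by blast
  have ext: "insert {x..y} D division_of {a..y} \<and> ?s (insert {x..y} D) = \<bar>f y - f x\<bar> + ?s D"
    if D: "D division_of {a..x}" and xy: "a \<le> x" "x < y" for D x y
  proof
    have "({{x..y}} \<union> D) division_of ({x..y} \<union> {a..x})"
    proof (rule division_disjoint_union[OF _ D])
      show "{{x..y}} division_of {x..y}"
        using xy by (metis box_real(2) division_of_self atLeastatMost_empty_iff2 less_imp_le not_less)
    qed (use xy in auto)
    then show "insert {x..y} D division_of {a..y}"
      using xy by (simp add: Un_commute ivl_disj_un_two_touch)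
    have "{x..y} \<notin> D"
      using division_ofD(2)[OF D, of "{x..y}"] xy by auto
    then show "?s (insert {x..y} D) = \<bar>f y - f x\<bar> + ?s D"
      using xy division_ofD(1)[OF D] by simp
  qed
  have ne: "S x \<noteq> {}" if "a \<le> x" for x
  proof -
    obtain D where "D division_of cbox a x" by (rule elementary_interval)
    then show ?thesis by (auto simp: S_def)
  qed
  have bdd: "bdd_above (S x)" if "a \<le> x" "x \<le> b" for x
  proof (cases "x = b")
    case True
    then show ?thesis unfolding S_def using M by (intro bdd_aboveI2) auto
  next
    case False
    \<comment> \<open>Adding the cell \<open>{x..b}\<close> does not decrease the sum and yields a
      division of \<open>{a..b}\<close>, to which the bound \<open>M\<close> applies.\<close>
    have "?s D \<le> M" if D: "D division_of {a..x}" for D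
      using ext[OF D, of b] M[of "insert {x..b} D"] False \<open>a \<le> x\<close> \<open>x \<le> b\<close> by simp
    then show ?thesis unfolding S_def by (intro bdd_aboveI2) auto
  qed
  show ?thesis
  proof (rule that[of V]; intro allI impI)
    fix x y assume xy: "a \<le> x" "x \<le> y" "y \<le> b"
    show "\<bar>f y - f x\<bar> \<le> V y - V x"
    proof (cases "x = y")
      case False
      have "V x \<le> V y - \<bar>f y - f x\<bar>"
        unfolding V_def
      proof (rule cSup_least[OF ne])
        fix z assume "z \<in> S x"
        then obtain D where D: "D division_of {a..x}" "z = ?s D" by (auto simp: S_def)
        have "?s (insert {x..y} D) \<le> Sup (S y)"
        proof (intro cSup_upper bdd)
          have "insert {x..y} D division_of {a..y}" using ext[OF D(1), of y] xy False by simp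
          then show "?s (insert {x..y} D) \<in> S y" unfolding S_def by blast
        qed (use xy in auto)
        then show "z \<le> Sup (S y) - \<bar>f y - f x\<bar>"
          using ext[OF D(1), of y] xy False D by simp
      qed (use xy in auto)
      then show ?thesis by simp
    qed simp
  next
    fix e :: real assume "e > 0"
    then have "V b - e < Sup (S b)" by (simp add: V_def)
    then obtain z where "z \<in> S b" "V b - e < z"
      using less_cSupD[OF ne[OF \<open>a \<le> b\<close>], of "V b - e"] by blast
    then obtain D where "D division_of {a..b}" "V b - e < ?s D"
      by (auto simp: S_def)
    moreover have "V a \<ge> 0"
    proof -
      obtain z where z: "z \<in> S a" using ne[of a] by auto
      then have "0 \<le> z" unfolding S_def by (auto intro: sum_nonneg)
      also have "z \<le> V a" unfolding V_def using z bdd[of a] \<open>a \<le> b\<close> by (intro cSup_upper) auto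
      finally show ?thesis .
    qed
    ultimately show "\<exists>D. D division_of {a..b} \<and> V b - V a - e < ?s D"
      by (intro exI[of _ D]) simp
  qed
qed

text \<open>The intervals contain \<open>x\<close>, possibly as an end point, so a difference
  quotient at \<open>x\<close> from either side qualifies. As they can be taken arbitrarily short,
  they form a Vitali cover of the set of steep points.\<close>

definition steep_at :: "real \<Rightarrow> real \<Rightarrow> real \<Rightarrow> (real \<Rightarrow> real) \<Rightarrow> real \<Rightarrow> bool" where
  "steep_at a b c f x \<longleftrightarrow>
     (\<forall>d>0. \<exists>p q. p < q \<and> p \<le> x \<and> x \<le> q \<and> q - p < d \<and> a \<le> p \<and> q \<le> b \<and> c * (q - p) \<le> f q - f p)"

lemma steep_atE:
  assumes "steep_at a b c f x" "d > 0"
  obtains p q where "p < q" "p \<le> x" "x \<le> q" "q - p < d" "a \<le> p" "q \<le> b" "c * (q - p) \<le> f q - f p"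
  using assms unfolding steep_at_def by blast

lemma steep_at_frequently:
  assumes x: "a < x" "x < b" and fr: "\<exists>\<^sub>F y in at x. c \<le> (f y - f x) / (y - x)"
  shows "steep_at a b c f x"
  unfolding steep_at_def
proof (intro allI impI)
  fix d :: real assume "d > 0"
  have "\<forall>\<^sub>F y in at x. y \<in> ball x d \<inter> {a<..<b} \<and> y \<noteq> x"
    using x \<open>d > 0\<close> by (intro eventually_conj eventually_at_in_open' eventually_neq_at_within) auto
  from frequently_eventually_frequently[OF fr this]
  obtain y where y: "c \<le> (f y - f x) / (y - x)" "\<bar>x - y\<bar> < d" "a < y" "y < b" "y \<noteq> x"
    by (auto dest!: frequently_ex simp: dist_real_def)
  show "\<exists>p q. p < q \<and> p \<le> x \<and> x \<le> q \<and> q - p < d \<and> a \<le> p \<and> q \<le> b \<and> c * (q - p) \<le> f q - f p"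
  proof (cases "x < y")
    case True
    with x y show ?thesis by (intro exI[of _ x] exI[of _ y]) (auto simp: field_simps)
  next
    case False
    with x y show ?thesis by (intro exI[of _ y] exI[of _ x]) (auto simp: field_simps)
  qed
qed

lemma bounded_variation_on_uminus:
  "bounded_variation_on a b f \<Longrightarrow> bounded_variation_on a b (\<lambda>x. - f x)"
  by (simp add: bounded_variation_on_def abs_minus_commute)

text \<open>Tilting by a linear function reduces two arbitrary distinct slopes to a pair of opposite
  slopes.\<close>

lemma bounded_variation_on_diff_linear:
  assumes "bounded_variation_on a b f" "a \<le> b"
  shows "bounded_variation_on a b (\<lambda>x. f x - p * x)"
proof -
  obtain M where M: "\<And>D. D division_of {a..b} \<Longrightarrow> (\<Sum>k\<in>D. \<bar>f (Sup k) - f (Inf k)\<bar>) \<le> M"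
    using assms unfolding bounded_variation_on_def by blast
  have "(\<Sum>k\<in>D. \<bar>f (Sup k) - p * Sup k - (f (Inf k) - p * Inf k)\<bar>) \<le> M + \<bar>p\<bar> * (b - a)"
    if D: "D division_of {a..b}" for D
  proof -
    have "(\<Sum>k\<in>D. \<bar>f (Sup k) - p * Sup k - (f (Inf k) - p * Inf k)\<bar>)
      \<le> (\<Sum>k\<in>D. \<bar>f (Sup k) - f (Inf k)\<bar> + \<bar>p\<bar> * (Sup k - Inf k))"
    proof (rule sum_mono)
      fix k assume k: "k \<in> D"
      have "Inf k \<le> Sup k" by (rule division_of_real_cases[OF D k]) simp
      then have "\<bar>p * (Sup k - Inf k)\<bar> = \<bar>p\<bar> * (Sup k - Inf k)" by (simp add: abs_mult)
      then show "\<bar>f (Sup k) - p * Sup k - (f (Inf k) - p * Inf k)\<bar>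
        \<le> \<bar>f (Sup k) - f (Inf k)\<bar> + \<bar>p\<bar> * (Sup k - Inf k)"
        by (simp add: right_diff_distrib)
    qed
    also have "\<dots> = (\<Sum>k\<in>D. \<bar>f (Sup k) - f (Inf k)\<bar>) + \<bar>p\<bar> * (b - a)"
      using additive_division_1[OF \<open>a \<le> b\<close> D, of "\<lambda>x. x"]
      by (simp add: sum.distrib flip: sum_distrib_left)
    finally show ?thesis using M[OF D] by simp
  qed
  then show ?thesis unfolding bounded_variation_on_def by blast
qed

text \<open>At such a point the variation function \<open>V\<close> is steep with every slope
  \<open>n\<close> as well, so the covering bound \<open>(V b - V a) / n\<close> can be made
  arbitrarily small.\<close>

lemma negligible_steep_unbounded:
  assumes bv: "bounded_variation_on a b f" and ab: "a \<le> b"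
  shows "negligible {x. \<forall>n::nat. steep_at a b (real n) f x}"
  unfolding negligible_outer_le
proof (intro allI impI)
  fix e :: real assume "e > 0"
  obtain V where "\<forall>x y. a \<le> x \<longrightarrow> x \<le> y \<longrightarrow> y \<le> b \<longrightarrow> \<bar>f y - f x\<bar> \<le> V y - V x"
    by (rule bounded_variation_on_majorant[OF bv ab])
  note V = this[rule_format]
  have mono: "mono_on {a..b} V"
  proof (rule mono_onI)
    fix x y assume "x \<in> {a..b}" "y \<in> {a..b}" "x \<le> y"
    then show "V x \<le> V y" using V[of x y] by simp
  qed
  obtain n :: nat where "max ((V b - V a) / e) 0 < real n"
    using reals_Archimedean2 by blast
  then have n: "real n > (V b - V a) / e" "real n > 0" by simp_all
  have steep: "\<exists>p q. p < q \<and> p \<le> x \<and> x \<le> q \<and> q - p < d \<and> a \<le> p \<and> q \<le> b \<and> real n * (q - p) \<le> V q - V p"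
    if x: "x \<in> {x. \<forall>n::nat. steep_at a b (real n) f x}" and "d > 0" for x d
  proof -
    obtain p q where pq: "p < q" "p \<le> x" "x \<le> q" "q - p < d" "a \<le> p" "q \<le> b"
      "real n * (q - p) \<le> f q - f p"
      by (rule steep_atE[OF x[unfolded mem_Collect_eq, rule_format, of n] \<open>d > 0\<close>])
    with V[of p q] show ?thesis by (intro exI[of _ p] exI[of _ q]) auto
  qed
  obtain T where T: "{x. \<forall>n::nat. steep_at a b (real n) f x} \<subseteq> T" "T \<in> lmeasurable"
    "measure lebesgue T \<le> (V b - V a) / real n"
    by (rule outer_measure_steep_mono_on[where E = "{x. \<forall>n::nat. steep_at a b (real n) f x}" and c = "real n",
          OF mono ab n(2) steep])
  have "(V b - V a) / real n \<le> e" using n \<open>e > 0\<close> by (simp add: field_simps)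
  then have "measure lebesgue T \<le> e" using T(3) by (rule order_trans[rotated])
  with T(1,2) show "\<exists>T. {x. \<forall>n::nat. steep_at a b (real n) f x} \<subseteq> T \<and> T \<in> lmeasurable \<and> measure lebesgue T \<le> e"
    by (intro exI[of _ T] conjI)
qed

text \<open>Take a division whose variation sum is within \<open>e\<close> of the total variation. On a cell where
  \<open>f\<close> increases overall, the intervals on which it decreases steeply contribute to the total
  variation but not to the sum, so that their total length is at most of order \<open>e\<close>.\<close>

lemma negligible_steep_up_down:
  assumes bv: "bounded_variation_on a b f" and ab: "a \<le> b" and c: "c > 0"
  shows "negligible {x. steep_at a b c f x \<and> steep_at a b c (\<lambda>x. - f x) x}"
  unfolding negligible_outer_le
proof (intro allI impI)
  let ?E = "{x. steep_at a b c f x \<and> steep_at a b c (\<lambda>x. - f x) x}"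
  fix e :: real assume "e > 0"
  obtain V where "\<forall>x y. a \<le> x \<longrightarrow> x \<le> y \<longrightarrow> y \<le> b \<longrightarrow> \<bar>f y - f x\<bar> \<le> V y - V x"
    "\<forall>e>0. \<exists>D. D division_of {a..b} \<and> V b - V a - e < (\<Sum>k\<in>D. \<bar>f (Sup k) - f (Inf k)\<bar>)"
    by (rule bounded_variation_on_majorant[OF bv ab])
  note V = this(1)[rule_format] and sup = this(2)[rule_format]
  \<comment> \<open>The tolerance is \<open>e * c\<close> because the covering bound on each cell
    divides by the slope \<open>c\<close>.\<close>
  obtain D where D: "D division_of {a..b}"
    and De: "V b - V a - e * c < (\<Sum>k\<in>D. \<bar>f (Sup k) - f (Inf k)\<bar>)"
    using sup[of "e * c"] \<open>e > 0\<close> c by auto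
  define w where "w k = V (Sup k) - V (Inf k) - \<bar>f (Sup k) - f (Inf k)\<bar>" for k
  have "\<exists>T. ?E \<inter> {Inf k<..<Sup k} \<subseteq> T \<and> T \<in> lmeasurable \<and> measure lebesgue T \<le> w k / c"
    if k: "k \<in> D" for k
  proof -
    obtain s t where st: "s \<le> t" "k = {s..t}" "Sup k = t" "Inf k = s"
      by (rule division_of_real_cases[OF D k])
    then have ast: "a \<le> s" "t \<le> b" using division_ofD(2)[OF D k] by auto
    \<comment> \<open>The sign \<sigma> is that of the net increment of \<open>f\<close> on the
      cell. Then \<open>W = V - \<sigma> f\<close> is monotone with total increment
      \<open>w k\<close>, and it rises at least with slope \<open>c\<close> wherever \<sigma> f
      falls with slope \<open>c\<close>. Points of the exceptional set are steep in both directions,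
      so either sign can be served.\<close>
    have key: "\<exists>T. ?E \<inter> {s<..<t} \<subseteq> T \<and> T \<in> lmeasurable \<and> measure lebesgue T \<le> w k / c"
      if \<sigma>: "\<sigma> = 1 \<or> \<sigma> = -1" "\<sigma> * (f t - f s) = \<bar>f t - f s\<bar>" for \<sigma> :: real
    proof -
      define W where "W x = V x - \<sigma> * f x" for x
      have mono: "mono_on {s..t} W"
      proof (rule mono_onI)
        fix x y assume "x \<in> {s..t}" "y \<in> {s..t}" "x \<le> y"
        then show "W x \<le> W y" using V[of x y] ast \<sigma>(1) by (auto simp: W_def abs_le_iff)
      qed
      have steep: "\<exists>p q. p < q \<and> p \<le> x \<and> x \<le> q \<and> q - p < d \<and> s \<le> p \<and> q \<le> t \<and> c * (q - p) \<le> W q - W p"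
        if x: "x \<in> ?E \<inter> {s<..<t}" and "d > 0" for x d
      proof -
        have st: "steep_at a b c (\<lambda>x. - (\<sigma> * f x)) x" using x \<sigma>(1) by auto
        \<comment> \<open>The minimum keeps \<open>p\<close> and \<open>q\<close> inside the cell.
          This works only for interior points; the finitely many end points of cells are covered
          separately by \<open>?F\<close>.\<close>
        have d: "min d (min (x - s) (t - x)) > 0" using x \<open>d > 0\<close> by simp
        obtain p q where pq: "p < q" "p \<le> x" "x \<le> q" "q - p < min d (min (x - s) (t - x))"
          "a \<le> p" "q \<le> b" "c * (q - p) \<le> - (\<sigma> * f q) - - (\<sigma> * f p)"
          by (rule steep_atE[OF st d])
        have "0 \<le> V q - V p" using V[of p q] pq by simp
        with pq have "c * (q - p) \<le> W q - W p" by (simp add: W_def)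
        with pq show ?thesis by (intro exI[of _ p] exI[of _ q]) auto
      qed
      obtain T where "?E \<inter> {s<..<t} \<subseteq> T" "T \<in> lmeasurable" "measure lebesgue T \<le> (W t - W s) / c"
        by (rule outer_measure_steep_mono_on[where E = "?E \<inter> {s<..<t}", OF mono \<open>s \<le> t\<close> c steep])
      moreover have "W t - W s = w k"
        using \<sigma>(2) st by (simp add: W_def w_def right_diff_distrib)
      ultimately show ?thesis by metis
    qed
    show ?thesis
      unfolding st(3,4) by (rule key[of "if f s \<le> f t then 1 else -1"]) auto
  qed
  then have "\<exists>T. \<forall>k\<in>D. ?E \<inter> {Inf k<..<Sup k} \<subseteq> T k \<and> T k \<in> lmeasurable
      \<and> measure lebesgue (T k) \<le> w k / c"
    by (intro bchoice ballI)
  then obtain T where T': "\<forall>k\<in>D. ?E \<inter> {Inf k<..<Sup k} \<subseteq> T k \<and> T k \<in> lmeasurable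
      \<and> measure lebesgue (T k) \<le> w k / c" ..
  have T: "?E \<inter> {Inf k<..<Sup k} \<subseteq> T k" "T k \<in> lmeasurable" "measure lebesgue (T k) \<le> w k / c"
    if "k \<in> D" for k using bspec[OF T' that] by simp_all
  have fin: "finite D" using D by blast
  let ?F = "Inf ` D \<union> Sup ` D"
  have F: "negligible ?F" using fin by (intro negligible_finite) auto
  have U: "(\<Union>k\<in>D. T k) \<in> lmeasurable" using fin T(2) by (rule fmeasurable.finite_UN)
  have "measure lebesgue (?F \<union> (\<Union>k\<in>D. T k)) = measure lebesgue (\<Union>k\<in>D. T k)"
    by (rule measure_negligible_symdiff[OF U]) (rule negligible_subset[OF F], auto)
  also have "\<dots> \<le> (\<Sum>k\<in>D. measure lebesgue (T k))"
    using fin T(2) by (intro measure_UNION_le fmeasurableD)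
  also have "\<dots> \<le> (\<Sum>k\<in>D. w k / c)"
    by (intro sum_mono T)
  also have "\<dots> = (V b - V a - (\<Sum>k\<in>D. \<bar>f (Sup k) - f (Inf k)\<bar>)) / c"
    using additive_division_1[OF ab D, of V] by (simp add: w_def sum_subtractf flip: sum_divide_distrib)
  also have "\<dots> \<le> e" using De c by (simp add: field_simps)
  finally have m: "measure lebesgue (?F \<union> (\<Union>k\<in>D. T k)) \<le> e" .
  have "?E \<subseteq> ?F \<union> (\<Union>k\<in>D. T k)"
  proof
    fix x assume x: "x \<in> ?E"
    then have "steep_at a b c f x" by simp
    then obtain p q where "p \<le> x" "x \<le> q" "a \<le> p" "q \<le> b"
      by (rule steep_atE[OF _ zero_less_one])
    then have "a \<le> x" "x \<le> b" by auto
    then obtain k where k: "k \<in> D" "x \<in> k" using division_ofD(6)[OF D] by (metis UnionE atLeastAtMost_iff)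
    obtain s t where st: "s \<le> t" "k = {s..t}" "Sup k = t" "Inf k = s"
      by (rule division_of_real_cases[OF D k(1)])
    show "x \<in> ?F \<union> (\<Union>k\<in>D. T k)"
    proof (cases "x = s \<or> x = t")
      case True
      then have "x = Inf k \<or> x = Sup k" using st by simp
      then show ?thesis using k(1) by blast
    next
      case False
      then have "x \<in> {Inf k<..<Sup k}" using st k by auto
      then show ?thesis using T(1)[OF k(1)] k(1) x by blast
    qed
  qed
  moreover have "?F \<union> (\<Union>k\<in>D. T k) \<in> lmeasurable"
    by (intro fmeasurable.Un U negligible_imp_measurable F)
  ultimately show "\<exists>T. ?E \<subseteq> T \<and> T \<in> lmeasurable \<and> measure lebesgue T \<le> e"
    using m by blast
qed

text \<open>If the lower limit were below the upper limit, two rationals would fit between them, and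
  \<open>Q\<close> would frequently lie above the larger and below the smaller one. The first two
  conditions exclude infinite limits. Lower bounds are phrased for \<open>- Q\<close> because they
  are matched with steepness of \<open>- f\<close>.\<close>

lemma tendsto_if_no_oscillation:
  fixes Q :: "'a \<Rightarrow> real"
  assumes F: "F \<noteq> bot"
    and up: "\<exists>n::nat. \<not> (\<exists>\<^sub>F y in F. real n \<le> Q y)"
    and down: "\<exists>n::nat. \<not> (\<exists>\<^sub>F y in F. real n \<le> - Q y)"
    and osc: "\<And>r s::rat. r < s \<Longrightarrow>
      \<not> ((\<exists>\<^sub>F y in F. of_rat s \<le> Q y) \<and> (\<exists>\<^sub>F y in F. - of_rat r \<le> - Q y))"
  shows "\<exists>l. (Q \<longlongrightarrow> l) F"
proof -
  let ?L = "Liminf F (\<lambda>y. ereal (Q y))" and ?U = "Limsup F (\<lambda>y. ereal (Q y))"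
  obtain n :: nat where n: "\<forall>\<^sub>F y in F. Q y < real n"
    using up unfolding not_frequently not_le by blast
  obtain m :: nat where m: "\<forall>\<^sub>F y in F. - Q y < real m"
    using down unfolding not_frequently not_le by blast
  have U: "?U \<le> ereal (real n)"
    by (rule Limsup_bounded, rule eventually_mono[OF n]) simp
  have L: "ereal (- real m) \<le> ?L"
    by (rule Liminf_bounded, rule eventually_mono[OF m]) simp
  have LU: "?L \<le> ?U" by (rule Liminf_le_Limsup[OF F])
  have eq: "?L = ?U"
  proof (rule ccontr)
    assume "?L \<noteq> ?U"
    with LU have "?L < ?U" by simp
    then obtain r where r: "?L < ereal (real_of_rat r)" "ereal (real_of_rat r) < ?U"
      using ereal_dense3[of ?L ?U] by blast
    from r(2) obtain s where s: "ereal (real_of_rat r) < ereal (real_of_rat s)" "ereal (real_of_rat s) < ?U"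
      using ereal_dense3[of "ereal (real_of_rat r)" ?U] by blast
    have "\<exists>\<^sub>F y in F. of_rat s \<le> Q y"
    proof (rule ccontr)
      assume "\<not> ?thesis"
      then have *: "\<forall>\<^sub>F y in F. Q y < of_rat s" unfolding not_frequently not_le .
      have "?U \<le> ereal (of_rat s)"
        by (rule Limsup_bounded, rule eventually_mono[OF *]) simp
      with s show False by simp
    qed
    moreover have "\<exists>\<^sub>F y in F. - of_rat r \<le> - Q y"
    proof (rule ccontr)
      assume "\<not> ?thesis"
      then have *: "\<forall>\<^sub>F y in F. of_rat r < Q y" unfolding not_frequently by (simp add: not_le)
      have "ereal (of_rat r) \<le> ?L"
        by (rule Liminf_bounded, rule eventually_mono[OF *]) simp
      with r show False by simp
    qed
    ultimately show False using osc[of r s] s by (simp add: of_rat_less)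
  qed
  obtain l where l: "?L = ereal l"
  proof -
    have "\<bar>?L\<bar> \<noteq> \<infinity>" using L order_trans[OF LU U] by auto
    then show ?thesis using ereal_real' that by metis
  qed
  have "((\<lambda>y. ereal (Q y)) \<longlongrightarrow> ereal l) F"
    by (rule Liminf_eq_Limsup[OF F l]) (rule trans[OF eq[symmetric] l])
  then show ?thesis by auto
qed

text \<open>The exceptional set has three kinds of points: quotients unbounded above, unbounded
  below, or oscillating across some gap between rationals \<open>r < s\<close>. Rational gaps keep
  the union countable.\<close>

lemma bounded_variation_on_ae_differentiable:
  assumes bv: "bounded_variation_on a b f" and ab: "a \<le> b"
  obtains N where "negligible N" "\<And>x. x \<in> {a<..<b} - N \<Longrightarrow> f differentiable (at x)"
proof -
  define E where "E = (\<lambda>(r::rat, s::rat). if r < s then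
     {x. steep_at a b (of_rat s) f x \<and> steep_at a b (- of_rat r) (\<lambda>x. - f x) x} else {})"
  define N where "N = {x. \<forall>n::nat. steep_at a b (real n) f x}
     \<union> {x. \<forall>n::nat. steep_at a b (real n) (\<lambda>x. - f x) x} \<union> (\<Union>i. E i)"
  have shift: "steep_at a b (c - p) (\<lambda>x. g x - p * x) x" if "steep_at a b c g x" for c p g x
    using that unfolding steep_at_def by (simp add: algebra_simps)
  have "negligible (E i)" for i
  proof -
    obtain r s where i: "i = (r, s)" by fastforce
    show ?thesis
    proof (cases "r < s")
      case True
      \<comment> \<open>Subtracting the mean slope \<open>p\<close> turns the slopes
        \<open>s\<close> and \<open>r\<close> into \<open>c\<close> and \<open>- c\<close>.\<close>
      define p c where "p = (of_rat r + of_rat s) / (2::real)" and "c = (of_rat s - of_rat r) / (2::real)"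
      have c: "c > 0" using True by (simp add: c_def of_rat_less)
      have "E i \<subseteq> {x. steep_at a b c (\<lambda>x. f x - p * x) x \<and> steep_at a b c (\<lambda>x. - (f x - p * x)) x}"
      proof
        fix x assume "x \<in> E i"
        then have "steep_at a b (of_rat s) f x" "steep_at a b (- of_rat r) (\<lambda>x. - f x) x"
          using True by (auto simp: E_def i)
        from shift[OF this(1), of p] shift[OF this(2), of "-p"]
        have "steep_at a b (of_rat s - p) (\<lambda>x. f x - p * x) x"
          "steep_at a b (- of_rat r + p) (\<lambda>x. - (f x - p * x)) x"
          by simp_all
        moreover have "of_rat s - p = c" "- of_rat r + p = c"
          by (simp_all add: p_def c_def field_simps)
        ultimately show "x \<in> {x. steep_at a b c (\<lambda>x. f x - p * x) x \<and> steep_at a b c (\<lambda>x. - (f x - p * x)) x}"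
          by simp
      qed
      then show ?thesis
        by (rule negligible_subset[OF negligible_steep_up_down[OF bounded_variation_on_diff_linear[OF bv ab] ab c]])
    qed (simp add: E_def i)
  qed
  then have "negligible (\<Union>(range E))"
    by (intro negligible_countable_Union) auto
  then have N: "negligible N"
    unfolding N_def
    by (intro negligible_Un negligible_steep_unbounded[OF _ ab] bv bounded_variation_on_uminus)
  have "f differentiable (at x)" if x: "x \<in> {a<..<b} - N" for x
  proof -
    let ?Q = "\<lambda>y. (f y - f x) / (y - x)"
    have ax: "a < x" "x < b" using x by auto
    have st: "steep_at a b c f x" if "\<exists>\<^sub>F y in at x. c \<le> ?Q y" for c
      using steep_at_frequently[OF ax that] .
    have st': "steep_at a b c (\<lambda>x. - f x) x" if "\<exists>\<^sub>F y in at x. c \<le> - ?Q y" for c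
    proof -
      have "- ?Q y = (- f y - - f x) / (y - x)" for y by (simp add: minus_divide_left)
      with that show ?thesis by (intro steep_at_frequently[OF ax]) simp
    qed
    have "\<exists>l. (?Q \<longlongrightarrow> l) (at x)"
    proof (rule tendsto_if_no_oscillation)
      show "\<exists>n::nat. \<not> (\<exists>\<^sub>F y in at x. real n \<le> ?Q y)"
      proof -
        obtain n :: nat where "\<not> steep_at a b (real n) f x" using x by (auto simp: N_def)
        then show ?thesis using st[of "real n"] by blast
      qed
      show "\<exists>n::nat. \<not> (\<exists>\<^sub>F y in at x. real n \<le> - ?Q y)"
      proof -
        obtain n :: nat where "\<not> steep_at a b (real n) (\<lambda>x. - f x) x" using x by (auto simp: N_def)
        then show ?thesis using st'[of "real n"] by blast
      qed
      fix r s :: rat assume rs: "r < s"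
      have "x \<notin> E (r, s)" using x by (auto simp: N_def)
      then show "\<not> ((\<exists>\<^sub>F y in at x. of_rat s \<le> ?Q y) \<and> (\<exists>\<^sub>F y in at x. - of_rat r \<le> - ?Q y))"
        using st[of "of_rat s"] st'[of "- of_rat r"] rs by (simp add: E_def) blast
    qed simp
    then obtain l where "(?Q \<longlongrightarrow> l) (at x)" ..
    then have "(f has_field_derivative l) (at x)" unfolding has_field_derivative_iff .
    then show ?thesis unfolding real_differentiable_def ..
  qed
  then show ?thesis by (rule that[OF N])
qed

section \<open>Absolutely continuous functions\<close>

lemma abs_cont_onE:
  assumes "abs_cont_on a b f" "e > 0"
  obtains d where "d > 0" "\<And>D. D division_of \<Union>D \<Longrightarrow> \<Union>D \<subseteq> {a..b} \<Longrightarrow> (\<Sum>k\<in>D. Sup k - Inf k) < d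
        \<Longrightarrow> (\<Sum>k\<in>D. \<bar>f (Sup k) - f (Inf k)\<bar>) < e"
proof -
  have "\<exists>d>0. \<forall>D. D division_of \<Union>D \<and> \<Union>D \<subseteq> {a..b} \<and> (\<Sum>k\<in>D. Sup k - Inf k) < d
        \<longrightarrow> (\<Sum>k\<in>D. \<bar>f (Sup k) - f (Inf k)\<bar>) < e"
    using assms(1) unfolding abs_cont_on_def by (rule allE[of _ e]) (simp add: assms(2))
  then obtain d where d: "d > 0" "\<forall>D. D division_of \<Union>D \<and> \<Union>D \<subseteq> {a..b} \<and> (\<Sum>k\<in>D. Sup k - Inf k) < d
        \<longrightarrow> (\<Sum>k\<in>D. \<bar>f (Sup k) - f (Inf k)\<bar>) < e"
    by (elim exE conjE)
  show ?thesis
    by (rule that[OF d(1)]) (rule d(2)[THEN spec, THEN mp], simp)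
qed

lemma abs_cont_on_subinterval:
  "abs_cont_on a b f \<Longrightarrow> a \<le> c \<Longrightarrow> d \<le> b \<Longrightarrow> abs_cont_on c d f"
proof -
  assume ac: "abs_cont_on a b f" and "a \<le> c" "d \<le> b"
  then have "{c..d} \<subseteq> {a..b}" by auto
  then show ?thesis
    using ac unfolding abs_cont_on_def by (meson order_trans)
qed

lemma abs_cont_on_imp_continuous_on:
  assumes "abs_cont_on a b f"
  shows "continuous_on {a..b} f"
  unfolding continuous_on_iff
proof (intro ballI allI impI)
  fix x e :: real assume x: "x \<in> {a..b}" and "e > 0"
  obtain d where d: "d > 0" "\<And>D. D division_of \<Union>D \<Longrightarrow> \<Union>D \<subseteq> {a..b} \<Longrightarrow> (\<Sum>k\<in>D. Sup k - Inf k) < d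
        \<Longrightarrow> (\<Sum>k\<in>D. \<bar>f (Sup k) - f (Inf k)\<bar>) < e"
    by (rule abs_cont_onE[OF assms \<open>e > 0\<close>]) (rule that)
  have *: "\<bar>f t - f s\<bar> < e" if "s \<le> t" "a \<le> s" "t \<le> b" "t - s < d" for s t
  proof -
    have "{{s..t}} division_of {s..t}" using that division_of_self[of s t] by auto
    with d(2)[of "{{s..t}}"] that show ?thesis by simp
  qed
  have "\<forall>y\<in>{a..b}. dist y x < d \<longrightarrow> dist (f y) (f x) < e"
  proof (intro ballI impI)
    fix y assume "y \<in> {a..b}" "dist y x < d"
    then show "dist (f y) (f x) < e"
      using *[of x y] *[of y x] x by (cases "x \<le> y") (auto simp: dist_real_def abs_minus_commute)
  qed
  with \<open>d > 0\<close> show "\<exists>d>0. \<forall>y\<in>{a..b}. dist y x < d \<longrightarrow> dist (f y) (f x) < e" by blast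
qed

lemma sum_UN_le:
  fixes t :: "'b \<Rightarrow> real"
  assumes "finite I" "\<And>i. i \<in> I \<Longrightarrow> finite (A i)" "\<And>x. 0 \<le> t x"
  shows "sum t (\<Union>i\<in>I. A i) \<le> (\<Sum>i\<in>I. sum t (A i))"
  using assms(1,2)
proof (induction I rule: finite_induct)
  case (insert i I)
  have "sum t (A i \<union> (\<Union>i\<in>I. A i)) \<le> sum t (A i) + sum t (\<Union>i\<in>I. A i)"
    using sum.union_inter[of "A i" "\<Union>i\<in>I. A i" t] insert.hyps insert.prems
      sum_nonneg[of "A i \<inter> (\<Union>i\<in>I. A i)" t] assms(3) by simp
  with insert show ?case by simp
qed simp

text \<open>A cell of a division either lies in a cell of a fixed grid or has a grid point in its
  interior; absolute continuity controls the former cells, and there are few of the latter.\<close>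

lemma abs_cont_on_imp_bounded_variation_on:
  assumes ac: "abs_cont_on a b f" and ab: "a \<le> b"
  shows "bounded_variation_on a b f"
proof -
  obtain d where d: "d > 0" "\<And>D. D division_of \<Union>D \<Longrightarrow> \<Union>D \<subseteq> {a..b} \<Longrightarrow> (\<Sum>k\<in>D. Sup k - Inf k) < d
        \<Longrightarrow> (\<Sum>k\<in>D. \<bar>f (Sup k) - f (Inf k)\<bar>) < 1"
    by (rule abs_cont_onE[OF ac zero_less_one]) (rule that)
  have "bounded (f ` {a..b})"
    by (intro compact_imp_bounded compact_continuous_image abs_cont_on_imp_continuous_on[OF ac]) auto
  then obtain B where "\<forall>x\<in>{a..b}. \<bar>f x\<bar> \<le> B"
    unfolding bounded_real by auto
  note B = this[rule_format]
  \<comment> \<open>Half of \<open>d\<close>, so that division cells inside one grid cell have total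
    length strictly below \<open>d\<close>.\<close>
  define h where "h = d / 2"
  have h: "h > 0" using d by (simp add: h_def)
  define g where "g i = a + real i * h" for i :: nat
  \<comment> \<open>The extra 1 is there because the grid point to be counted may be the right end
    \<open>g (Suc i)\<close> of the grid cell that contains the left end of
    \<open>k\<close>.\<close>
  define m where "m = nat \<lceil>(b - a) / h\<rceil> + 1"
  have "(\<Sum>k\<in>D. \<bar>f (Sup k) - f (Inf k)\<bar>) \<le> (\<Sum>i\<le>m. 1 + 2 * B)" if D: "D division_of {a..b}" for D
  proof -
    let ?t = "\<lambda>k. \<bar>f (Sup k) - f (Inf k)\<bar>"
    have fin: "finite D" using D by blast
    define X where "X i = {k\<in>D. k \<subseteq> {g i..g (Suc i)}}" for i
    define Y where "Y i = {k\<in>D. g i \<in> interior k}" for i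
    have cover: "D \<subseteq> (\<Union>i\<le>m. X i \<union> Y i)"
    proof
      fix k assume k: "k \<in> D"
      obtain s t where st: "s \<le> t" "k = {s..t}"
        by (rule division_of_real_cases[OF D k])
      then have ast: "a \<le> s" "t \<le> b" using division_ofD(2)[OF D k] by auto
      define i where "i = nat \<lfloor>(s - a) / h\<rfloor>"
      have "real i = of_int \<lfloor>(s - a) / h\<rfloor>" using ast h by (simp add: i_def)
      then have "real i \<le> (s - a) / h" "(s - a) / h < real i + 1" by linarith+
      then have gi: "g i \<le> s" "s < g (Suc i)" using h by (auto simp: g_def field_simps)
      have "(s - a) / h \<le> (b - a) / h" using ast st h by (intro divide_right_mono) auto
      then have "\<lfloor>(s - a) / h\<rfloor> \<le> \<lceil>(b - a) / h\<rceil>" by linarith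
      then have im: "Suc i \<le> m" unfolding i_def m_def using nat_mono by simp
      show "k \<in> (\<Union>i\<le>m. X i \<union> Y i)"
      proof (cases "t \<le> g (Suc i)")
        case True
        then have "k \<in> X i" using gi st k by (auto simp: X_def)
        with im show ?thesis by (intro UN_I[of i]) auto
      next
        case False
        then have "k \<in> Y (Suc i)" using gi st k by (auto simp: Y_def)
        with im show ?thesis by (intro UN_I[of "Suc i"]) auto
      qed
    qed
    have sub: "X i \<subseteq> D" "Y i \<subseteq> D" for i by (auto simp: X_def Y_def)
    have XY: "finite (X i)" "finite (Y i)" for i
      using finite_subset[OF sub(1) fin] finite_subset[OF sub(2) fin] .
    have divX: "X i division_of \<Union>(X i)" for i
      using D division_ofD(6)[OF D] by (intro division_of_subset[OF _ sub(1)]) simp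
    have boundX: "sum ?t (X i) \<le> 1" for i
    proof -
      have "(\<Sum>k\<in>X i. Sup k - Inf k) \<le> g (Suc i) - g i"
        using sum_increments_mono_on_le[OF _ _ divX, of "g i" "g (Suc i)" "\<lambda>x. x"] h
        by (auto simp: X_def g_def mono_on_def)
      also have "\<dots> < d" using d by (simp add: g_def h_def algebra_simps)
      finally have "sum ?t (X i) < 1"
      proof (intro d(2) divX)
        show "\<Union>(X i) \<subseteq> {a..b}"
          using sub(1)[of i] division_ofD(6)[OF D] by blast
      qed
      then show ?thesis by simp
    qed
    have boundY: "sum ?t (Y i) \<le> 2 * B" for i
    proof -
      \<comment> \<open>Distinct cells have disjoint interiors, so a grid point is interior to at
        most one of them.\<close>
      have "card (Y i) \<le> 1"
      proof (rule ccontr)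
        assume "\<not> ?thesis"
        then obtain k k' where "k \<in> Y i" "k' \<in> Y i" "k \<noteq> k'"
          by (metis One_nat_def XY(2) card_le_Suc0_iff_eq)
        then show False using division_ofD(5)[OF D, of k k'] by (auto simp: Y_def)
      qed
      moreover have "?t k \<le> 2 * B" if k: "k \<in> Y i" for k
      proof -
        have kD: "k \<in> D" using k sub by blast
        obtain s t where st: "s \<le> t" "k = {s..t}" "Sup k = t" "Inf k = s"
          by (rule division_of_real_cases[OF D kD])
        then have "s \<in> {a..b}" "t \<in> {a..b}" using division_ofD(2)[OF D kD] by auto
        then show ?thesis using B[of s] B[of t] st by simp
      qed
      ultimately have "sum ?t (Y i) \<le> real (card (Y i)) * (2 * B)"
        using sum_bounded_above[of "Y i" ?t "2 * B"] by simp
      also have "\<dots> \<le> 1 * (2 * B)"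
        using \<open>card (Y i) \<le> 1\<close> B[of a] ab by (intro mult_right_mono) auto
      finally show ?thesis by simp
    qed
    have "sum ?t D \<le> sum ?t (\<Union>i\<le>m. X i \<union> Y i)"
      using cover XY by (intro sum_mono2) auto
    also have "\<dots> \<le> (\<Sum>i\<le>m. sum ?t (X i \<union> Y i))"
      by (rule sum_UN_le) (use XY in simp_all)
    also have "\<dots> \<le> (\<Sum>i\<le>m. 1 + 2 * B)"
    proof (rule sum_mono)
      fix i
      have "sum ?t (X i \<union> Y i) \<le> sum ?t (X i) + sum ?t (Y i)"
      proof -
        have "0 \<le> sum ?t (X i \<inter> Y i)" by (rule sum_nonneg) simp
        then show ?thesis using sum.union_inter[OF XY, of ?t i i] by linarith
      qed
      then show "sum ?t (X i \<union> Y i) \<le> 1 + 2 * B" using boundX[of i] boundY[of i] by simp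
    qed
    finally show ?thesis .
  qed
  then show ?thesis unfolding bounded_variation_on_def by blast
qed

section \<open>The fundamental theorem of calculus for absolutely continuous functions\<close>

lemma sum_tagged_partial_division_increments:
  fixes t :: "real set \<Rightarrow> real"
  assumes p: "p tagged_partial_division_of S" and t: "\<And>u. t {u} = 0"
  shows "(\<Sum>(x, k)\<in>p. t k) = (\<Sum>k\<in>snd ` p. t k)"
proof -
  have "sum t (snd ` p) = sum (t \<circ> snd) p"
  proof (rule sum.reindex_nontrivial)
    show "finite p" using tagged_partial_division_ofD(1)[OF p] .
    fix y z assume yz: "y \<in> p" "z \<in> p" "y \<noteq> z" "snd y = snd z"
    obtain x k x' where xk: "y = (x, k)" "z = (x', k)"
      using yz(4) by (metis prod.collapse)
    have "x \<in> k" using tagged_partial_division_ofD(2)[OF p, of x k] xk yz by auto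
    obtain u v where k: "k = cbox u v"
      using tagged_partial_division_ofD(4)[OF p, of x k] xk yz by auto
    \<comment> \<open>A cell occurring with two different tags has empty interior, hence is a single
      point, where \<open>t\<close> vanishes. So nothing is lost by forgetting the tags.\<close>
    have "interior k \<inter> interior k = {}"
      using tagged_partial_division_ofD(5)[OF p, of x k x' k] xk yz by auto
    then have "v \<le> u" using k by auto
    with \<open>x \<in> k\<close> k have "k = {u}" by auto
    then show "t (snd y) = 0" using t xk by simp
  qed
  then show ?thesis by (simp add: case_prod_unfold comp_def)
qed

lemma tagged_partial_division_real_cases:
  fixes p :: "(real \<times> real set) set"
  assumes "p tagged_partial_division_of S" "(x, k) \<in> p"
  obtains s t where "s \<le> x" "x \<le> t" "k = {s..t}" "Sup k = t" "Inf k = s" "k \<subseteq> S"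
proof -
  obtain s t where k: "k = cbox s t" "x \<in> k" "k \<subseteq> S"
    using tagged_partial_division_ofD(2,3,4)[OF assms] by blast
  then have "s \<le> x" "x \<le> t" by auto
  with k show ?thesis by (intro that[of s t]) auto
qed

text \<open>The gauge integral is computed directly. Cells tagged outside \<open>N\<close> are
  handled by the derivative. Cells tagged in \<open>N\<close> are confined to an open set of measure
  below \<open>d\<close>, so absolute continuity makes their increments of \<open>f\<close> small in
  sum, while \<open>g\<close>, set to 0 on \<open>N\<close>, contributes nothing there.\<close>

lemma fundamental_theorem_abs_cont_on:
  assumes ac: "abs_cont_on a b f" and ab: "a \<le> b" and N: "negligible N"
    and der: "\<And>x. x \<in> {a..b} - N \<Longrightarrow> (f has_vector_derivative f' x) (at x within {a..b})"
  shows "(f' has_integral f b - f a) {a..b}"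
proof -
  define g where "g x = (if x \<in> N then 0 else f' x)" for x
  have "(g has_integral f b - f a) {a..b}"
    unfolding has_integral_real
  proof (intro allI impI)
    fix e :: real assume e: "e > 0"
    obtain d where d: "d > 0" "\<And>D. D division_of \<Union>D \<Longrightarrow> \<Union>D \<subseteq> {a..b} \<Longrightarrow> (\<Sum>k\<in>D. Sup k - Inf k) < d
        \<Longrightarrow> (\<Sum>k\<in>D. \<bar>f (Sup k) - f (Inf k)\<bar>) < e / 2"
      by (rule abs_cont_onE[OF ac, of "e / 2"]) (use e in simp, rule that)
    obtain U where U: "open U" "N \<subseteq> U" "U \<in> lmeasurable" "measure lebesgue U < d"
    proof -
      obtain U where "open U" "N \<subseteq> U" "U - N \<in> lmeasurable" "emeasure lebesgue (U - N) < ennreal d"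
        using sets_lebesgue_outer_open[of N d] d N negligible_imp_sets by blast
      moreover have "U = (U - N) \<union> N" using \<open>N \<subseteq> U\<close> by blast
      moreover have "measure lebesgue ((U - N) \<union> N) = measure lebesgue (U - N)"
        by (rule measure_negligible_symdiff) (use \<open>U - N \<in> lmeasurable\<close> in simp, rule negligible_subset[OF N], auto)
      moreover have "(U - N) \<union> N \<in> lmeasurable"
        using \<open>U - N \<in> lmeasurable\<close> negligible_imp_measurable[OF N] by (rule fmeasurable.Un)
      moreover have "measure lebesgue (U - N) < d"
        using \<open>emeasure lebesgue (U - N) < ennreal d\<close> \<open>U - N \<in> lmeasurable\<close> d(1)
        by (simp add: emeasure_eq_measure2 ennreal_less_iff)
      ultimately show ?thesis using that by metis
    qed
    \<comment> \<open>The tolerance for difference quotients; the added 1 keeps the denominator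
      positive also for \<open>a = b\<close>.\<close>
    define c where "c = e / 2 / (b - a + 1)"
    have c: "c > 0" using e ab by (simp add: c_def)
    have "c * (b - a) < c * (b - a + 1)" using c by simp
    also have "\<dots> = e / 2" unfolding c_def using ab by (intro nonzero_eq_divide_eq[THEN iffD1, OF _ refl]) auto
    finally have cb: "c * (b - a) < e / 2" .
    have "\<exists>r>0. \<forall>y\<in>{a..b}. \<bar>y - x\<bar> < r \<longrightarrow> \<bar>f y - f x - (y - x) * f' x\<bar> \<le> c * \<bar>y - x\<bar>"
      if "x \<in> {a..b} - N" for x
      using der[OF that] c unfolding has_vector_derivative_def has_derivative_within_alt by force
    then obtain r where r: "\<forall>x\<in>{a..b} - N. r x > 0 \<and>
        (\<forall>y\<in>{a..b}. \<bar>y - x\<bar> < r x \<longrightarrow> \<bar>f y - f x - (y - x) * f' x\<bar> \<le> c * \<bar>y - x\<bar>)"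
      by (rule bchoice[rule_format, THEN exE])
    \<comment> \<open>Only the first two branches matter; the unit balls outside
      \<open>{a..b}\<close> merely make \<gamma> a gauge on the whole line.\<close>
    define \<gamma> where "\<gamma> x = (if x \<in> N then U else if x \<in> {a..b} then ball x (r x) else ball x 1)" for x
    have gauge: "gauge \<gamma>"
      unfolding gauge_def \<gamma>_def using U r by auto
    have main: "norm ((\<Sum>(x, k)\<in>p. measure lborel k *\<^sub>R g x) - (f b - f a)) < e"
      if p: "p tagged_division_of {a..b}" and fine: "\<gamma> fine p" for p
    proof -
      let ?q = "{(x, k)\<in>p. x \<in> N}"
      have pp: "p tagged_partial_division_of {a..b}" using p by (simp add: tagged_division_of_def)
      have fin: "finite p" using p by blast
      have q: "?q tagged_partial_division_of {a..b}"
        by (rule tagged_partial_division_subset[OF pp]) auto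
      have nq: "p - ?q tagged_partial_division_of {a..b}"
        by (rule tagged_partial_division_subset[OF pp]) auto
      \<comment> \<open>Splitting the increment at the tag \<open>x\<close> applies the derivative
        estimate to both end points, and the two error bounds add up to \<open>c\<close> times the
        length of the cell.\<close>
      have good: "\<bar>measure lborel k * g x - (f (Sup k) - f (Inf k))\<bar> \<le> c * (Sup k - Inf k)"
        if xk: "(x, k) \<in> p - ?q" for x k
      proof -
        obtain s t where st: "s \<le> x" "x \<le> t" "k = {s..t}" "Sup k = t" "Inf k = s" "k \<subseteq> {a..b}"
          by (rule tagged_partial_division_real_cases[OF nq xk])
        have x: "x \<in> {a..b} - N" using xk st by auto
        then have "k \<subseteq> ball x (r x)" using fineD[OF fine, of x k] xk by (auto simp: \<gamma>_def)
        moreover have "s \<in> k" "t \<in> k" using st by auto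
        ultimately have "s \<in> ball x (r x)" "t \<in> ball x (r x)" "s \<in> {a..b}" "t \<in> {a..b}"
          using st(6) by blast+
        then have "\<bar>f s - f x - (s - x) * f' x\<bar> \<le> c * \<bar>s - x\<bar>"
          "\<bar>f t - f x - (t - x) * f' x\<bar> \<le> c * \<bar>t - x\<bar>"
          using r[rule_format, OF x] by (auto simp: dist_real_def abs_minus_commute)
        moreover have "measure lborel k * g x = (t - x) * f' x - (s - x) * f' x"
          using st x by (simp add: g_def algebra_simps)
        moreover have "c * \<bar>s - x\<bar> + c * \<bar>t - x\<bar> = c * (t - s)"
          using st by (simp add: algebra_simps)
        ultimately show ?thesis using st(4,5) by (simp add: abs_le_iff)
      qed
      have div: "snd ` ?q division_of \<Union>(snd ` ?q)"
        by (rule partial_division_of_tagged_division[OF q])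
      have sub: "\<Union>(snd ` ?q) \<subseteq> {a..b}"
        using tagged_partial_division_ofD(3)[OF q] by fastforce
      have subU: "\<Union>(snd ` ?q) \<subseteq> U"
        using fine unfolding fine_def \<gamma>_def by fastforce
      have "(\<Sum>k\<in>snd ` ?q. Sup k - Inf k) = (\<Sum>k\<in>snd ` ?q. measure lebesgue k)"
      proof (rule sum.cong[OF refl])
        fix k assume k: "k \<in> snd ` ?q"
        obtain s t where "s \<le> t" "k = {s..t}" "Sup k = t" "Inf k = s"
          by (rule division_of_real_cases[OF div k])
        then show "Sup k - Inf k = measure lebesgue k" by simp
      qed
      also have "\<dots> = measure lebesgue (\<Union>(snd ` ?q))" by (rule content_division[OF div])
      also have "\<dots> \<le> measure lebesgue U"
        using lmeasurable_division[OF div] U(3) by (intro measure_mono_fmeasurable subU) auto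
      also have "\<dots> < d" by (rule U(4))
      finally have bad: "(\<Sum>k\<in>snd ` ?q. \<bar>f (Sup k) - f (Inf k)\<bar>) < e / 2"
        by (rule d(2)[OF div sub])
      have "(\<Sum>(x, k)\<in>p. measure lborel k *\<^sub>R g x) - (f b - f a)
          = (\<Sum>(x, k)\<in>p. measure lborel k * g x - (f (Sup k) - f (Inf k)))"
        using additive_tagged_division_1[OF ab p, of f] by (simp add: case_prod_unfold sum_subtractf)
      also have "\<bar>\<dots>\<bar> \<le> (\<Sum>(x, k)\<in>p. \<bar>measure lborel k * g x - (f (Sup k) - f (Inf k))\<bar>)"
        unfolding case_prod_unfold by (rule sum_abs)
      also have "\<dots> = (\<Sum>(x, k)\<in>p - ?q. \<bar>measure lborel k * g x - (f (Sup k) - f (Inf k))\<bar>)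
          + (\<Sum>(x, k)\<in>?q. \<bar>measure lborel k * g x - (f (Sup k) - f (Inf k))\<bar>)"
        by (rule sum.subset_diff[OF _ fin]) auto
      also have "(\<Sum>(x, k)\<in>?q. \<bar>measure lborel k * g x - (f (Sup k) - f (Inf k))\<bar>)
          = (\<Sum>(x, k)\<in>?q. \<bar>f (Sup k) - f (Inf k)\<bar>)"
        by (rule sum.cong) (auto simp: g_def abs_minus_commute)
      also have "\<dots> = (\<Sum>k\<in>snd ` ?q. \<bar>f (Sup k) - f (Inf k)\<bar>)"
        by (rule sum_tagged_partial_division_increments[OF q]) simp
      also have "\<dots> < e / 2" by (rule bad)
      also have "(\<Sum>(x, k)\<in>p - ?q. \<bar>measure lborel k * g x - (f (Sup k) - f (Inf k))\<bar>)
          \<le> (\<Sum>(x, k)\<in>p - ?q. c * (Sup k - Inf k))"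
        unfolding case_prod_unfold by (rule sum_mono) (use good in auto)
      also have "\<dots> \<le> (\<Sum>(x, k)\<in>p. c * (Sup k - Inf k))"
      proof (rule sum_mono2[OF fin])
        fix y assume "y \<in> p - (p - ?q)"
        then obtain x k where y: "y = (x, k)" "(x, k) \<in> p" by (cases y) auto
        obtain s t where "s \<le> x" "x \<le> t" "Sup k = t" "Inf k = s"
          by (rule tagged_partial_division_real_cases[OF pp y(2)])
        then show "0 \<le> (case y of (x, k) \<Rightarrow> c * (Sup k - Inf k))" using y(1) c by simp
      qed auto
      also have "\<dots> = c * (b - a)"
        using additive_tagged_division_1[OF ab p, of "\<lambda>x. x"]
        unfolding case_prod_unfold sum_distrib_left[symmetric] by simp
      finally show ?thesis using cb by simp
    qed
    show "\<exists>\<gamma>. gauge \<gamma> \<and> (\<forall>\<D>. \<D> tagged_division_of {a..b} \<and> \<gamma> fine \<D> \<longrightarrow>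
        norm ((\<Sum>(x, k)\<in>\<D>. measure lborel k *\<^sub>R g x) - (f b - f a)) < e)"
      by (intro exI[of _ \<gamma>] conjI allI impI gauge main) (elim conjE, assumption)+
  qed
  then show ?thesis
    by (rule has_integral_spike[OF N, rotated]) (simp add: g_def)
qed

section \<open>Lipschitz functions, products, and derivatives of absolutely continuous
  functions\<close>

lemma abs_cont_on_lipschitz:
  assumes L: "\<And>x y. a \<le> x \<Longrightarrow> x \<le> y \<Longrightarrow> y \<le> b \<Longrightarrow> \<bar>f y - f x\<bar> \<le> L * (y - x)"
  shows "abs_cont_on a b f"
  unfolding abs_cont_on_def
proof (intro allI impI)
  fix e :: real assume "e > 0"
  define d where "d = e / (\<bar>L\<bar> + 1)"
  have d: "d > 0" using \<open>e > 0\<close> by (simp add: d_def)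
  have "(\<Sum>k\<in>D. \<bar>f (Sup k) - f (Inf k)\<bar>) < e"
    if D: "D division_of \<Union>D" "\<Union>D \<subseteq> {a..b}" "(\<Sum>k\<in>D. Sup k - Inf k) < d" for D
  proof -
    have "(\<Sum>k\<in>D. \<bar>f (Sup k) - f (Inf k)\<bar>) \<le> (\<Sum>k\<in>D. (\<bar>L\<bar> + 1) * (Sup k - Inf k))"
    proof (rule sum_mono)
      fix k assume k: "k \<in> D"
      obtain s t where st: "s \<le> t" "k = {s..t}" "Sup k = t" "Inf k = s"
        by (rule division_of_real_cases[OF D(1) k])
      moreover have "k \<subseteq> {a..b}" using k D(2) by blast
      ultimately have "\<bar>f t - f s\<bar> \<le> L * (t - s)" by (intro L) auto
      also have "\<dots> \<le> (\<bar>L\<bar> + 1) * (t - s)" using st by (intro mult_right_mono) auto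
      finally show "\<bar>f (Sup k) - f (Inf k)\<bar> \<le> (\<bar>L\<bar> + 1) * (Sup k - Inf k)" using st by simp
    qed
    also have "\<dots> = (\<bar>L\<bar> + 1) * (\<Sum>k\<in>D. Sup k - Inf k)" by (simp add: sum_distrib_left)
    also have "\<dots> < (\<bar>L\<bar> + 1) * d" using D(3) by (intro mult_strict_left_mono) auto
    also have "\<dots> = e" by (simp add: d_def)
    finally show ?thesis .
  qed
  with d show "\<exists>d>0. \<forall>D. D division_of \<Union>D \<and> \<Union>D \<subseteq> {a..b} \<and> (\<Sum>k\<in>D. Sup k - Inf k) < d
        \<longrightarrow> (\<Sum>k\<in>D. \<bar>f (Sup k) - f (Inf k)\<bar>) < e"
    by blast
qed

lemma abs_cont_on_mult:
  assumes f: "abs_cont_on a b f" and g: "abs_cont_on a b g"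
  shows "abs_cont_on a b (\<lambda>x. f x * g x)"
  unfolding abs_cont_on_def
proof (intro allI impI)
  fix e :: real assume "e > 0"
  have bdd: "\<exists>B>0. \<forall>x\<in>{a..b}. \<bar>h x\<bar> \<le> B" if "abs_cont_on a b h" for h
  proof -
    have "bounded (h ` {a..b})"
      by (intro compact_imp_bounded compact_continuous_image abs_cont_on_imp_continuous_on that) auto
    then show ?thesis unfolding bounded_pos by auto
  qed
  obtain A where A: "A > 0" "\<forall>x\<in>{a..b}. \<bar>f x\<bar> \<le> A" using bdd[OF f] by blast
  obtain B where B: "B > 0" "\<forall>x\<in>{a..b}. \<bar>g x\<bar> \<le> B" using bdd[OF g] by blast
  have e1: "e / 2 / B > 0" and e2: "e / 2 / A > 0" using \<open>e > 0\<close> A B by auto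
  obtain d1 where d1: "d1 > 0" "\<And>D. D division_of \<Union>D \<Longrightarrow> \<Union>D \<subseteq> {a..b} \<Longrightarrow> (\<Sum>k\<in>D. Sup k - Inf k) < d1
        \<Longrightarrow> (\<Sum>k\<in>D. \<bar>f (Sup k) - f (Inf k)\<bar>) < e / 2 / B"
    by (rule abs_cont_onE[OF f e1]) (rule that)
  obtain d2 where d2: "d2 > 0" "\<And>D. D division_of \<Union>D \<Longrightarrow> \<Union>D \<subseteq> {a..b} \<Longrightarrow> (\<Sum>k\<in>D. Sup k - Inf k) < d2
        \<Longrightarrow> (\<Sum>k\<in>D. \<bar>g (Sup k) - g (Inf k)\<bar>) < e / 2 / A"
    by (rule abs_cont_onE[OF g e2]) (rule that)
  have "(\<Sum>k\<in>D. \<bar>f (Sup k) * g (Sup k) - f (Inf k) * g (Inf k)\<bar>) < e"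
    if D: "D division_of \<Union>D" "\<Union>D \<subseteq> {a..b}" "(\<Sum>k\<in>D. Sup k - Inf k) < min d1 d2" for D
  proof -
    have "(\<Sum>k\<in>D. \<bar>f (Sup k) * g (Sup k) - f (Inf k) * g (Inf k)\<bar>)
      \<le> (\<Sum>k\<in>D. B * \<bar>f (Sup k) - f (Inf k)\<bar> + A * \<bar>g (Sup k) - g (Inf k)\<bar>)"
    proof (rule sum_mono)
      fix k assume k: "k \<in> D"
      obtain s t where st: "s \<le> t" "k = {s..t}" "Sup k = t" "Inf k = s"
        by (rule division_of_real_cases[OF D(1) k])
      moreover have "k \<subseteq> {a..b}" using k D(2) by blast
      ultimately have "s \<in> {a..b}" "t \<in> {a..b}" by auto
      then have le: "\<bar>g t\<bar> \<le> B" "\<bar>f s\<bar> \<le> A" using A B by auto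
      have "\<bar>f t * g t - f s * g s\<bar> = \<bar>g t * (f t - f s) + f s * (g t - g s)\<bar>"
        by (simp add: algebra_simps)
      also have "\<dots> \<le> \<bar>g t\<bar> * \<bar>f t - f s\<bar> + \<bar>f s\<bar> * \<bar>g t - g s\<bar>"
        using abs_triangle_ineq by (simp add: abs_mult flip: abs_mult)
      also have "\<dots> \<le> B * \<bar>f t - f s\<bar> + A * \<bar>g t - g s\<bar>"
        using le by (intro add_mono mult_right_mono) auto
      finally show "\<bar>f (Sup k) * g (Sup k) - f (Inf k) * g (Inf k)\<bar>
        \<le> B * \<bar>f (Sup k) - f (Inf k)\<bar> + A * \<bar>g (Sup k) - g (Inf k)\<bar>" using st by simp
    qed
    also have "\<dots> = B * (\<Sum>k\<in>D. \<bar>f (Sup k) - f (Inf k)\<bar>) + A * (\<Sum>k\<in>D. \<bar>g (Sup k) - g (Inf k)\<bar>)"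
      by (simp add: sum.distrib sum_distrib_left)
    also have "\<dots> < B * (e / 2 / B) + A * (e / 2 / A)"
      using d1(2)[OF D(1,2)] d2(2)[OF D(1,2)] D(3) A(1) B(1)
      by (intro add_strict_mono mult_strict_left_mono) auto
    also have "\<dots> = e" using A(1) B(1) by simp
    finally show ?thesis .
  qed
  with d1(1) d2(1) show "\<exists>d>0. \<forall>D. D division_of \<Union>D \<and> \<Union>D \<subseteq> {a..b} \<and> (\<Sum>k\<in>D. Sup k - Inf k) < d
        \<longrightarrow> (\<Sum>k\<in>D. \<bar>f (Sup k) * g (Sup k) - f (Inf k) * g (Inf k)\<bar>) < e"
    by (intro exI[of _ "min d1 d2"]) auto
qed

text \<open>The second claim is first of all a gauge integral. Since its values over cells are
  increments of \<open>f\<close>, the bounded variation of \<open>f\<close> makes it absolutely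
  convergent, which is the third claim.\<close>

lemma abs_cont_on_01_derivative:
  assumes ac: "abs_cont_on 0 1 f"
  shows "\<exists>N. negligible N \<and>
      (\<forall>x\<in>{0..1} - N. (f has_vector_derivative D01 f x) (at x within {0..1}))"
    and "\<And>c d. 0 \<le> c \<Longrightarrow> c \<le> d \<Longrightarrow> d \<le> 1 \<Longrightarrow> (D01 f has_integral f d - f c) {c..d}"
    and "D01 f absolutely_integrable_on {0..1}"
proof -
  have bv: "bounded_variation_on 0 1 f"
    using abs_cont_on_imp_bounded_variation_on[OF ac] by simp
  obtain N where N: "negligible N" "\<And>x. x \<in> {0<..<1} - N \<Longrightarrow> f differentiable (at x)"
    by (rule bounded_variation_on_ae_differentiable[OF bv]) (simp, rule that)
  \<comment> \<open>Differentiability almost everywhere was obtained inside the open interval, so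
    both end points join the exceptional set.\<close>
  have N': "negligible (N \<union> {0, 1})" using N(1) by simp
  have der: "(f has_vector_derivative D01 f x) (at x within {0..1})" if "x \<in> {0..1} - (N \<union> {0, 1})" for x
  proof -
    have "f differentiable (at x)" using that by (intro N(2)) auto
    then have "f differentiable (at x within {0..1})" by (rule differentiable_at_withinI)
    then show ?thesis unfolding D01_def by (simp add: vector_derivative_works)
  qed
  with N' show "\<exists>N. negligible N \<and>
      (\<forall>x\<in>{0..1} - N. (f has_vector_derivative D01 f x) (at x within {0..1}))" by blast
  show int: "(D01 f has_integral f d - f c) {c..d}" if cd: "0 \<le> c" "c \<le> d" "d \<le> 1" for c d
  proof (rule fundamental_theorem_abs_cont_on[OF _ cd(2) N'])
    show "abs_cont_on c d f" by (rule abs_cont_on_subinterval[OF ac cd(1,3)])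
    fix x assume "x \<in> {c..d} - (N \<union> {0, 1})"
    then show "(f has_vector_derivative D01 f x) (at x within {c..d})"
      using cd by (intro has_vector_derivative_within_subset[OF der]) auto
  qed
  obtain M where M: "\<forall>D. D division_of {0..1} \<longrightarrow> (\<Sum>k\<in>D. \<bar>f (Sup k) - f (Inf k)\<bar>) \<le> M"
    using bv unfolding bounded_variation_on_def by blast
  have "D01 f absolutely_integrable_on cbox 0 1"
  proof (rule bounded_variation_absolutely_integrable_interval)
    show "D01 f integrable_on cbox 0 1" using int[of 0 1] by (auto simp: has_integral_integrable)
    fix D :: "real set set" assume "D division_of cbox 0 1"
    then have D: "D division_of {0..1}" by simp
    have "(\<Sum>k\<in>D. norm (integral k (D01 f))) = (\<Sum>k\<in>D. \<bar>f (Sup k) - f (Inf k)\<bar>)"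
    proof (rule sum.cong[OF refl])
      fix k assume k: "k \<in> D"
      obtain s t where st: "s \<le> t" "k = {s..t}" "Sup k = t" "Inf k = s"
        by (rule division_of_real_cases[OF D k])
      then have "0 \<le> s" "t \<le> 1" using division_ofD(2)[OF D k] by auto
      then have "integral k (D01 f) = f t - f s"
        unfolding st(2) using st(1) by (intro integral_unique int)
      then show "norm (integral k (D01 f)) = \<bar>f (Sup k) - f (Inf k)\<bar>" using st by simp
    qed
    also have "\<dots> \<le> M" using M D by blast
    finally show "(\<Sum>k\<in>D. norm (integral k (D01 f))) \<le> M" .
  qed
  then show "D01 f absolutely_integrable_on {0..1}" by simp
qed

section \<open>Riemann--Stieltjes integrals\<close>

definition stieltjes_sum :: "(real \<Rightarrow> real) \<Rightarrow> (real \<Rightarrow> real) \<Rightarrow> (real \<times> real set) set \<Rightarrow> real" where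
  "stieltjes_sum b \<phi> p = (\<Sum>(\<xi>, k)\<in>p. \<phi> \<xi> * (b (Sup k) - b (Inf k)))"

text \<open>As in \<open>has_path_integral\<close>, fineness is a uniform mesh and not a general
  gauge. Free end points are allowed because the integral is also needed over subintervals.\<close>

definition has_stieltjes_integral ::
    "(real \<Rightarrow> real) \<Rightarrow> (real \<Rightarrow> real) \<Rightarrow> real \<Rightarrow> real \<Rightarrow> real \<Rightarrow> bool" where
  "has_stieltjes_integral b \<phi> a c I \<longleftrightarrow>
     (\<forall>\<epsilon>>0. \<exists>\<delta>>0. \<forall>p. p tagged_division_of {a..c} \<and> (\<lambda>\<xi>. ball \<xi> \<delta>) fine p \<longrightarrow>
        \<bar>stieltjes_sum b \<phi> p - I\<bar> < \<epsilon>)"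

lemma has_path_integral_iff_stieltjes:
  "has_path_integral b \<phi> I \<longleftrightarrow> has_stieltjes_integral b \<phi> 0 1 I"
  unfolding has_path_integral_def has_stieltjes_integral_def stieltjes_sum_def ..

lemma has_stieltjes_integralE:
  assumes "has_stieltjes_integral b \<phi> a c I" "\<epsilon> > 0"
  obtains \<delta> where "\<delta> > 0" "\<And>p. p tagged_division_of {a..c} \<Longrightarrow> (\<lambda>\<xi>. ball \<xi> \<delta>) fine p \<Longrightarrow>
        \<bar>stieltjes_sum b \<phi> p - I\<bar> < \<epsilon>"
proof -
  have "\<exists>\<delta>>0. \<forall>p. p tagged_division_of {a..c} \<and> (\<lambda>\<xi>. ball \<xi> \<delta>) fine p \<longrightarrow>
        \<bar>stieltjes_sum b \<phi> p - I\<bar> < \<epsilon>"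
    using assms(1) unfolding has_stieltjes_integral_def by (rule allE[of _ \<epsilon>]) (simp add: assms(2))
  then obtain \<delta> where d: "\<delta> > 0" "\<forall>p. p tagged_division_of {a..c} \<and> (\<lambda>\<xi>. ball \<xi> \<delta>) fine p \<longrightarrow>
        \<bar>stieltjes_sum b \<phi> p - I\<bar> < \<epsilon>"
    by (elim exE conjE)
  show ?thesis
    by (rule that[OF d(1)]) (rule d(2)[THEN spec, THEN mp], simp)
qed

lemma ball_fine_mono:
  fixes \<delta> \<delta>' :: real
  shows "(\<lambda>\<xi>. ball \<xi> \<delta>) fine p \<Longrightarrow> \<delta> \<le> \<delta>' \<Longrightarrow> (\<lambda>\<xi>. ball \<xi> \<delta>') fine p"
  unfolding fine_def using subset_ball by blast

lemma has_stieltjes_integral_unique: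
  assumes "has_stieltjes_integral b \<phi> a c I" "has_stieltjes_integral b \<phi> a c J"
  shows "I = J"
proof (rule ccontr)
  assume "I \<noteq> J"
  then have e: "\<bar>I - J\<bar> / 2 > 0" by simp
  obtain d1 where d1: "d1 > 0" "\<And>p. p tagged_division_of {a..c} \<Longrightarrow> (\<lambda>\<xi>. ball \<xi> d1) fine p \<Longrightarrow>
        \<bar>stieltjes_sum b \<phi> p - I\<bar> < \<bar>I - J\<bar> / 2"
    by (rule has_stieltjes_integralE[OF assms(1) e]) (rule that)
  obtain d2 where d2: "d2 > 0" "\<And>p. p tagged_division_of {a..c} \<Longrightarrow> (\<lambda>\<xi>. ball \<xi> d2) fine p \<Longrightarrow>
        \<bar>stieltjes_sum b \<phi> p - J\<bar> < \<bar>I - J\<bar> / 2"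
    by (rule has_stieltjes_integralE[OF assms(2) e]) (rule that)
  have "gauge (\<lambda>\<xi>::real. ball \<xi> (min d1 d2))" using d1(1) d2(1) by (intro gauge_ball) simp
  then obtain p where p: "p tagged_division_of {a..c}" "(\<lambda>\<xi>. ball \<xi> (min d1 d2)) fine p"
    by (rule fine_division_exists_real)
  have "\<bar>stieltjes_sum b \<phi> p - I\<bar> < \<bar>I - J\<bar> / 2"
    by (rule d1(2)[OF p(1) ball_fine_mono[OF p(2)]]) simp
  moreover have "\<bar>stieltjes_sum b \<phi> p - J\<bar> < \<bar>I - J\<bar> / 2"
    by (rule d2(2)[OF p(1) ball_fine_mono[OF p(2)]]) simp
  moreover have "\<bar>I - J\<bar> \<le> \<bar>stieltjes_sum b \<phi> p - I\<bar> + \<bar>stieltjes_sum b \<phi> p - J\<bar>" by linarith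
  ultimately show False by simp
qed

text \<open>The variation falls on \<phi>, so a continuous \<open>b\<close> of unbounded variation
  is admissible: on each cell the error is at most the oscillation of \<open>b\<close> times the
  integral of \<bar>g\<bar> over that cell.\<close>

lemma has_stieltjes_integral_by_parts:
  fixes b g \<phi> :: "real \<Rightarrow> real"
  assumes ac: "a \<le> c" and b: "continuous_on {a..c} b"
    and g: "g absolutely_integrable_on {a..c}"
    and \<phi>: "\<And>s t. a \<le> s \<Longrightarrow> s \<le> t \<Longrightarrow> t \<le> c \<Longrightarrow> (g has_integral \<phi> t - \<phi> s) {s..t}"
  shows "has_stieltjes_integral b \<phi> a c
    (\<phi> c * b c - \<phi> a * b a - integral {a..c} (\<lambda>x. g x * b x))"
    and "(\<lambda>x. g x * b x) absolutely_integrable_on {a..c}"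
proof -
  have "(\<lambda>x. b x * g x) absolutely_integrable_on {a..c}"
  proof (rule absolutely_integrable_bounded_measurable_product_real)
    show "b \<in> borel_measurable (lebesgue_on {a..c})"
      by (rule continuous_imp_measurable_on_sets_lebesgue[OF b]) simp
    show "bounded (b ` {a..c})"
      by (intro compact_imp_bounded compact_continuous_image b) simp
  qed (use g in auto)
  then show gb: "(\<lambda>x. g x * b x) absolutely_integrable_on {a..c}" by (simp add: mult.commute)
  have gbi: "(\<lambda>x. g x * b x) integrable_on {a..c}" and gi: "(\<lambda>x. \<bar>g x\<bar>) integrable_on {a..c}"
    using gb g by (auto simp: absolutely_integrable_on_def)
  define Gb where "Gb x = integral {a..x} (\<lambda>x. g x * b x)" for x
  define \<Gamma> where "\<Gamma> x = integral {a..x} (\<lambda>x. \<bar>g x\<bar>)" for x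
  have sub: "h integrable_on {s..t}" if "h integrable_on {a..c}" "a \<le> s" "t \<le> c" for s t and h :: "real \<Rightarrow> real"
    by (rule integrable_subinterval_real[OF that(1)]) (use that in auto)
  have Gb: "integral {s..t} (\<lambda>x. g x * b x) = Gb t - Gb s" if "a \<le> s" "s \<le> t" "t \<le> c" for s t
    unfolding Gb_def using Henstock_Kurzweil_Integration.integral_combine[OF that(1,2) sub[OF gbi order_refl that(3)]] by simp
  have \<Gamma>: "integral {s..t} (\<lambda>x. \<bar>g x\<bar>) = \<Gamma> t - \<Gamma> s" if "a \<le> s" "s \<le> t" "t \<le> c" for s t
    unfolding \<Gamma>_def using Henstock_Kurzweil_Integration.integral_combine[OF that(1,2) sub[OF gi order_refl that(3)]] by simp
  have local_bound: "\<bar>Gb t - Gb s - (\<phi> t - \<phi> s) * y\<bar> \<le> \<eta> * (\<Gamma> t - \<Gamma> s)"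
    if st: "a \<le> s" "s \<le> t" "t \<le> c" and y: "\<And>x. x \<in> {s..t} \<Longrightarrow> \<bar>b x - y\<bar> \<le> \<eta>" for s t y \<eta>
  proof -
    have i: "((\<lambda>x. g x * b x - g x * y) has_integral Gb t - Gb s - (\<phi> t - \<phi> s) * y) {s..t}"
      using sub[OF gbi, where s=s and t=t] st
      by (intro has_integral_diff has_integral_mult_left \<phi>) (simp_all add: Gb[symmetric] integrable_integral)
    have "norm (integral {s..t} (\<lambda>x. g x * b x - g x * y)) \<le> integral {s..t} (\<lambda>x. \<eta> * \<bar>g x\<bar>)"
    proof (rule integral_norm_bound_integral)
      show "(\<lambda>x. g x * b x - g x * y) integrable_on {s..t}" using i by (rule has_integral_integrable)
      show "(\<lambda>x. \<eta> * \<bar>g x\<bar>) integrable_on {s..t}"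
        using sub[OF gi st(1,3)] by (rule integrable_on_mult_right)
      fix x assume "x \<in> {s..t}"
      have "norm (g x * b x - g x * y) = \<bar>b x - y\<bar> * \<bar>g x\<bar>"
        unfolding right_diff_distrib[symmetric] real_norm_def abs_mult by (rule mult.commute)
      also have "\<dots> \<le> \<eta> * \<bar>g x\<bar>" using y[OF \<open>x \<in> {s..t}\<close>] by (intro mult_right_mono) auto
      finally show "norm (g x * b x - g x * y) \<le> \<eta> * \<bar>g x\<bar>" .
    qed
    then show ?thesis using \<Gamma>[OF st] integral_unique[OF i] by simp
  qed
  show "has_stieltjes_integral b \<phi> a c (\<phi> c * b c - \<phi> a * b a - integral {a..c} (\<lambda>x. g x * b x))"
    unfolding has_stieltjes_integral_def
  proof (intro allI impI)
    fix \<epsilon> :: real assume \<epsilon>: "\<epsilon> > 0"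
    \<comment> \<open>\<open>m\<close> is the integral of \<bar>g\<bar>; dividing \<epsilon> by
      \<open>m + 1\<close> gives a strict bound and covers \<open>m = 0\<close>.\<close>
    define m where "m = \<Gamma> c - \<Gamma> a"
    have m: "m \<ge> 0" unfolding m_def using \<Gamma>[of a c] ac integral_nonneg[OF gi] by simp
    define \<eta> where "\<eta> = \<epsilon> / (m + 1)"
    have \<eta>: "\<eta> > 0" using \<epsilon> m by (simp add: \<eta>_def)
    have "\<eta> * m < \<eta> * (m + 1)" using \<eta> by simp
    also have "\<dots> = \<epsilon>" using m by (simp add: \<eta>_def)
    finally have \<eta>m: "\<eta> * m < \<epsilon>" .
    have "uniformly_continuous_on {a..c} b"
      by (rule compact_uniformly_continuous[OF b]) simp
    then obtain d where d: "d > 0" "\<forall>x\<in>{a..c}. \<forall>y\<in>{a..c}. dist y x < d \<longrightarrow> dist (b y) (b x) < \<eta>"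
      unfolding uniformly_continuous_on_def using \<eta> by blast
    have main: "\<bar>stieltjes_sum b \<phi> p - (\<phi> c * b c - \<phi> a * b a - integral {a..c} (\<lambda>x. g x * b x))\<bar> < \<epsilon>"
      if p: "p tagged_division_of {a..c}" and fine: "(\<lambda>\<xi>. ball \<xi> (d / 2)) fine p" for p
    proof -
      have pp: "p tagged_partial_division_of {a..c}" using p by (simp add: tagged_division_of_def)
      have Gac: "integral {a..c} (\<lambda>x. g x * b x) = Gb c - Gb a" using Gb[of a c] ac by simp
      \<comment> \<open>The claimed value is the increment of \<open>?h\<close> over the whole
        interval, so the error can be estimated cell by cell. On a cell it splits at the tag: left
        of it \<open>b\<close> is compared with \<open>b s\<close>, right of it with
        \<open>b t\<close>.\<close>
      let ?h = "\<lambda>x. \<phi> x * b x - Gb x"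
      have eq: "stieltjes_sum b \<phi> p - (\<phi> c * b c - \<phi> a * b a - integral {a..c} (\<lambda>x. g x * b x))
         = (\<Sum>(\<xi>, k)\<in>p. \<phi> \<xi> * (b (Sup k) - b (Inf k)) - (?h (Sup k) - ?h (Inf k)))"
        using additive_tagged_division_1[OF ac p, of ?h]
        unfolding stieltjes_sum_def case_prod_unfold sum_subtractf Gac by simp
      have "\<bar>stieltjes_sum b \<phi> p - (\<phi> c * b c - \<phi> a * b a - integral {a..c} (\<lambda>x. g x * b x))\<bar>
         \<le> (\<Sum>(\<xi>, k)\<in>p. \<eta> * (\<Gamma> (Sup k) - \<Gamma> (Inf k)))"
        unfolding eq unfolding case_prod_unfold
      proof (rule order_trans[OF sum_abs sum_mono])
        fix y assume "y \<in> p"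
        obtain \<xi> k where y: "y = (\<xi>, k)" by fastforce
        with \<open>y \<in> p\<close> have xk: "(\<xi>, k) \<in> p" by simp
        obtain s t where st: "s \<le> \<xi>" "\<xi> \<le> t" "k = {s..t}" "Sup k = t" "Inf k = s" "k \<subseteq> {a..c}"
          by (rule tagged_partial_division_real_cases[OF pp xk])
        have as: "a \<le> s" "t \<le> c" using st by auto
        have kb: "k \<subseteq> ball \<xi> (d / 2)" using fine xk by (rule fineD)
        have close: "\<bar>b x - b z\<bar> \<le> \<eta>" if "x \<in> k" "z \<in> k" for x z
        proof -
          have "x \<in> ball \<xi> (d / 2)" "z \<in> ball \<xi> (d / 2)" using that kb by blast+
          then have "dist x z < d" unfolding mem_ball using dist_triangle_half_r by blast
          then have "dist (b x) (b z) < \<eta>" using d(2) that st(6) by blast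
          then show ?thesis by (simp add: dist_real_def)
        qed
        have "s \<in> k" "t \<in> k" using st by auto
        have "\<bar>Gb \<xi> - Gb s - (\<phi> \<xi> - \<phi> s) * b s\<bar> \<le> \<eta> * (\<Gamma> \<xi> - \<Gamma> s)"
          by (rule local_bound) (use st as in \<open>auto intro: close[OF _ \<open>s \<in> k\<close>]\<close>)
        moreover have "\<bar>Gb t - Gb \<xi> - (\<phi> t - \<phi> \<xi>) * b t\<bar> \<le> \<eta> * (\<Gamma> t - \<Gamma> \<xi>)"
          by (rule local_bound) (use st as in \<open>auto intro: close[OF _ \<open>t \<in> k\<close>]\<close>)
        moreover have "\<phi> \<xi> * (b t - b s) - (?h t - ?h s)
          = (Gb \<xi> - Gb s - (\<phi> \<xi> - \<phi> s) * b s) + (Gb t - Gb \<xi> - (\<phi> t - \<phi> \<xi>) * b t)"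
          by (simp add: algebra_simps)
        moreover have "\<eta> * (\<Gamma> \<xi> - \<Gamma> s) + \<eta> * (\<Gamma> t - \<Gamma> \<xi>) = \<eta> * (\<Gamma> t - \<Gamma> s)"
          by (simp add: algebra_simps)
        ultimately have "\<bar>\<phi> \<xi> * (b t - b s) - (?h t - ?h s)\<bar> \<le> \<eta> * (\<Gamma> t - \<Gamma> s)" by linarith
        then show "\<bar>\<phi> (fst y) * (b (Sup (snd y)) - b (Inf (snd y))) - (?h (Sup (snd y)) - ?h (Inf (snd y)))\<bar>
           \<le> \<eta> * (\<Gamma> (Sup (snd y)) - \<Gamma> (Inf (snd y)))"
          using y st(4,5) by simp
      qed
      also have "\<dots> = \<eta> * m"
        using additive_tagged_division_1[OF ac p, of \<Gamma>]
        unfolding case_prod_unfold sum_distrib_left[symmetric] m_def by simp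
      also have "\<dots> < \<epsilon>" by (rule \<eta>m)
      finally show ?thesis .
    qed
    show "\<exists>\<delta>>0. \<forall>p. p tagged_division_of {a..c} \<and> (\<lambda>\<xi>. ball \<xi> \<delta>) fine p \<longrightarrow>
      \<bar>stieltjes_sum b \<phi> p - (\<phi> c * b c - \<phi> a * b a - integral {a..c} (\<lambda>x. g x * b x))\<bar> < \<epsilon>"
      by (intro exI[of _ "d / 2"] conjI allI impI main) (use d(1) in simp, (elim conjE, assumption)+)
  qed
qed

section \<open>Stieltjes integrals with a variable end point\<close>

lemma tagged_division_append:
  fixes b \<phi> :: "real \<Rightarrow> real"
  assumes p: "p tagged_division_of {s..t}" and q: "q tagged_division_of {t..w}" and st: "s \<le> t" "t \<le> w"
  shows "p \<union> q tagged_division_of {s..w}"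
    and "stieltjes_sum b \<phi> (p \<union> q) = stieltjes_sum b \<phi> p + stieltjes_sum b \<phi> q"
proof -
  have "p \<union> q tagged_division_of ({s..t} \<union> {t..w})"
    by (rule tagged_division_Un[OF p q]) auto
  then show "p \<union> q tagged_division_of {s..w}"
    using st by (simp add: ivl_disj_un_two_touch)
  \<comment> \<open>The two divisions can only share the degenerate cell at \<open>t\<close>, over
    which \<open>b\<close> has increment zero.\<close>
  have zero: "(case y of (\<xi>, k) \<Rightarrow> \<phi> \<xi> * (b (Sup k) - b (Inf k))) = 0" if "y \<in> p \<inter> q" for y
  proof -
    obtain \<xi> k where y: "y = (\<xi>, k)" by fastforce
    then have k: "(\<xi>, k) \<in> p" "(\<xi>, k) \<in> q" using that by auto
    have "\<xi> \<in> k" "k \<subseteq> {s..t}" "k \<subseteq> {t..w}"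
      using tagged_division_ofD(2,3)[OF p k(1)] tagged_division_ofD(3)[OF q k(2)] by auto
    then have "k \<subseteq> {t}" by (force simp: subset_iff)
    with \<open>\<xi> \<in> k\<close> have "k = {t}" by blast
    then show ?thesis using y by simp
  qed
  have fin: "finite p" "finite q" using p q by blast+
  show "stieltjes_sum b \<phi> (p \<union> q) = stieltjes_sum b \<phi> p + stieltjes_sum b \<phi> q"
    unfolding stieltjes_sum_def
    by (rule sum.union_inter_neutral[OF fin]) (use zero in blast)
qed

text \<open>\<open>R\<close> is the integral as a function of its upper end point, up to a constant.
  One \<delta> serves all subintervals, which later bounds all partial sums over a grid
  simultaneously. The final inequality is not strict because it arises from a limit.\<close>

definition indefinite_stieltjes :: "(real \<Rightarrow> real) \<Rightarrow> (real \<Rightarrow> real) \<Rightarrow> real \<Rightarrow> real \<Rightarrow> (real \<Rightarrow> real) \<Rightarrow> bool" where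
  "indefinite_stieltjes b \<phi> a c R \<longleftrightarrow>
     (\<forall>\<epsilon>>0. \<exists>\<delta>>0. \<forall>s t p. a \<le> s \<longrightarrow> s \<le> t \<longrightarrow> t \<le> c \<longrightarrow>
       p tagged_division_of {s..t} \<longrightarrow> (\<lambda>\<xi>. ball \<xi> \<delta>) fine p \<longrightarrow>
       \<bar>stieltjes_sum b \<phi> p - (R t - R s)\<bar> \<le> \<epsilon>)"

text \<open>Completing divisions of a subinterval by fixed fine divisions of the remaining ones
  turns the Cauchy property on the whole interval into one that is uniform over subintervals.\<close>

lemma has_stieltjes_integral_indefinite:
  assumes I: "has_stieltjes_integral b \<phi> a c I"
  obtains R where "indefinite_stieltjes b \<phi> a c R"
proof -
  let ?S = "stieltjes_sum b \<phi>"
  have div: "\<exists>p. p tagged_division_of {s..t} \<and> (\<lambda>\<xi>. ball \<xi> \<delta>) fine p" if "\<delta> > 0" for s t \<delta> :: real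
  proof -
    obtain p where "p tagged_division_of {s..t}" "(\<lambda>\<xi>. ball \<xi> \<delta>) fine p"
      by (rule fine_division_exists_real[OF gauge_ball[OF \<open>\<delta> > 0\<close>]])
    then show ?thesis by (intro exI[of _ p] conjI)
  qed
  have cauchy: "\<exists>\<delta>>0. \<forall>x p q. a \<le> x \<longrightarrow> x \<le> c \<longrightarrow> p tagged_division_of {a..x} \<longrightarrow> q tagged_division_of {a..x} \<longrightarrow>
     (\<lambda>\<xi>. ball \<xi> \<delta>) fine p \<longrightarrow> (\<lambda>\<xi>. ball \<xi> \<delta>) fine q \<longrightarrow> \<bar>?S p - ?S q\<bar> < \<epsilon>" if "\<epsilon> > 0" for \<epsilon>
  proof -
    obtain \<delta> where \<delta>: "\<delta> > 0" "\<And>p. p tagged_division_of {a..c} \<Longrightarrow> (\<lambda>\<xi>. ball \<xi> \<delta>) fine p \<Longrightarrow>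
        \<bar>?S p - I\<bar> < \<epsilon> / 2"
      by (rule has_stieltjes_integralE[OF I half_gt_zero[OF \<open>\<epsilon> > 0\<close>]]) (rule that)
    have "\<bar>?S p - ?S q\<bar> < \<epsilon>"
      if x: "a \<le> x" "x \<le> c" and p: "p tagged_division_of {a..x}" "(\<lambda>\<xi>. ball \<xi> \<delta>) fine p"
        and q: "q tagged_division_of {a..x}" "(\<lambda>\<xi>. ball \<xi> \<delta>) fine q" for x p q
    proof -
      obtain r where r: "r tagged_division_of {x..c}" "(\<lambda>\<xi>. ball \<xi> \<delta>) fine r"
        using div[OF \<delta>(1), of x c] by blast
      have "\<bar>?S p + ?S r - I\<bar> < \<epsilon> / 2"
        using \<delta>(2)[OF tagged_division_append(1)[OF p(1) r(1) x] fine_Un[OF p(2) r(2)]]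
        unfolding tagged_division_append(2)[OF p(1) r(1) x] .
      moreover have "\<bar>?S q + ?S r - I\<bar> < \<epsilon> / 2"
        using \<delta>(2)[OF tagged_division_append(1)[OF q(1) r(1) x] fine_Un[OF q(2) r(2)]]
        unfolding tagged_division_append(2)[OF q(1) r(1) x] .
      ultimately show ?thesis by linarith
    qed
    with \<delta>(1) show ?thesis by (intro exI[of _ \<delta>]) simp
  qed
  have "\<exists>P. \<forall>x. P x tagged_division_of {a..x} \<and> (\<lambda>\<xi>. ball \<xi> (1 / real (Suc n))) fine P x" for n :: nat
    by (rule choice) (intro allI div, simp)
  then obtain P where P: "\<forall>n::nat. \<forall>x. P n x tagged_division_of {a..x} \<and>
      (\<lambda>\<xi>. ball \<xi> (1 / real (Suc n))) fine P n x"
    using choice[of "\<lambda>n P. \<forall>x. P x tagged_division_of {a..x} \<and> (\<lambda>\<xi>. ball \<xi> (1 / real (Suc n))) fine P x"]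
    by blast
  have fine: "\<exists>n0. \<forall>n\<ge>n0. \<forall>x. (\<lambda>\<xi>. ball \<xi> \<delta>) fine P n x" if "\<delta> > 0" for \<delta>
  proof -
    obtain n0 where n0: "1 / real (Suc n0) < \<delta>" by (rule nat_approx_posE[OF \<open>\<delta> > 0\<close>])
    have "(\<lambda>\<xi>. ball \<xi> \<delta>) fine P n x" if "n \<ge> n0" for n x
    proof (rule ball_fine_mono)
      show "(\<lambda>\<xi>. ball \<xi> (1 / real (Suc n))) fine P n x" using P by blast
      have "1 / real (Suc n) \<le> 1 / real (Suc n0)" using that by (simp add: field_simps)
      then show "1 / real (Suc n) \<le> \<delta>" using n0 by linarith
    qed
    then show ?thesis by blast
  qed
  define R where "R x = lim (\<lambda>n. ?S (P n x))" for x
  have lim: "(\<lambda>n. ?S (P n x)) \<longlonglongrightarrow> R x" if x: "a \<le> x" "x \<le> c" for x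
  proof -
    have "Cauchy (\<lambda>n. ?S (P n x))"
    proof (rule metric_CauchyI)
      fix e :: real assume "e > 0"
      from cauchy[OF this] obtain \<delta> where \<delta>: "\<delta> > 0"
        "\<forall>x p q. a \<le> x \<longrightarrow> x \<le> c \<longrightarrow> p tagged_division_of {a..x} \<longrightarrow> q tagged_division_of {a..x} \<longrightarrow>
        (\<lambda>\<xi>. ball \<xi> \<delta>) fine p \<longrightarrow> (\<lambda>\<xi>. ball \<xi> \<delta>) fine q \<longrightarrow> \<bar>?S p - ?S q\<bar> < e"
        by (elim exE conjE)
      obtain n0 where n0: "\<forall>n\<ge>n0. \<forall>x. (\<lambda>\<xi>. ball \<xi> \<delta>) fine P n x" using fine[OF \<delta>(1)] by blast
      have "\<forall>m\<ge>n0. \<forall>n\<ge>n0. dist (?S (P m x)) (?S (P n x)) < e"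
      proof (intro allI impI)
        fix m n assume "m \<ge> n0" "n \<ge> n0"
        then show "dist (?S (P m x)) (?S (P n x)) < e"
          unfolding dist_real_def using \<delta>(2)[rule_format, OF x, of "P m x" "P n x"] P n0 by simp
      qed
      then show "\<exists>M. \<forall>m\<ge>M. \<forall>n\<ge>M. dist (?S (P m x)) (?S (P n x)) < e" by blast
    qed
    then show ?thesis unfolding R_def by (simp add: Cauchy_convergent convergent_LIMSEQ_iff[THEN iffD1])
  qed
  have "\<exists>\<delta>>0. \<forall>s t p. a \<le> s \<longrightarrow> s \<le> t \<longrightarrow> t \<le> c \<longrightarrow>
     p tagged_division_of {s..t} \<longrightarrow> (\<lambda>\<xi>. ball \<xi> \<delta>) fine p \<longrightarrow>
     \<bar>?S p - (R t - R s)\<bar> \<le> \<epsilon>" if "\<epsilon> > 0" for \<epsilon>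
  proof -
    from cauchy[OF half_gt_zero[OF that]] obtain \<delta> where \<delta>: "\<delta> > 0"
      "\<forall>x p q. a \<le> x \<longrightarrow> x \<le> c \<longrightarrow> p tagged_division_of {a..x} \<longrightarrow> q tagged_division_of {a..x} \<longrightarrow>
        (\<lambda>\<xi>. ball \<xi> \<delta>) fine p \<longrightarrow> (\<lambda>\<xi>. ball \<xi> \<delta>) fine q \<longrightarrow> \<bar>?S p - ?S q\<bar> < \<epsilon> / 2"
      by (elim exE conjE)
    obtain n0 where n0: "\<forall>n\<ge>n0. \<forall>x. (\<lambda>\<xi>. ball \<xi> \<delta>) fine P n x" using fine[OF \<delta>(1)] by blast
    have R: "\<bar>?S p - R x\<bar> \<le> \<epsilon> / 2"
      if x: "a \<le> x" "x \<le> c" and p: "p tagged_division_of {a..x}" "(\<lambda>\<xi>. ball \<xi> \<delta>) fine p" for x p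
    proof (rule tendsto_upperbound)
      show "(\<lambda>n. \<bar>?S p - ?S (P n x)\<bar>) \<longlonglongrightarrow> \<bar>?S p - R x\<bar>"
        by (intro tendsto_intros lim x)
      show "\<forall>\<^sub>F n in sequentially. \<bar>?S p - ?S (P n x)\<bar> \<le> \<epsilon> / 2"
        unfolding eventually_sequentially
      proof (intro exI[of _ n0] allI impI less_imp_le)
        fix n assume "n \<ge> n0"
        then show "\<bar>?S p - ?S (P n x)\<bar> < \<epsilon> / 2"
          using \<delta>(2)[rule_format, OF x p(1), of "P n x"] p(2) P n0 by simp
      qed
    qed simp
    have "\<bar>?S p - (R t - R s)\<bar> \<le> \<epsilon>"
      if st: "a \<le> s" "s \<le> t" "t \<le> c" and p: "p tagged_division_of {s..t}" "(\<lambda>\<xi>. ball \<xi> \<delta>) fine p" for s t p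
    proof -
      \<comment> \<open>With a fine division of \<open>{a..s}\<close> in front, the sum over
        \<open>p\<close> is a difference of two sums starting at \<open>a\<close>, each within half
        of \<epsilon> of the corresponding value of \<open>R\<close>.\<close>
      obtain q where q: "q tagged_division_of {a..s}" "(\<lambda>\<xi>. ball \<xi> \<delta>) fine q"
        using div[OF \<delta>(1), of a s] by blast
      have "\<bar>?S q - R s\<bar> \<le> \<epsilon> / 2" using st q by (intro R) auto
      moreover have "\<bar>?S q + ?S p - R t\<bar> \<le> \<epsilon> / 2"
        using R[OF _ st(3) tagged_division_append(1)[OF q(1) p(1) st(1,2)] fine_Un[OF q(2) p(2)]] st
        unfolding tagged_division_append(2)[OF q(1) p(1) st(1,2)] by simp
      ultimately show ?thesis by linarith
    qed
    with \<delta>(1) show ?thesis by (intro exI[of _ \<delta>]) simp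
  qed
  then have "indefinite_stieltjes b \<phi> a c R" unfolding indefinite_stieltjes_def by blast
  then show ?thesis by (rule that)
qed

text \<open>Abel summation: only the accumulated errors \<open>d i\<close> have to be small, not the
  sum of the sizes of their increments; the price is the variation of the weights \<psi>.\<close>

lemma sum_by_parts_bound:
  fixes d \<psi> :: "nat \<Rightarrow> real"
  assumes d0: "d 0 = 0" and d: "\<And>i. i \<le> n \<Longrightarrow> \<bar>d i\<bar> \<le> \<epsilon>"
  shows "\<bar>\<Sum>i<n. \<psi> i * (d (Suc i) - d i)\<bar> \<le> \<epsilon> * (\<bar>\<psi> n\<bar> + (\<Sum>i<n. \<bar>\<psi> (Suc i) - \<psi> i\<bar>))"
proof -
  have "(\<Sum>i<n. \<psi> i * (d (Suc i) - d i)) = \<psi> n * d n - (\<Sum>i<n. d (Suc i) * (\<psi> (Suc i) - \<psi> i))"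
    by (induction n) (simp_all add: d0 algebra_simps)
  also have "\<bar>\<dots>\<bar> \<le> \<bar>\<psi> n * d n\<bar> + \<bar>\<Sum>i<n. d (Suc i) * (\<psi> (Suc i) - \<psi> i)\<bar>"
    by (rule abs_triangle_ineq4)
  also have "\<dots> \<le> \<epsilon> * \<bar>\<psi> n\<bar> + (\<Sum>i<n. \<epsilon> * \<bar>\<psi> (Suc i) - \<psi> i\<bar>)"
  proof (rule add_mono)
    show "\<bar>\<psi> n * d n\<bar> \<le> \<epsilon> * \<bar>\<psi> n\<bar>"
      unfolding abs_mult using d[of n] by (subst mult.commute) (simp add: mult_right_mono)
    show "\<bar>\<Sum>i<n. d (Suc i) * (\<psi> (Suc i) - \<psi> i)\<bar> \<le> (\<Sum>i<n. \<epsilon> * \<bar>\<psi> (Suc i) - \<psi> i\<bar>)"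
    proof (rule order_trans[OF sum_abs sum_mono])
      fix i assume "i \<in> {..<n}"
      then show "\<bar>d (Suc i) * (\<psi> (Suc i) - \<psi> i)\<bar> \<le> \<epsilon> * \<bar>\<psi> (Suc i) - \<psi> i\<bar>"
        unfolding abs_mult using d[of "Suc i"] by (intro mult_right_mono) auto
    qed
  qed
  also have "\<dots> = \<epsilon> * (\<bar>\<psi> n\<bar> + (\<Sum>i<n. \<bar>\<psi> (Suc i) - \<psi> i\<bar>))"
    by (simp add: distrib_left sum_distrib_left)
  finally show ?thesis .
qed

lemma indefinite_stieltjesE:
  assumes "indefinite_stieltjes b \<phi> a c R" "\<epsilon> > 0"
  obtains \<delta> where "\<delta> > 0" "\<And>s t p. a \<le> s \<Longrightarrow> s \<le> t \<Longrightarrow> t \<le> c \<Longrightarrow>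
       p tagged_division_of {s..t} \<Longrightarrow> (\<lambda>\<xi>. ball \<xi> \<delta>) fine p \<Longrightarrow>
       \<bar>stieltjes_sum b \<phi> p - (R t - R s)\<bar> \<le> \<epsilon>"
proof -
  obtain \<delta> where d: "\<delta> > 0" "\<forall>s t p. a \<le> s \<longrightarrow> s \<le> t \<longrightarrow> t \<le> c \<longrightarrow>
       p tagged_division_of {s..t} \<longrightarrow> (\<lambda>\<xi>. ball \<xi> \<delta>) fine p \<longrightarrow>
       \<bar>stieltjes_sum b \<phi> p - (R t - R s)\<bar> \<le> \<epsilon>"
    using assms(1)[unfolded indefinite_stieltjes_def, THEN spec, THEN mp, OF assms(2)] by (elim exE conjE)
  show ?thesis by (rule that[OF d(1)]) (rule d(2)[rule_format])
qed

lemma indefinite_stieltjes_integral: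
  assumes R: "indefinite_stieltjes b \<phi> a c R" and st: "a \<le> s" "s \<le> t" "t \<le> c"
  shows "has_stieltjes_integral b \<phi> s t (R t - R s)"
  unfolding has_stieltjes_integral_def
proof (intro allI impI)
  fix \<epsilon> :: real assume "\<epsilon> > 0"
  obtain \<delta> where \<delta>: "\<delta> > 0" "\<And>s t p. a \<le> s \<Longrightarrow> s \<le> t \<Longrightarrow> t \<le> c \<Longrightarrow>
       p tagged_division_of {s..t} \<Longrightarrow> (\<lambda>\<xi>. ball \<xi> \<delta>) fine p \<Longrightarrow>
       \<bar>stieltjes_sum b \<phi> p - (R t - R s)\<bar> \<le> \<epsilon> / 2"
    by (rule indefinite_stieltjesE[OF R half_gt_zero[OF \<open>\<epsilon> > 0\<close>]]) (rule that)
  have "\<bar>stieltjes_sum b \<phi> p - (R t - R s)\<bar> < \<epsilon>"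
    if "p tagged_division_of {s..t} \<and> (\<lambda>\<xi>. ball \<xi> \<delta>) fine p" for p
  proof -
    have "\<bar>stieltjes_sum b \<phi> p - (R t - R s)\<bar> \<le> \<epsilon> / 2" using that by (intro \<delta>(2) st) simp_all
    with \<open>\<epsilon> > 0\<close> show ?thesis by linarith
  qed
  with \<delta>(1) show "\<exists>\<delta>>0. \<forall>p. p tagged_division_of {s..t} \<and> (\<lambda>\<xi>. ball \<xi> \<delta>) fine p \<longrightarrow>
       \<bar>stieltjes_sum b \<phi> p - (R t - R s)\<bar> < \<epsilon>"
    by (intro exI[of _ \<delta>]) simp
qed

lemma stieltjes_sum_single: "s \<le> t \<Longrightarrow> stieltjes_sum b \<phi> {(\<xi>, {s..t})} = \<phi> \<xi> * (b t - b s)"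
  by (simp add: stieltjes_sum_def)

text \<open>On a short interval the division into a single cell is already fine, which compares the
  increment of \<open>R\<close> with \<open>\<phi> s * (b t - b s)\<close>.\<close>

lemma indefinite_stieltjes_continuous_on:
  assumes R: "indefinite_stieltjes b \<phi> a c R" and b: "continuous_on {a..c} b"
    and \<phi>: "bounded (\<phi> ` {a..c})"
  shows "continuous_on {a..c} R"
  unfolding continuous_on_iff
proof (intro ballI allI impI)
  fix x e :: real assume x: "x \<in> {a..c}" and e: "e > 0"
  obtain B where B: "B > 0" "\<forall>x\<in>{a..c}. \<bar>\<phi> x\<bar> \<le> B" using \<phi> unfolding bounded_pos by auto
  obtain \<delta> where \<delta>: "\<delta> > 0" "\<And>s t p. a \<le> s \<Longrightarrow> s \<le> t \<Longrightarrow> t \<le> c \<Longrightarrow>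
       p tagged_division_of {s..t} \<Longrightarrow> (\<lambda>\<xi>. ball \<xi> \<delta>) fine p \<Longrightarrow>
       \<bar>stieltjes_sum b \<phi> p - (R t - R s)\<bar> \<le> e / 2"
    by (rule indefinite_stieltjesE[OF R half_gt_zero[OF e]]) (rule that)
  have "e / 2 / B > 0" using e B by simp
  then obtain d where d: "d > 0" "\<forall>y\<in>{a..c}. dist y x < d \<longrightarrow> dist (b y) (b x) < e / 2 / B"
    using b x unfolding continuous_on_iff by blast
  have key: "\<bar>R t - R s\<bar> < e" if st: "a \<le> s" "s \<le> t" "t \<le> c" "t - s < \<delta>" "\<bar>b t - b s\<bar> < e / 2 / B" for s t
  proof -
    have "\<bar>stieltjes_sum b \<phi> {(s, {s..t})} - (R t - R s)\<bar> \<le> e / 2"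
      using st by (intro \<delta>(2) tagged_division_of_self_real) (auto simp: fine_def dist_real_def)
    then have "\<bar>\<phi> s * (b t - b s) - (R t - R s)\<bar> \<le> e / 2"
      using stieltjes_sum_single[OF st(2)] by simp
    moreover have "\<bar>\<phi> s * (b t - b s)\<bar> < e / 2"
    proof -
      have "\<bar>\<phi> s * (b t - b s)\<bar> \<le> B * \<bar>b t - b s\<bar>"
        unfolding abs_mult using B(2) st by (intro mult_right_mono) auto
      also have "\<dots> < B * (e / 2 / B)" using B(1) st(5) by (intro mult_strict_left_mono)
      also have "\<dots> = e / 2" using B(1) by simp
      finally show ?thesis .
    qed
    ultimately show ?thesis by linarith
  qed
  have "\<forall>y\<in>{a..c}. dist y x < min \<delta> d \<longrightarrow> dist (R y) (R x) < e"
  proof (intro ballI impI)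
    fix y assume y: "y \<in> {a..c}" "dist y x < min \<delta> d"
    then have "\<bar>b y - b x\<bar> < e / 2 / B" using d(2) by (simp add: dist_real_def)
    then show "dist (R y) (R x) < e"
      using key[of x y] key[of y x] x y by (cases "x \<le> y") (simp_all add: dist_real_def abs_minus_commute)
  qed
  then show "\<exists>d>0. \<forall>y\<in>{a..c}. dist y x < d \<longrightarrow> dist (R y) (R x) < e"
    using \<delta>(1) d(1) by (intro exI[of _ "min \<delta> d"]) simp
qed

section \<open>Substitution of an indefinite integral, on uniform grids\<close>

definition uniform_division :: "nat \<Rightarrow> nat \<Rightarrow> (real \<times> real set) set" where
  "uniform_division n m = (\<lambda>i. (real i / real n, {real i / real n..real (Suc i) / real n})) ` {..<m}"

lemma uniform_tagged_division:
  assumes n: "n > 0"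
  shows "m > 0 \<Longrightarrow> uniform_division n m tagged_division_of {0..real m / real n}"
    and "stieltjes_sum b \<phi> (uniform_division n m)
      = (\<Sum>i<m. \<phi> (real i / real n) * (b (real (Suc i) / real n) - b (real i / real n)))"
    and "\<delta> > 1 / real n \<Longrightarrow> (\<lambda>\<xi>. ball \<xi> \<delta>) fine (uniform_division n m)"
proof -
  let ?T = "\<lambda>i. (real i / real n, {real i / real n..real (Suc i) / real n})"
  have le: "real i / real n \<le> real (Suc i) / real n" for i using n by (simp add: field_simps)
  show "uniform_division n m tagged_division_of {0..real m / real n}" if "m > 0" for m
    using that
  proof (induction m rule: nat_induct_non_zero)
    case 1
    have "uniform_division n 1 = {(0, {0..1 / real n})}" by (simp add: uniform_division_def lessThan_Suc)
    then show ?case using tagged_division_of_self_real[of 0 0 "1 / real n"] by simp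
  next
    case (Suc m)
    have "uniform_division n m \<union> {?T m} tagged_division_of {0..real (Suc m) / real n}"
      by (rule tagged_division_append(1)[OF Suc.IH tagged_division_of_self_real]) (use le n in auto)
    moreover have "uniform_division n m \<union> {?T m} = uniform_division n (Suc m)" by (auto simp: uniform_division_def lessThan_Suc)
    ultimately show ?case by simp
  qed
  have inj: "inj_on ?T {..<m}" using n by (auto simp: inj_on_def)
  show "stieltjes_sum b \<phi> (uniform_division n m)
      = (\<Sum>i<m. \<phi> (real i / real n) * (b (real (Suc i) / real n) - b (real i / real n)))"
    unfolding stieltjes_sum_def uniform_division_def sum.reindex[OF inj]
    by (rule sum.cong) (use le in auto)
  show "(\<lambda>\<xi>. ball \<xi> \<delta>) fine (uniform_division n m)" if "\<delta> > 1 / real n"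
  proof (rule fineI)
    fix x k assume "(x, k) \<in> uniform_division n m"
    then obtain i where i: "x = real i / real n" "k = {real i / real n..real (Suc i) / real n}"
      by (auto simp: uniform_division_def)
    have "real (Suc i) / real n = x + 1 / real n" by (simp add: i add_divide_distrib)
    then show "k \<subseteq> ball x \<delta>" using that i by (auto simp: dist_real_def)
  qed
qed

text \<open>Substitution \<open>\<psi> \<phi> db = \<psi> dR\<close>, followed by integration by
  parts. The multiplier \<psi> has bounded variation, so Abel summation compares the two kinds of
  Riemann sums. Afterwards the path \<open>b\<close> has disappeared from the value of
  \<open>J\<close> except through \<open>R\<close>.\<close>

lemma stieltjes_integral_product:
  assumes R: "indefinite_stieltjes b \<phi> 0 1 R" and Rc: "continuous_on {0..1} R"
    and J: "has_stieltjes_integral b (\<lambda>x. \<psi> x * \<phi> x) 0 1 J"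
    and g: "g absolutely_integrable_on {0..1}"
    and \<psi>: "\<And>s t. 0 \<le> s \<Longrightarrow> s \<le> t \<Longrightarrow> t \<le> 1 \<Longrightarrow> (g has_integral \<psi> t - \<psi> s) {s..t}"
  shows "J = \<psi> 1 * R 1 - \<psi> 0 * R 0 - integral {0..1} (\<lambda>x. g x * R x)"
proof -
  define X where "X = \<psi> 1 * R 1 - \<psi> 0 * R 0 - integral {0..1} (\<lambda>x. g x * R x)"
  have X: "has_stieltjes_integral R \<psi> 0 1 X"
    unfolding X_def by (rule has_stieltjes_integral_by_parts(1)[OF _ Rc g \<psi>]) auto
  have gi: "(\<lambda>x. \<bar>g x\<bar>) integrable_on {0..1}" using g by (auto simp: absolutely_integrable_on_def)
  define \<Gamma> where "\<Gamma> x = integral {0..x} (\<lambda>x. \<bar>g x\<bar>)" for x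
  have \<psi>\<Gamma>: "\<bar>\<psi> t - \<psi> s\<bar> \<le> \<Gamma> t - \<Gamma> s" if st: "0 \<le> s" "s \<le> t" "t \<le> 1" for s t
  proof -
    have i: "(\<lambda>x. \<bar>g x\<bar>) integrable_on {0..t}" "(\<lambda>x. \<bar>g x\<bar>) integrable_on {s..t}"
      by (rule integrable_subinterval_real[OF gi], use st in auto)+
    have "norm (integral {s..t} g) \<le> integral {s..t} (\<lambda>x. \<bar>g x\<bar>)"
      by (rule integral_norm_bound_integral[OF has_integral_integrable[OF \<psi>[OF st]] i(2)]) simp
    then show ?thesis
      using Henstock_Kurzweil_Integration.integral_combine[OF st(1,2) i(1)] integral_unique[OF \<psi>[OF st]]
      by (simp add: \<Gamma>_def)
  qed
  define C where "C = \<bar>\<psi> 1\<bar> + \<Gamma> 1"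
  have C: "C \<ge> 0" using \<psi>\<Gamma>[of 0 1] by (simp add: C_def \<Gamma>_def)
  have "\<bar>J - X\<bar> \<le> e" if "e > 0" for e
  proof -
    \<comment> \<open>Three errors occur: \<open>C\<close> times \<epsilon> from Abel summation, and
      one \<epsilon> for each of the integrals \<open>J\<close> and \<open>X\<close>.\<close>
    define \<epsilon> where "\<epsilon> = e / (C + 2)"
    have \<epsilon>: "\<epsilon> > 0" using that C by (simp add: \<epsilon>_def)
    obtain d1 where d1: "d1 > 0" "\<And>p. p tagged_division_of {0..1} \<Longrightarrow> (\<lambda>\<xi>. ball \<xi> d1) fine p \<Longrightarrow>
        \<bar>stieltjes_sum b (\<lambda>x. \<psi> x * \<phi> x) p - J\<bar> < \<epsilon>"
      by (rule has_stieltjes_integralE[OF J \<epsilon>]) (rule that)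
    obtain d2 where d2: "d2 > 0" "\<And>p. p tagged_division_of {0..1} \<Longrightarrow> (\<lambda>\<xi>. ball \<xi> d2) fine p \<Longrightarrow>
        \<bar>stieltjes_sum R \<psi> p - X\<bar> < \<epsilon>"
      by (rule has_stieltjes_integralE[OF X \<epsilon>]) (rule that)
    obtain d3 where d3: "d3 > 0" "\<And>s t p. 0 \<le> s \<Longrightarrow> s \<le> t \<Longrightarrow> t \<le> 1 \<Longrightarrow>
       p tagged_division_of {s..t} \<Longrightarrow> (\<lambda>\<xi>. ball \<xi> d3) fine p \<Longrightarrow>
       \<bar>stieltjes_sum b \<phi> p - (R t - R s)\<bar> \<le> \<epsilon>"
      by (rule indefinite_stieltjesE[OF R \<epsilon>]) (rule that)
    have "min d1 (min d2 d3) > 0" using d1(1) d2(1) d3(1) by simp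
    then obtain n' where n': "1 / real (Suc n') < min d1 (min d2 d3)" by (rule nat_approx_posE)
    define n where "n = Suc n'"
    have n: "n > 0" "1 / real n < d1" "1 / real n < d2" "1 / real n < d3" using n' by (simp_all add: n_def)
    define x where "x i = real i / real n" for i
    define P where "P = uniform_division n"
    note ut = uniform_tagged_division[OF n(1), folded P_def]
    have x1: "x 0 = 0" "x n = 1" using n(1) by (simp_all add: x_def)
    have Pn: "P n tagged_division_of {0..1}" using ut(1)[OF n(1)] n(1) by simp
    \<comment> \<open>\<open>d m\<close> is the error accumulated over the first \<open>m\<close>
      grid cells. It is small for every \<open>m\<close> at once because \<delta> in
      \<open>indefinite_stieltjes\<close> does not depend on the subinterval; this is why
      \<open>uniform_division\<close> provides initial segments of the grid.\<close>
    define d where "d m = (\<Sum>i<m. \<phi> (x i) * (b (x (Suc i)) - b (x i))) - (R (x m) - R 0)" for m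
    have d: "\<bar>d m\<bar> \<le> \<epsilon>" if "m \<le> n" for m
    proof (cases "m = 0")
      case True
      then show ?thesis using \<epsilon> by (simp add: d_def x1)
    next
      case False
      then have m: "m > 0" by simp
      have "\<bar>stieltjes_sum b \<phi> (P m) - (R (x m) - R 0)\<bar> \<le> \<epsilon>"
        unfolding x_def
        by (rule d3(2)[OF _ _ _ ut(1)[OF m] ut(3)[OF n(4)]]) (use that n(1) in auto)
      then show ?thesis unfolding ut(2) by (simp only: d_def x_def)
    qed
    have "\<bar>\<Sum>i<n. \<psi> (x i) * (d (Suc i) - d i)\<bar> \<le> \<epsilon> * (\<bar>\<psi> (x n)\<bar> + (\<Sum>i<n. \<bar>\<psi> (x (Suc i)) - \<psi> (x i)\<bar>))"
      by (rule sum_by_parts_bound) (use d in \<open>auto simp: d_def x1\<close>)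
    also have "\<dots> \<le> \<epsilon> * (\<bar>\<psi> (x n)\<bar> + (\<Sum>i<n. \<Gamma> (x (Suc i)) - \<Gamma> (x i)))"
    proof (intro mult_left_mono add_left_mono sum_mono \<psi>\<Gamma>)
      fix i assume i: "i \<in> {..<n}"
      show "0 \<le> x i" "x i \<le> x (Suc i)" "x (Suc i) \<le> 1"
        using i n(1) by (auto simp: x_def field_simps)
    qed (use \<epsilon> in simp)
    also have "(\<Sum>i<n. \<Gamma> (x (Suc i)) - \<Gamma> (x i)) = \<Gamma> 1"
      by (subst sum_lessThan_telescope) (simp add: x1 \<Gamma>_def)
    finally have A: "\<bar>\<Sum>i<n. \<psi> (x i) * (d (Suc i) - d i)\<bar> \<le> \<epsilon> * C" by (simp add: C_def x1)
    have "(\<Sum>i<n. \<psi> (x i) * (d (Suc i) - d i))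
       = (\<Sum>i<n. \<psi> (x i) * \<phi> (x i) * (b (x (Suc i)) - b (x i)) - \<psi> (x i) * (R (x (Suc i)) - R (x i)))"
      by (rule sum.cong) (simp_all add: d_def algebra_simps)
    also have "\<dots> = stieltjes_sum b (\<lambda>x. \<psi> x * \<phi> x) (P n) - stieltjes_sum R \<psi> (P n)"
      unfolding ut(2) x_def sum_subtractf ..
    finally have "\<bar>stieltjes_sum b (\<lambda>x. \<psi> x * \<phi> x) (P n) - stieltjes_sum R \<psi> (P n)\<bar> \<le> \<epsilon> * C"
      using A by simp
    moreover have "\<bar>stieltjes_sum b (\<lambda>x. \<psi> x * \<phi> x) (P n) - J\<bar> < \<epsilon>"
      by (rule d1(2)[OF Pn ut(3)[OF n(2)]])
    moreover have "\<bar>stieltjes_sum R \<psi> (P n) - X\<bar> < \<epsilon>"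
      by (rule d2(2)[OF Pn ut(3)[OF n(3)]])
    ultimately have "\<bar>J - X\<bar> \<le> \<epsilon> * C + \<epsilon> + \<epsilon>" by linarith
    also have "\<dots> = \<epsilon> * (C + 2)" by (simp add: algebra_simps)
    also have "\<dots> = e" using C by (simp add: \<epsilon>_def)
    finally show ?thesis .
  qed
  then have "J - X = 0" by (rule dense_eq0_I)
  then show ?thesis by (simp add: X_def)
qed

section \<open>Linearity and dependence on the integrand\<close>

lemma has_stieltjes_integral_add:
  assumes "has_stieltjes_integral b \<phi> a c I" "has_stieltjes_integral b \<psi> a c J"
  shows "has_stieltjes_integral b (\<lambda>x. \<phi> x + \<psi> x) a c (I + J)"
  unfolding has_stieltjes_integral_def
proof (intro allI impI)
  fix e :: real assume "e > 0"
  obtain d1 where d1: "d1 > 0" "\<And>p. p tagged_division_of {a..c} \<Longrightarrow> (\<lambda>\<xi>. ball \<xi> d1) fine p \<Longrightarrow>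
        \<bar>stieltjes_sum b \<phi> p - I\<bar> < e / 2"
    by (rule has_stieltjes_integralE[OF assms(1) half_gt_zero[OF \<open>e > 0\<close>]]) (rule that)
  obtain d2 where d2: "d2 > 0" "\<And>p. p tagged_division_of {a..c} \<Longrightarrow> (\<lambda>\<xi>. ball \<xi> d2) fine p \<Longrightarrow>
        \<bar>stieltjes_sum b \<psi> p - J\<bar> < e / 2"
    by (rule has_stieltjes_integralE[OF assms(2) half_gt_zero[OF \<open>e > 0\<close>]]) (rule that)
  have "\<bar>stieltjes_sum b (\<lambda>x. \<phi> x + \<psi> x) p - (I + J)\<bar> < e"
    if p: "p tagged_division_of {a..c} \<and> (\<lambda>\<xi>. ball \<xi> (min d1 d2)) fine p" for p
  proof -
    have "\<bar>stieltjes_sum b \<phi> p - I\<bar> < e / 2"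
      by (rule d1(2)[OF conjunct1[OF p] ball_fine_mono[OF conjunct2[OF p]]]) simp
    moreover have "\<bar>stieltjes_sum b \<psi> p - J\<bar> < e / 2"
      by (rule d2(2)[OF conjunct1[OF p] ball_fine_mono[OF conjunct2[OF p]]]) simp
    moreover have "stieltjes_sum b (\<lambda>x. \<phi> x + \<psi> x) p = stieltjes_sum b \<phi> p + stieltjes_sum b \<psi> p"
      by (simp add: stieltjes_sum_def case_prod_unfold distrib_right sum.distrib)
    ultimately show ?thesis by linarith
  qed
  with d1(1) d2(1) show "\<exists>\<delta>>0. \<forall>p. p tagged_division_of {a..c} \<and> (\<lambda>\<xi>. ball \<xi> \<delta>) fine p \<longrightarrow>
        \<bar>stieltjes_sum b (\<lambda>x. \<phi> x + \<psi> x) p - (I + J)\<bar> < e"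
    by (intro exI[of _ "min d1 d2"]) simp
qed

lemma has_stieltjes_integral_cmult:
  assumes "has_stieltjes_integral b \<phi> a c I"
  shows "has_stieltjes_integral b (\<lambda>x. r * \<phi> x) a c (r * I)"
  unfolding has_stieltjes_integral_def
proof (intro allI impI)
  fix e :: real assume "e > 0"
  then have e: "e / (\<bar>r\<bar> + 1) > 0" by simp
  obtain d where d: "d > 0" "\<And>p. p tagged_division_of {a..c} \<Longrightarrow> (\<lambda>\<xi>. ball \<xi> d) fine p \<Longrightarrow>
        \<bar>stieltjes_sum b \<phi> p - I\<bar> < e / (\<bar>r\<bar> + 1)"
    by (rule has_stieltjes_integralE[OF assms e]) (rule that)
  have "\<bar>stieltjes_sum b (\<lambda>x. r * \<phi> x) p - r * I\<bar> < e"
    if p: "p tagged_division_of {a..c} \<and> (\<lambda>\<xi>. ball \<xi> d) fine p" for p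
  proof -
    have "stieltjes_sum b (\<lambda>x. r * \<phi> x) p = r * stieltjes_sum b \<phi> p"
      by (simp add: stieltjes_sum_def case_prod_unfold sum_distrib_left mult.assoc)
    then have "\<bar>stieltjes_sum b (\<lambda>x. r * \<phi> x) p - r * I\<bar> = \<bar>r\<bar> * \<bar>stieltjes_sum b \<phi> p - I\<bar>"
      by (simp add: abs_mult flip: right_diff_distrib)
    also have "\<dots> \<le> (\<bar>r\<bar> + 1) * \<bar>stieltjes_sum b \<phi> p - I\<bar>" by (intro mult_right_mono) auto
    also have "\<dots> < (\<bar>r\<bar> + 1) * (e / (\<bar>r\<bar> + 1))"
      by (intro mult_strict_left_mono d(2) conjunct1[OF p] conjunct2[OF p]) simp
    also have "\<dots> = e" by simp
    finally show ?thesis .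
  qed
  with d(1) show "\<exists>\<delta>>0. \<forall>p. p tagged_division_of {a..c} \<and> (\<lambda>\<xi>. ball \<xi> \<delta>) fine p \<longrightarrow>
        \<bar>stieltjes_sum b (\<lambda>x. r * \<phi> x) p - r * I\<bar> < e"
    by (intro exI[of _ d]) simp
qed

lemma has_stieltjes_integral_cong:
  assumes "has_stieltjes_integral b \<phi> a c I" and eq: "\<And>x. x \<in> {a..c} \<Longrightarrow> \<phi> x = \<psi> x"
  shows "has_stieltjes_integral b \<psi> a c I"
proof -
  have "stieltjes_sum b \<psi> p = stieltjes_sum b \<phi> p" if "p tagged_division_of {a..c}" for p
    unfolding stieltjes_sum_def
  proof (rule sum.cong[OF refl])
    fix y assume "y \<in> p"
    then obtain \<xi> k where y: "y = (\<xi>, k)" "(\<xi>, k) \<in> p" by (cases y) simp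
    have "\<xi> \<in> {a..c}" by (rule tag_in_interval[OF that y(2)])
    then show "(case y of (\<xi>, k) \<Rightarrow> \<psi> \<xi> * (b (Sup k) - b (Inf k)))
        = (case y of (\<xi>, k) \<Rightarrow> \<phi> \<xi> * (b (Sup k) - b (Inf k)))"
      using y eq by simp
  qed
  then have "(p tagged_division_of {a..c} \<and> (\<lambda>\<xi>. ball \<xi> \<delta>) fine p \<longrightarrow> \<bar>stieltjes_sum b \<psi> p - I\<bar> < \<epsilon>)
     \<longleftrightarrow> (p tagged_division_of {a..c} \<and> (\<lambda>\<xi>. ball \<xi> \<delta>) fine p \<longrightarrow> \<bar>stieltjes_sum b \<phi> p - I\<bar> < \<epsilon>)" for p \<delta> \<epsilon>
    by auto
  then show ?thesis
    using assms(1) unfolding has_stieltjes_integral_def by simp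
qed

section \<open>The kernel equation along a path\<close>

lemma K_eq_min: "K x y = min x y - x * y"
  by (auto simp: K_def algebra_simps)

text \<open>For \<open>c \<le> d\<close> this is a primitive of the indicator of
  \<open>{c..d}\<close>, which makes it an admissible multiplier in the product formula.\<close>

definition clip :: "real \<Rightarrow> real \<Rightarrow> real \<Rightarrow> real" where
  "clip c d z = max c (min z d)"

lemma has_integral_indicator_clip:
  assumes "c \<le> d" "s \<le> t"
  shows "(indicat_real {c..d} has_integral clip c d t - clip c d s) {s..t}"
proof -
  have "((\<lambda>x. 1) has_integral clip c d t - clip c d s) ({c..d} \<inter> {s..t})"
  proof (cases "max c s \<le> min d t")
    case True
    have "((\<lambda>x::real. 1::real) has_integral (min d t - max c s)) {max c s..min d t}"
      using has_integral_const_real[of "1::real" "max c s" "min d t"] True by simp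
    moreover have "min d t - max c s = clip c d t - clip c d s"
      using True assms by (auto simp: clip_def max_def min_def split: if_splits)
    ultimately show ?thesis by simp
  next
    case False
    then have "{c..d} \<inter> {s..t} = {}" "clip c d t = clip c d s"
      using assms by (auto simp: clip_def max_def min_def split: if_splits)
    then show ?thesis by simp
  qed
  then have "((\<lambda>x. if x \<in> {c..d} then 1 else 0) has_integral clip c d t - clip c d s) {s..t}"
    by (simp only: has_integral_restrict_Int)
  then show ?thesis by (simp add: indicator_def[abs_def] of_bool_def)
qed

lemma integral_indicator_mult:
  fixes f :: "real \<Rightarrow> real"
  assumes "{c..d} \<subseteq> S"
  shows "integral S (\<lambda>x. indicat_real {c..d} x * f x) = integral {c..d} f"
proof -
  have "(\<lambda>x. indicat_real {c..d} x * f x) = (\<lambda>x. if x \<in> {c..d} then f x else 0)"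
    by (auto simp: indicator_def)
  then have "integral S (\<lambda>x. indicat_real {c..d} x * f x) = integral ({c..d} \<inter> S) f"
    by (simp only: integral_restrict_Int)
  then show ?thesis using assms by (simp add: Int_absorb2)
qed

text \<open>The combination \<open>\<tau>\<close> of two kernel sections equals 1 on the middle interval, and every other
  section is \<open>\<tau>\<close> times a Lipschitz function that is constant near the end points.  Hence the
  single indefinite integral of \<open>\<tau> u\<close> determines the right-hand side of the equation at all \<open>x\<close>.\<close>

lemma K_factor:
  assumes "0 < a" "a \<le> x" "x \<le> 1 - a" "0 \<le> y" "y \<le> 1"
  shows "K x y = (clip a x y - x * clip a (1 - a) y) * ((K a y + K (1 - a) y) / a)"
proof -
  consider "y \<le> a" | "a \<le> y" "y \<le> 1 - a" | "1 - a \<le> y" by linarith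
  then show ?thesis
  proof cases
    case 1
    then have eq: "K a y + K (1 - a) y = y" "clip a x y = a" "clip a (1 - a) y = a" "K x y = (1 - x) * y"
      using assms by (auto simp: K_eq_min clip_def max_def min_def algebra_simps)
    show ?thesis unfolding eq using assms by (simp add: field_simps)
  next
    case 2
    then have "(K a y + K (1 - a) y) / a = 1" "clip a x y = min x y" "clip a (1 - a) y = y"
      using assms by (auto simp: K_eq_min clip_def max_def min_def field_simps)
    then show ?thesis by (simp add: K_eq_min)
  next
    case 3
    then have eq: "K a y + K (1 - a) y = 1 - y" "clip a x y = x" "clip a (1 - a) y = 1 - a" "K x y = x * (1 - y)"
      using assms by (auto simp: K_eq_min clip_def max_def min_def algebra_simps)
    show ?thesis unfolding eq using assms by (simp add: field_simps)
  qed
qed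

section \<open>Regularity of solutions away from the end points\<close>

lemma continuous_on_eq_on_rationals:
  fixes f g :: "real \<Rightarrow> real"
  assumes f: "continuous_on {a..b} f" and g: "continuous_on {a..b} g" and "a < b"
    and eq: "\<And>x. x \<in> \<rat> \<Longrightarrow> x \<in> {a..b} \<Longrightarrow> f x = g x" and x: "x \<in> {a..b}"
  shows "f x = g x"
proof -
  let ?S = "\<rat> \<inter> {a<..<b}"
  have "closure ?S = closure {a<..<b}"
  proof (rule antisym)
    show "closure {a<..<b} \<subseteq> closure ?S"
    proof (rule closure_minimal[OF _ closed_closure])
      show "{a<..<b} \<subseteq> closure ?S"
        using open_Int_closure_subset[of "{a<..<b}" "\<rat>"] Rats_closure_real
        by (simp add: Int_commute)
    qed
  qed (intro closure_mono, auto)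
  then have cl: "closure ?S = {a..b}" using \<open>a < b\<close> by simp
  have "f x - g x = 0"
  proof (rule continuous_constant_on_closure[of ?S "\<lambda>x. f x - g x" 0 x])
    show "continuous_on (closure ?S) (\<lambda>x. f x - g x)" unfolding cl by (intro continuous_on_diff f g)
  qed (use eq x cl in auto)
  then show ?thesis by simp
qed

text \<open>At rational \<open>x\<close> the product formula turns the noise integral of the
  equation into an ordinary integral of the continuous function \<open>R\<close>. Hence
  \<open>u\<close> is continuously differentiable with \<open>u' = R + const\<close>. Formally this
  is u'' = b' u integrated once, since on the middle interval \<open>R\<close> is an indefinite
  integral of \<open>u\<close> against \<open>b\<close>.\<close>

lemma kernel_equation_interior:
  fixes b u :: "real \<Rightarrow> real"
  assumes b: "continuous_on {0..1} b" and u: "continuous_on {0..1} u"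
    and sde: "\<And>x. x \<in> \<rat> \<Longrightarrow> x \<in> {0..1} \<Longrightarrow>
       \<exists>I. has_path_integral b (\<lambda>y. K x y * u y) I \<and> u x = p + r * x - I"
    and a: "a \<in> \<rat>" "0 < a" "a < 1 / 2"
  obtains w where "continuous_on {a..1 - a} w"
    "\<And>x. x \<in> {a..1 - a} \<Longrightarrow> (u has_vector_derivative w x) (at x within {a..1 - a})"
    "\<And>s t. a \<le> s \<Longrightarrow> s \<le> t \<Longrightarrow> t \<le> 1 - a \<Longrightarrow>
       w t - w s = u t * b t - u s * b s - integral {s..t} (\<lambda>x. w x * b x)"
proof -
  \<comment> \<open>A trapezoid on the unit interval: \<open>y / a\<close> up to \<open>a\<close>,
    then 1, and \<open>(1 - y) / a\<close> from \<open>1 - a\<close> on.\<close>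
  define \<tau> where "\<tau> y = (K a y + K (1 - a) y) / a" for y
  have \<tau>1: "\<tau> y = 1" if "y \<in> {a..1 - a}" for y
    using that a by (auto simp: \<tau>_def K_eq_min min_def field_simps)
  \<comment> \<open>Rationality of \<open>a\<close> makes the equation available at both
    \<open>a\<close> and \<open>1 - a\<close>, so both kernel sections in \<tau> are integrable
    after multiplication by \<open>u\<close>.\<close>
  have a': "1 - a \<in> \<rat>" "a \<in> {0..1}" "1 - a \<in> {0..1}" using a by auto
  obtain I1 where I1: "has_stieltjes_integral b (\<lambda>y. K a y * u y) 0 1 I1"
    using sde[OF a(1) a'(2)] unfolding has_path_integral_iff_stieltjes by blast
  obtain I2 where I2: "has_stieltjes_integral b (\<lambda>y. K (1 - a) y * u y) 0 1 I2"
    using sde[OF a'(1) a'(3)] unfolding has_path_integral_iff_stieltjes by blast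
  have "has_stieltjes_integral b (\<lambda>y. \<tau> y * u y) 0 1 (1 / a * (I1 + I2))"
    by (rule has_stieltjes_integral_cong[OF has_stieltjes_integral_cmult[OF has_stieltjes_integral_add[OF I1 I2]]])
      (simp add: \<tau>_def field_simps)
  then obtain R where R: "indefinite_stieltjes b (\<lambda>y. \<tau> y * u y) 0 1 R"
    by (rule has_stieltjes_integral_indefinite)
  have Kc: "continuous_on {0..1} (K x)" for x
    unfolding K_eq_min[abs_def] by (intro continuous_intros)
  have Rc: "continuous_on {0..1} R"
  proof (rule indefinite_stieltjes_continuous_on[OF R b])
    have "continuous_on {0..1} (\<lambda>y. \<tau> y * u y)"
      unfolding \<tau>_def using a by (intro continuous_intros Kc u) auto
    then show "bounded ((\<lambda>y. \<tau> y * u y) ` {0..1})"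
      by (intro compact_imp_bounded compact_continuous_image) auto
  qed
  have Rc': "continuous_on {a..1 - a} R" by (rule continuous_on_subset[OF Rc]) (use a in auto)
  define M where "M = integral {a..1 - a} R"
  \<comment> \<open>The right-hand side of the equation with the product formula inserted for the
    noise integral. The boundary terms carry \<open>\<psi> 1 = x * a\<close> and
    \<open>\<psi> 0 = a * (1 - x)\<close>. The result is affine in \<open>x\<close> up to a
    primitive of \<open>R\<close>, hence continuously differentiable.\<close>
  define F where "F x = p + r * x - (x * a * R 1 - a * (1 - x) * R 0 - (integral {a..x} R - x * M))" for x
  have uF: "u x = F x" if x: "x \<in> \<rat>" "x \<in> {a..1 - a}" for x
  proof -
    define g where "g y = indicat_real {a..x} y - x * indicat_real {a..1 - a} y" for y
    define \<psi> where "\<psi> y = clip a x y - x * clip a (1 - a) y" for y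
    have gi: "(g has_integral \<psi> t - \<psi> s) {s..t}" if "s \<le> t" for s t
    proof -
      have "(g has_integral (clip a x t - clip a x s) - x * (clip a (1 - a) t - clip a (1 - a) s)) {s..t}"
        unfolding g_def using x that a
        by (intro has_integral_diff has_integral_mult_right has_integral_indicator_clip) auto
      then show ?thesis by (simp add: \<psi>_def algebra_simps)
    qed
    have ga: "g absolutely_integrable_on {0..1}"
    proof (rule absolutely_integrable_integrable_bound)
      show "norm (g y) \<le> 1 + \<bar>x\<bar>" for y by (auto simp: g_def indicator_def)
      show "g integrable_on {0..1}" using gi[of 0 1] by (auto intro: has_integral_integrable)
    qed (intro integrable_continuous_interval continuous_on_const)
    obtain J where J: "has_stieltjes_integral b (\<lambda>y. K x y * u y) 0 1 J" "u x = p + r * x - J"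
      using sde[of x] x a unfolding has_path_integral_iff_stieltjes by auto
    have "has_stieltjes_integral b (\<lambda>y. \<psi> y * (\<tau> y * u y)) 0 1 J"
      by (rule has_stieltjes_integral_cong[OF J(1)])
        (use x a in \<open>simp add: \<psi>_def \<tau>_def K_factor[of a x]\<close>)
    then have J': "J = \<psi> 1 * R 1 - \<psi> 0 * R 0 - integral {0..1} (\<lambda>y. g y * R y)"
      by (rule stieltjes_integral_product[OF R Rc _ ga gi])
    have sub: "{a..x} \<subseteq> {0..1}" "{a..1 - a} \<subseteq> {0..1}" using a x by auto
    have ind: "(\<lambda>y. indicat_real {c..d} y * R y) integrable_on {0..1}" if "{c..d} \<subseteq> {0..1}" for c d
    proof -
      have "R integrable_on {c..d}"
        by (rule integrable_continuous_interval[OF continuous_on_subset[OF Rc that]])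
      then have "(\<lambda>y. if y \<in> {c..d} then R y else 0) integrable_on {0..1}"
        unfolding integrable_restrict_Int using Int_absorb2[OF that] by (simp only:)
      then show ?thesis by (simp add: indicator_def of_bool_def if_distrib[of "\<lambda>x. x * _"] cong: if_cong)
    qed
    have "integral {0..1} (\<lambda>y. g y * R y) = integral {0..1} (\<lambda>y. indicat_real {a..x} y * R y)
       - integral {0..1} (\<lambda>y. x * (indicat_real {a..1 - a} y * R y))"
      unfolding g_def left_diff_distrib mult.assoc
      by (rule Henstock_Kurzweil_Integration.integral_diff[OF ind[OF sub(1)] integrable_on_mult_right[OF ind[OF sub(2)]]])
    also have "\<dots> = integral {a..x} R - x * M"
      unfolding M_def by (simp add: integral_indicator_mult[OF sub(1)] integral_indicator_mult[OF sub(2)])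
    finally have "integral {0..1} (\<lambda>y. g y * R y) = integral {a..x} R - x * M" .
    moreover have "\<psi> 1 = x * a" "\<psi> 0 = a * (1 - x)"
      using x a by (auto simp: \<psi>_def clip_def algebra_simps max_def min_def)
    ultimately show ?thesis using J(2) J' by (simp add: F_def)
  qed
  have Fd: "(F has_vector_derivative (r - a * R 1 - a * R 0 - M + R x)) (at x within {a..1 - a})"
    if "x \<in> {a..1 - a}" for x
  proof -
    have "((\<lambda>x. integral {a..x} R) has_real_derivative R x) (at x within {a..1 - a})"
      using integral_has_vector_derivative[OF Rc' that] by (simp add: has_real_derivative_iff_has_vector_derivative)
    then have "(F has_real_derivative (r - a * R 1 - a * R 0 - M + R x)) (at x within {a..1 - a})"
      unfolding F_def by (auto intro!: derivative_eq_intros)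
    then show ?thesis by (simp add: has_real_derivative_iff_has_vector_derivative)
  qed
  have uF': "u x = F x" if "x \<in> {a..1 - a}" for x
  proof (rule continuous_on_eq_on_rationals[OF _ _ _ uF that])
    show "continuous_on {a..1 - a} u" by (rule continuous_on_subset[OF u]) (use a in auto)
    show "continuous_on {a..1 - a} F"
      unfolding continuous_on_eq_continuous_within using Fd by (blast intro: has_vector_derivative_continuous)
  qed (use a in auto)
  define w where "w x = r - a * R 1 - a * R 0 - M + R x" for x
  have wc: "continuous_on {a..1 - a} w" unfolding w_def by (intro continuous_intros Rc')
  have ud: "(u has_vector_derivative w x) (at x within {a..1 - a})" if "x \<in> {a..1 - a}" for x
    by (rule has_vector_derivative_transform[OF that uF' Fd[OF that, folded w_def]])
  have main: "w t - w s = u t * b t - u s * b s - integral {s..t} (\<lambda>x. w x * b x)"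
    if st: "a \<le> s" "s \<le> t" "t \<le> 1 - a" for s t
  proof -
    have st01: "{s..t} \<subseteq> {0..1}" "{s..t} \<subseteq> {a..1 - a}" using st a by auto
    \<comment> \<open>The integral of \<open>u\<close> over \<open>{s..t}\<close> is evaluated
      twice, through \<open>R\<close> and by parts with the now known derivative \<open>w\<close>;
      uniqueness equates the two values.\<close>
    have "has_stieltjes_integral b (\<lambda>y. \<tau> y * u y) s t (R t - R s)"
      by (rule indefinite_stieltjes_integral[OF R]) (use st a in auto)
    then have "has_stieltjes_integral b u s t (R t - R s)"
      by (rule has_stieltjes_integral_cong) (use \<tau>1 st in auto)
    moreover have "has_stieltjes_integral b u s t (u t * b t - u s * b s - integral {s..t} (\<lambda>x. w x * b x))"
    proof (rule has_stieltjes_integral_by_parts(1)[OF st(2) continuous_on_subset[OF b st01(1)]])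
      show "w absolutely_integrable_on {s..t}"
        by (rule absolutely_integrable_continuous_real[OF continuous_on_subset[OF wc st01(2)]])
      fix s' t' assume st': "s \<le> s'" "s' \<le> t'" "t' \<le> t"
      show "(w has_integral u t' - u s') {s'..t'}"
      proof (rule fundamental_theorem_of_calculus[OF st'(2)])
        fix x assume "x \<in> {s'..t'}"
        then have "x \<in> {a..1 - a}" using st st' by auto
        then show "(u has_vector_derivative w x) (at x within {s'..t'})"
          by (rule has_vector_derivative_within_subset[OF ud]) (use st st' in auto)
      qed
    qed
    ultimately have "R t - R s = u t * b t - u s * b s - integral {s..t} (\<lambda>x. w x * b x)"
      by (rule has_stieltjes_integral_unique)
    then show ?thesis by (simp add: w_def)
  qed
  show ?thesis by (rule that[OF wc ud main])
qed

section \<open>Extension of the first-order system to the closed interval\<close>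

lemma has_vector_derivative_interior_extend:
  fixes f f' :: "real \<Rightarrow> real"
  assumes "a < b" and f: "continuous_on {a..b} f" and f': "continuous_on {a..b} f'"
    and der: "\<And>x. x \<in> {a<..<b} \<Longrightarrow> (f has_vector_derivative f' x) (at x)"
    and x: "x \<in> {a..b}"
  shows "(f has_vector_derivative f' x) (at x within {a..b})"
proof -
  \<comment> \<open>The fundamental theorem needs the derivative only in the interior. It exhibits
    \<open>f\<close> as a primitive of a function continuous up to the ends, and such a primitive
    has the one-sided derivatives as well.\<close>
  have eq: "f y = f a + integral {a..y} f'" if "y \<in> {a..b}" for y
  proof -
    have "(f' has_integral f y - f a) {a..y}"
    proof (rule fundamental_theorem_of_calculus_interior)
      show "continuous_on {a..y} f" by (rule continuous_on_subset[OF f]) (use that in auto)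
    qed (use that der in auto)
    then show ?thesis by (simp add: integral_unique)
  qed
  have "((\<lambda>y. f a + integral {a..y} f') has_vector_derivative f' x) (at x within {a..b})"
    using has_vector_derivative_add[OF has_vector_derivative_const integral_has_vector_derivative[OF f' x]]
    by simp
  then show ?thesis by (rule has_vector_derivative_transform[OF x eq, rotated])
qed

text \<open>The quasi-derivative \<open>q = u' - u b\<close> turns the equation with the noise \<open>b'\<close> into a linear system
  with continuous coefficients.  That system holds on the open interval first; the integrating factor
  \<open>exp (\<integral> b)\<close> shows that \<open>q\<close> extends continuously to the end points.\<close>

lemma kernel_equation_system:
  fixes b u :: "real \<Rightarrow> real"
  assumes b: "continuous_on {0..1} b" and u: "continuous_on {0..1} u"
    and sde: "\<And>x. x \<in> \<rat> \<Longrightarrow> x \<in> {0..1} \<Longrightarrow>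
       \<exists>I. has_path_integral b (\<lambda>y. K x y * u y) I \<and> u x = p + r * x - I"
  obtains q where
    "\<And>x. x \<in> {0..1} \<Longrightarrow> (u has_real_derivative q x + u x * b x) (at x within {0..1})"
    "\<And>x. x \<in> {0..1} \<Longrightarrow> (q has_real_derivative - b x * (q x + u x * b x)) (at x within {0..1})"
proof -
  \<comment> \<open>Defining \<open>w\<close> as the derivative of \<open>u\<close> makes the local
    functions \<open>v\<close>, found for different \<open>a\<close>, parts of a single
    function.\<close>
  define w where "w x = vector_derivative u (at x)" for x
  define q where "q x = w x - u x * b x" for x
  have interior: "(u has_real_derivative w x) (at x) \<and> (q has_real_derivative - b x * w x) (at x)"
    if x: "x \<in> {0<..<1}" for x
  proof -
    have "0 < min x (1 - x)" using x by simp
    then obtain a where "a \<in> \<rat>" "0 < a" "a < min x (1 - x)" using Rats_dense_in_real by blast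
    then have a: "a \<in> \<rat>" "0 < a" "a < 1 / 2" and xa: "x \<in> {a<..<1 - a}" by auto
    obtain v where v: "continuous_on {a..1 - a} v"
      "\<And>x. x \<in> {a..1 - a} \<Longrightarrow> (u has_vector_derivative v x) (at x within {a..1 - a})"
      "\<And>s t. a \<le> s \<Longrightarrow> s \<le> t \<Longrightarrow> t \<le> 1 - a \<Longrightarrow>
         v t - v s = u t * b t - u s * b s - integral {s..t} (\<lambda>x. v x * b x)"
      by (rule kernel_equation_interior[OF b u sde a]) (assumption | rule that)+
    have at: "at y within {a..1 - a} = at y" if "y \<in> {a<..<1 - a}" for y
      using that at_within_interior[of y "{a..1 - a}"] by simp
    have uv: "(u has_vector_derivative v y) (at y)" if "y \<in> {a<..<1 - a}" for y
      using v(2)[of y] that unfolding at[OF that] by simp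
    have wv: "w y = v y" if "y \<in> {a<..<1 - a}" for y
      unfolding w_def by (rule vector_derivative_at[OF uv[OF that]])
    have vb: "continuous_on {a..1 - a} (\<lambda>x. v x * b x)"
      by (intro continuous_on_mult v(1) continuous_on_subset[OF b]) (use a in auto)
    have "((\<lambda>y. integral {a..y} (\<lambda>x. v x * b x)) has_real_derivative v x * b x) (at x)"
      using integral_has_vector_derivative[OF vb, of x] xa unfolding at[OF xa]
      by (simp add: has_real_derivative_iff_has_vector_derivative)
    then have "((\<lambda>y. v a - u a * b a - integral {a..y} (\<lambda>x. v x * b x)) has_real_derivative - b x * w x) (at x)"
      using wv[OF xa] by (auto intro!: derivative_eq_intros)
    then have "(q has_real_derivative - b x * w x) (at x)"
    proof (rule has_field_derivative_transform_within_open[OF _ open_greaterThanLessThan xa])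
      fix y assume y: "y \<in> {a<..<1 - a}"
      then show "v a - u a * b a - integral {a..y} (\<lambda>x. v x * b x) = q y"
        using v(3)[of a y] wv[OF y] by (simp add: q_def)
    qed
    moreover have "(u has_real_derivative w x) (at x)"
      using uv[OF xa] wv[OF xa] by (simp add: has_real_derivative_iff_has_vector_derivative)
    ultimately show ?thesis by blast
  qed
  have at01: "at x within {0..1} = at x" if "x \<in> {0<..<1}" for x :: real
    using that at_within_interior[of x "{0..1}"] by simp
  define \<beta> where "\<beta> x = integral {0..x} b" for x
  have \<beta>: "(\<beta> has_real_derivative b x) (at x within {0..1})" if "x \<in> {0..1}" for x
    unfolding \<beta>_def has_real_derivative_iff_has_vector_derivative
    by (rule integral_has_vector_derivative[OF b that])
  have \<beta>c: "continuous_on {0..1} \<beta>" by (rule DERIV_continuous_on[OF \<beta>])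
  \<comment> \<open>The derivative of \<open>q * exp \<beta>\<close>: the terms \<open>b * q\<close>
    cancel, and what remains involves only \<open>b\<close> and \<open>u\<close>, hence is
    continuous up to the end points.\<close>
  define z where "z x = - (exp (\<beta> x) * (b x)\<^sup>2 * u x)" for x
  have zc: "continuous_on {0..1} z" unfolding z_def by (intro continuous_intros \<beta>c b u)
  \<comment> \<open>The constant is matched at the interior point 1/2, since nothing is known yet
    about \<open>q\<close> at the ends.\<close>
  define Z where "Z x = q (1 / 2) * exp (\<beta> (1 / 2)) - integral {0..1 / 2} z + integral {0..x} z" for x
  have Z: "(Z has_real_derivative z x) (at x within {0..1})" if "x \<in> {0..1}" for x
  proof -
    have "((\<lambda>x. integral {0..x} z) has_real_derivative z x) (at x within {0..1})"
      unfolding has_real_derivative_iff_has_vector_derivative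
      by (rule integral_has_vector_derivative[OF zc that])
    then show ?thesis unfolding Z_def by (auto intro!: derivative_eq_intros)
  qed
  have qZ: "q x * exp (\<beta> x) = Z x" if x: "x \<in> {0<..<1}" for x
  proof -
    have "q x * exp (\<beta> x) - Z x = q (1 / 2) * exp (\<beta> (1 / 2)) - Z (1 / 2)"
    proof (rule DERIV_isconst3[where a = 0 and b = 1 and f = "\<lambda>y. q y * exp (\<beta> y) - Z y"])
      fix y :: real assume y: "y \<in> {0<..<1}"
      then have y': "y \<in> {0..1}" by simp
      have d: "(\<beta> has_real_derivative b y) (at y)" "(Z has_real_derivative z y) (at y)"
        "(q has_real_derivative - b y * w y) (at y)"
        using \<beta>[OF y'] Z[OF y'] interior[OF y] unfolding at01[OF y] by simp_all
      have "((\<lambda>y. q y * exp (\<beta> y) - Z y) has_real_derivative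
          (- b y * w y) * exp (\<beta> y) + exp (\<beta> y) * b y * q y - z y) (at y)"
        by (intro DERIV_diff DERIV_mult DERIV_fun_exp d)
      moreover have "(- b y * w y) * exp (\<beta> y) + exp (\<beta> y) * b y * q y - z y = 0"
        by (simp add: q_def z_def power2_eq_square algebra_simps)
      ultimately show "((\<lambda>y. q y * exp (\<beta> y) - Z y) has_real_derivative 0) (at y)" by simp
    qed (use x in auto)
    then show ?thesis by (simp add: Z_def)
  qed
  \<comment> \<open>\<open>Q\<close> replaces \<open>q\<close> from here on: they agree in the
    interior, while at the end points \<open>q\<close> rests on a two-sided derivative that need not
    exist.\<close>
  define Q where "Q x = Z x * exp (- \<beta> x)" for x
  have qQ: "q x = Q x" if "x \<in> {0<..<1}" for x
    using qZ[OF that] by (simp add: Q_def exp_minus field_simps)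
  have Qd: "(Q has_real_derivative - b x * (Q x + u x * b x)) (at x within {0..1})" if x: "x \<in> {0..1}" for x
  proof -
    have "(Q has_real_derivative z x * exp (- \<beta> x) + exp (- \<beta> x) * - b x * Z x) (at x within {0..1})"
      unfolding Q_def by (auto intro!: derivative_eq_intros \<beta>[OF x] Z[OF x])
    moreover have "z x * exp (- \<beta> x) + exp (- \<beta> x) * - b x * Z x = - b x * (Q x + u x * b x)"
      by (simp add: Q_def z_def power2_eq_square algebra_simps flip: exp_add)
    ultimately show ?thesis by simp
  qed
  have Qc: "continuous_on {0..1} Q" by (rule DERIV_continuous_on[OF Qd])
  have uQ: "(u has_real_derivative Q x + u x * b x) (at x within {0..1})" if x: "x \<in> {0..1}" for x
    unfolding has_real_derivative_iff_has_vector_derivative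
  proof (rule has_vector_derivative_interior_extend[OF _ u _ _ x])
    show "continuous_on {0..1} (\<lambda>x. Q x + u x * b x)" by (intro continuous_intros Qc u b)
    fix y :: real assume y: "y \<in> {0<..<1}"
    show "(u has_vector_derivative Q y + u y * b y) (at y)"
    proof -
      have "w y = Q y + u y * b y" using qQ[OF y] by (simp add: q_def)
      then show ?thesis using interior[OF y] by (simp add: has_real_derivative_iff_has_vector_derivative)
    qed
  qed simp
  show ?thesis by (rule that[OF uQ Qd])
qed

text \<open>Both extreme kernel sections vanish on the unit interval. The equations at 0 and 1
  therefore yield the boundary values of the solutions.\<close>

lemma kernel_equation_boundary:
  fixes b u :: "real \<Rightarrow> real"
  assumes x: "x = 0 \<or> x = 1" and I: "has_path_integral b (\<lambda>y. K x y * u y) I"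
  shows "I = 0"
proof (rule has_stieltjes_integral_unique)
  show "has_stieltjes_integral b (\<lambda>y. K x y * u y) 0 1 I"
    using I unfolding has_path_integral_iff_stieltjes .
  have "has_stieltjes_integral b (\<lambda>y. 0) 0 1 0"
    by (auto simp: has_stieltjes_integral_def stieltjes_sum_def intro: exI[of _ 1])
  then show "has_stieltjes_integral b (\<lambda>y. K x y * u y) 0 1 0"
    by (rule has_stieltjes_integral_cong) (use x in \<open>auto simp: K_eq_min\<close>)
qed

section \<open>The Green operator along a path\<close>

lemma D01_eqI:
  assumes "(f has_real_derivative y) (at x within {0..1})" "x \<in> {0..1}"
  shows "D01 f x = y"
  unfolding D01_def using assms
  by (intro vector_derivative_within_closed_interval)
    (auto simp: has_real_derivative_iff_has_vector_derivative)

lemma abs_cont_on_continuously_differentiable: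
  assumes f: "\<And>x. x \<in> {a..b} \<Longrightarrow> (f has_real_derivative f' x) (at x within {a..b})"
    and f': "continuous_on {a..b} f'"
  shows "abs_cont_on a b f"
proof -
  have "bounded (f' ` {a..b})" by (intro compact_imp_bounded compact_continuous_image f') auto
  then obtain L where L: "\<forall>x\<in>{a..b}. \<bar>f' x\<bar> \<le> L" unfolding bounded_real by auto
  show ?thesis
  proof (rule abs_cont_on_lipschitz)
    fix x y assume xy: "a \<le> x" "x \<le> y" "y \<le> b"
    have "norm (f y - f x) \<le> L * norm (y - x)"
      by (rule field_differentiable_bound[of "{a..b}" f f']) (use f L xy in auto)
    then show "\<bar>f y - f x\<bar> \<le> L * (y - x)" using xy by simp
  qed
qed

text \<open>A Gronwall argument: the energy \<open>u\<^sup>2 + q\<^sup>2\<close>, damped by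
  \<open>exp (- C x)\<close>, is nonincreasing and starts at zero. The conclusion is stated at 1
  because there it contradicts the boundary value of \<open>u\<close>.\<close>

lemma linear_system_zero:
  fixes b u q :: "real \<Rightarrow> real"
  assumes b: "continuous_on {0..1} b"
    and u: "\<And>x. x \<in> {0..1} \<Longrightarrow> (u has_real_derivative q x + u x * b x) (at x within {0..1})"
    and q: "\<And>x. x \<in> {0..1} \<Longrightarrow> (q has_real_derivative - b x * (q x + u x * b x)) (at x within {0..1})"
    and 0: "u 0 = 0" "q 0 = 0"
  shows "u 1 = 0"
proof -
  have "bounded (b ` {0..1})" by (intro compact_imp_bounded compact_continuous_image b) auto
  then obtain B where B: "\<forall>x\<in>{0..1}. \<bar>b x\<bar> \<le> B" unfolding bounded_real by auto
  \<comment> \<open>The growth rate of the energy: 1 and \<open>B\<^sup>2\<close> absorb the mixed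
    products \<open>u q\<close>, and a multiple of \<open>B\<close> absorbs the terms with
    \<open>u\<^sup>2 b\<close> and \<open>q\<^sup>2 b\<close>. Here \<open>2 * B\<close> would do
    for the latter; \<open>4 * B\<close> leaves slack.\<close>
  define C where "C = 1 + 4 * B + B\<^sup>2"
  define E where "E x = ((u x)\<^sup>2 + (q x)\<^sup>2) * exp (- (C * x))" for x
  define E' where "E' x = (2 * u x * (q x + u x * b x) + 2 * q x * (- b x * (q x + u x * b x))
      - C * ((u x)\<^sup>2 + (q x)\<^sup>2)) * exp (- (C * x))" for x
  have E: "(E has_real_derivative E' x) (at x within {0..1})" if "x \<in> {0..1}" for x
    unfolding E_def E'_def
    by (auto intro!: derivative_eq_intros u[OF that] q[OF that]) (simp add: algebra_simps)
  have E'0: "E' x \<le> 0" if x: "x \<in> {0..1}" for x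
  proof -
    have bB: "\<bar>b x\<bar> \<le> B" using B x by blast
    have 1: "2 * \<bar>u x * q x\<bar> \<le> (u x)\<^sup>2 + (q x)\<^sup>2"
      using sum_squares_bound[of "\<bar>u x\<bar>" "\<bar>q x\<bar>"] by (simp add: abs_mult)
    have 2: "u x * u x * b x \<le> B * (u x)\<^sup>2"
      using mult_right_mono[of "b x" B "(u x)\<^sup>2"] bB by (simp add: power2_eq_square mult.commute)
    have 3: "- (q x * q x * b x) \<le> B * (q x)\<^sup>2"
      using mult_right_mono[of "- b x" B "(q x)\<^sup>2"] bB by (simp add: power2_eq_square mult.commute)
    have "(b x)\<^sup>2 \<le> B\<^sup>2" using power_mono[OF bB, of 2] by simp
    then have "(b x)\<^sup>2 * (2 * \<bar>u x * q x\<bar>) \<le> B\<^sup>2 * ((u x)\<^sup>2 + (q x)\<^sup>2)"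
      using 1 by (rule mult_mono) simp_all
    moreover have "- ((b x)\<^sup>2 * (2 * (u x * q x))) \<le> (b x)\<^sup>2 * (2 * \<bar>u x * q x\<bar>)"
      unfolding mult_minus_right[symmetric]
      by (rule mult_left_mono[OF _ zero_le_power2]) linarith
    ultimately have 4: "- ((b x)\<^sup>2 * (2 * (u x * q x))) \<le> B\<^sup>2 * ((u x)\<^sup>2 + (q x)\<^sup>2)" by linarith
    have 5: "2 * (u x * q x) \<le> (u x)\<^sup>2 + (q x)\<^sup>2" using 1 by linarith
    have B0: "0 \<le> B * (u x)\<^sup>2" "0 \<le> B * (q x)\<^sup>2" using bB by (auto intro!: mult_nonneg_nonneg)
    have "2 * u x * (q x + u x * b x) + 2 * q x * (- b x * (q x + u x * b x))
      = 2 * (u x * q x) + 2 * (u x * u x * b x) + 2 * (- (q x * q x * b x)) + - ((b x)\<^sup>2 * (2 * (u x * q x)))"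
      by (simp add: algebra_simps power2_eq_square)
    also have "\<dots> \<le> ((u x)\<^sup>2 + (q x)\<^sup>2) + 2 * (B * (u x)\<^sup>2) + 2 * (B * (q x)\<^sup>2) + B\<^sup>2 * ((u x)\<^sup>2 + (q x)\<^sup>2)"
      using 2 3 4 5 by linarith
    also have "\<dots> \<le> C * ((u x)\<^sup>2 + (q x)\<^sup>2)"
      using B0 by (simp add: C_def algebra_simps)
    finally show ?thesis unfolding E'_def by (intro mult_nonpos_nonneg) auto
  qed
  have "E 1 \<le> E 0"
  proof (rule DERIV_nonpos_imp_decreasing_open[where f = E and a = 0 and b = 1])
    fix x :: real assume x: "0 < x" "x < 1"
    then have "at x within {0..1} = at x" using at_within_interior[of x "{0..1}"] by simp
    then show "\<exists>y. (E has_real_derivative y) (at x) \<and> y \<le> 0" using E[of x] E'0[of x] x by auto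
  qed (use DERIV_continuous_on[OF E] in auto)
  then have "(u 1)\<^sup>2 + (q 1)\<^sup>2 \<le> 0" by (simp add: E_def 0 mult_le_0_iff)
  then show ?thesis by (simp add: sum_power2_le_zero_iff)
qed

section \<open>Wronskian and variation of constants\<close>

locale path_solutions =
  fixes b u v qu qv :: "real \<Rightarrow> real"
  assumes b: "continuous_on {0..1} b"
    and u: "\<And>x. x \<in> {0..1} \<Longrightarrow> (u has_real_derivative qu x + u x * b x) (at x within {0..1})"
    and qu: "\<And>x. x \<in> {0..1} \<Longrightarrow> (qu has_real_derivative - b x * (qu x + u x * b x)) (at x within {0..1})"
    and v: "\<And>x. x \<in> {0..1} \<Longrightarrow> (v has_real_derivative qv x + v x * b x) (at x within {0..1})"
    and qv: "\<And>x. x \<in> {0..1} \<Longrightarrow> (qv has_real_derivative - b x * (qv x + v x * b x)) (at x within {0..1})"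
    and boundary: "u 0 = 0" "u 1 = 1" "v 0 = 1" "v 1 = 0"
begin

lemma continuous: "continuous_on {0..1} u" "continuous_on {0..1} v"
    "continuous_on {0..1} qu" "continuous_on {0..1} qv"
  using DERIV_continuous_on[OF u] DERIV_continuous_on[OF v]
    DERIV_continuous_on[OF qu] DERIV_continuous_on[OF qv] by auto

text \<open>Liouville's formula: the coefficient matrix of the system for \<open>(u, q)\<close> has
  diagonal entries \<open>b\<close> and \<open>- b\<close>, hence trace zero. The boundary values at
  0 reduce the constant to \<open>qu 0\<close>.\<close>

lemma quasi_wronskian: "x \<in> {0..1} \<Longrightarrow> qu x * v x - u x * qv x = qu 0"
proof -
  assume x: "x \<in> {0..1}"
  have "((\<lambda>x. qu x * v x - u x * qv x) has_real_derivative 0) (at y within {0..1})" if y: "y \<in> {0..1}" for y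
    by (auto intro!: derivative_eq_intros u[OF y] v[OF y] qu[OF y] qv[OF y]) (simp add: algebra_simps)
  then obtain c where "\<And>x. x \<in> {0..1} \<Longrightarrow> qu x * v x - u x * qv x = c"
    using has_field_derivative_zero_constant[of "{0..1}" "\<lambda>x. qu x * v x - u x * qv x"] by auto
  from this[of 0] this[OF x] show ?thesis by (simp add: boundary)
qed

text \<open>Replacing derivatives by quasi-derivatives adds \<open>u b v\<close> and subtracts it
  again in the Wronskian, so both versions agree.\<close>

lemma alpha_eq: "alpha u v = qu 0"
proof -
  have eq: "wronskian u v x = qu 0" if x: "x \<in> {0..1}" for x
    using quasi_wronskian[OF x] unfolding wronskian_def D01_eqI[OF u[OF x] x] D01_eqI[OF v[OF x] x]
    by (simp add: algebra_simps)
  show ?thesis unfolding alpha_def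
  proof (rule the_equality)
    fix a assume "\<forall>x\<in>{0..1}. wronskian u v x = a"
    then have "wronskian u v 0 = a" by simp
    then show "a = qu 0" using eq[of 0] by simp
  qed (use eq in blast)
qed

lemma alpha_nonzero: "alpha u v \<noteq> 0"
  using linear_system_zero[OF b u qu boundary(1)] boundary(2) unfolding alpha_eq by auto

lemma green_operator:
  assumes f: "continuous_on {0..1} f" and x: "x \<in> {0..1}"
  shows "T u v f x = (v x * integral {0..x} (\<lambda>y. u y * f y)
     + u x * (integral {0..1} (\<lambda>y. v y * f y) - integral {0..x} (\<lambda>y. v y * f y))) / alpha u v"
proof -
  have "continuous_on {0..1} (\<lambda>y. if y \<le> x then u y * v x else u x * v y)"
    by (rule continuous_on_cases_le) (auto intro!: continuous_intros continuous_on_subset[OF continuous(1)] continuous_on_subset[OF continuous(2)])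
  then have Gc: "continuous_on {0..1} (\<lambda>y. G u v x y * f y)"
    unfolding G_def by (intro continuous_on_mult f)
  have Gi: "(\<lambda>y. G u v x y * f y) integrable_on {0..1}" by (rule integrable_continuous_interval[OF Gc])
  have vf: "(\<lambda>y. v y * f y) integrable_on {0..1}"
    by (intro integrable_continuous_interval continuous_on_mult continuous f)
  have "(LINT y:{0..1}|lebesgue. G u v x y * f y) = integral {0..1} (\<lambda>y. G u v x y * f y)"
    by (rule set_lebesgue_integral_eq_integral(2)[OF absolutely_integrable_continuous_real[OF Gc]])
  also have "\<dots> = integral {0..x} (\<lambda>y. G u v x y * f y) + integral {x..1} (\<lambda>y. G u v x y * f y)"
    using Henstock_Kurzweil_Integration.integral_combine[OF _ _ Gi, of x] x by simp
  also have "integral {0..x} (\<lambda>y. G u v x y * f y) = integral {0..x} (\<lambda>y. v x * (u y * f y))"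
    by (rule Henstock_Kurzweil_Integration.integral_cong) (auto simp: G_def)
  also have "integral {x..1} (\<lambda>y. G u v x y * f y) = integral {x..1} (\<lambda>y. u x * (v y * f y))"
    by (rule Henstock_Kurzweil_Integration.integral_cong) (auto simp: G_def)
  also have "integral {x..1} (\<lambda>y. u x * (v y * f y))
      = u x * (integral {0..1} (\<lambda>y. v y * f y) - integral {0..x} (\<lambda>y. v y * f y))"
    using Henstock_Kurzweil_Integration.integral_combine[OF _ _ vf, of x] x by simp
  finally show ?thesis unfolding T_def by simp
qed

text \<open>The function \<open>q\<close> is built from the quasi-derivatives exactly as
  \<open>T u v f\<close> is from \<open>v\<close> and \<open>u\<close>. Differentiating the
  coefficients \<open>A\<close> and \<open>B\<close> contributes \<open>u f v - v f u = 0\<close> to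
  the first equation and \<open>- f\<close> times the quasi-Wronskian to the second; dividing by
  \<alpha> leaves the source term \<open>- f\<close>.\<close>

lemma green_operator_system:
  assumes f: "continuous_on {0..1} f"
  obtains q where
    "\<And>x. x \<in> {0..1} \<Longrightarrow> (T u v f has_real_derivative q x + T u v f x * b x) (at x within {0..1})"
    "\<And>x. x \<in> {0..1} \<Longrightarrow> (q has_real_derivative - b x * (q x + T u v f x * b x) - f x) (at x within {0..1})"
    "T u v f 0 = 0" "T u v f 1 = 0"
proof -
  define \<alpha> where "\<alpha> = alpha u v"
  have \<alpha>: "\<alpha> \<noteq> 0" "\<And>x. x \<in> {0..1} \<Longrightarrow> qu x * v x - u x * qv x = \<alpha>"
    using alpha_nonzero quasi_wronskian by (simp_all add: \<alpha>_def alpha_eq)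
  define A where "A x = integral {0..x} (\<lambda>y. u y * f y)" for x
  define B where "B x = integral {0..1} (\<lambda>y. v y * f y) - integral {0..x} (\<lambda>y. v y * f y)" for x
  have A: "(A has_real_derivative u x * f x) (at x within {0..1})" if "x \<in> {0..1}" for x
    unfolding A_def has_real_derivative_iff_has_vector_derivative
    by (intro integral_has_vector_derivative that continuous_on_mult continuous f)
  have B: "(B has_real_derivative - (v x * f x)) (at x within {0..1})" if "x \<in> {0..1}" for x
  proof -
    have "((\<lambda>x. integral {0..x} (\<lambda>y. v y * f y)) has_real_derivative v x * f x) (at x within {0..1})"
      unfolding has_real_derivative_iff_has_vector_derivative
      by (intro integral_has_vector_derivative that continuous_on_mult continuous f)
    then show ?thesis unfolding B_def by (auto intro!: derivative_eq_intros)
  qed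
  have Tx: "T u v f x = (v x * A x + u x * B x) / \<alpha>" if "x \<in> {0..1}" for x
    unfolding green_operator[OF f that] A_def B_def \<alpha>_def ..
  define q where "q x = (qv x * A x + qu x * B x) / \<alpha>" for x
  show ?thesis
  proof (rule that)
    show "T u v f 0 = 0" "T u v f 1 = 0"
      by (simp_all add: Tx boundary A_def B_def)
    fix x :: real assume x: "x \<in> {0..1}"
    have "((\<lambda>x. (v x * A x + u x * B x) / \<alpha>) has_real_derivative
        ((qv x + v x * b x) * A x + u x * f x * v x + ((qu x + u x * b x) * B x + - (v x * f x) * u x)) / \<alpha>)
        (at x within {0..1})"
      by (intro DERIV_cdivide DERIV_add DERIV_mult u v A B x)
    moreover have "((qv x + v x * b x) * A x + u x * f x * v x + ((qu x + u x * b x) * B x + - (v x * f x) * u x)) / \<alpha>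
      = q x + T u v f x * b x"
      unfolding Tx[OF x] q_def using \<alpha>(1) by (simp add: field_simps)
    ultimately have "((\<lambda>x. (v x * A x + u x * B x) / \<alpha>) has_real_derivative q x + T u v f x * b x) (at x within {0..1})"
      by simp
    then show "(T u v f has_real_derivative q x + T u v f x * b x) (at x within {0..1})"
      unfolding has_real_derivative_iff_has_vector_derivative
      by (rule has_vector_derivative_transform[OF x Tx, rotated])
    have "(q has_real_derivative
        (- b x * (qv x + v x * b x) * A x + u x * f x * qv x
          + (- b x * (qu x + u x * b x) * B x + - (v x * f x) * qu x)) / \<alpha>) (at x within {0..1})"
      unfolding q_def by (intro DERIV_cdivide DERIV_add DERIV_mult qu qv A B x)
    moreover have "(- b x * (qv x + v x * b x) * A x + u x * f x * qv x
          + (- b x * (qu x + u x * b x) * B x + - (v x * f x) * qu x)) / \<alpha>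
        = - b x * (q x + T u v f x * b x) - f x * (qu x * v x - u x * qv x) / \<alpha>"
      unfolding Tx[OF x] q_def using \<alpha>(1) by (simp add: field_simps)
    moreover have "f x * (qu x * v x - u x * qv x) / \<alpha> = f x" using \<alpha> x by simp
    ultimately show "(q has_real_derivative - b x * (q x + T u v f x * b x) - f x) (at x within {0..1})"
      by simp
  qed
qed

end

text \<open>Almost everywhere, \<open>f h = w' h' - (w h)' b - (q h)'\<close>, and \<open>q h\<close> vanishes at both end points.\<close>

lemma has_L_form_system:
  fixes b w q f h :: "real \<Rightarrow> real"
  assumes b: "continuous_on {0..1} b" and f: "continuous_on {0..1} f"
    and w: "\<And>x. x \<in> {0..1} \<Longrightarrow> (w has_real_derivative q x + w x * b x) (at x within {0..1})"
    and q: "\<And>x. x \<in> {0..1} \<Longrightarrow> (q has_real_derivative - b x * (q x + w x * b x) - f x) (at x within {0..1})"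
    and h: "abs_cont_on 0 1 h" "h 0 = 0" "h 1 = 0"
  shows "has_L_form b w h (inner01 f h)"
proof -
  define w' where "w' x = q x + w x * b x" for x
  have c: "continuous_on {0..1} w" "continuous_on {0..1} q"
    using DERIV_continuous_on[OF w] DERIV_continuous_on[OF q] by simp_all
  have w'c: "continuous_on {0..1} w'" unfolding w'_def by (intro continuous_intros c b)
  have hc: "continuous_on {0..1} h" by (rule abs_cont_on_imp_continuous_on[OF h(1)])
  have ac_w: "abs_cont_on 0 1 w"
    by (rule abs_cont_on_continuously_differentiable[OF w]) (use w'c in \<open>simp_all add: w'_def[abs_def]\<close>)
  have ac_q: "abs_cont_on 0 1 q"
    by (rule abs_cont_on_continuously_differentiable[OF q]) (auto intro!: continuous_intros c b f)
  have ac_wh: "abs_cont_on 0 1 (\<lambda>x. w x * h x)" and ac_qh: "abs_cont_on 0 1 (\<lambda>x. q x * h x)"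
    by (intro abs_cont_on_mult ac_w ac_q h(1))+
  obtain N where N: "negligible N"
    "\<forall>x\<in>{0..1} - N. (h has_vector_derivative D01 h x) (at x within {0..1})"
    using abs_cont_on_01_derivative(1)[OF h(1)] by blast
  have Dw: "D01 w x = w' x" if "x \<in> {0..1}" for x
    unfolding w'_def by (rule D01_eqI[OF w[OF that] that])
  have prod: "D01 (\<lambda>x. k x * h x) x = k' * h x + D01 h x * k x"
    if "x \<in> {0..1} - N" "(k has_real_derivative k') (at x within {0..1})" for k k' x
    using that N(2) by (intro D01_eqI DERIV_mult) (auto simp: has_real_derivative_iff_has_vector_derivative)

  \<comment> \<open>The second claim of integration by parts, with \<open>w'\<close> in the role of
    the path, is simply integrability of an integrable function times a continuous one.\<close>
  have int1: "(\<lambda>x. D01 h x * w' x) absolutely_integrable_on {0..1}"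
    by (rule has_stieltjes_integral_by_parts(2)[OF _ w'c abs_cont_on_01_derivative(3,2)[OF h(1)]]) auto
  have int1': "(\<lambda>x. D01 w x * D01 h x) absolutely_integrable_on {0..1}"
    by (rule set_integrable_cong[THEN iffD1, OF refl refl _ int1]) (simp add: Dw mult.commute)
  have int2: "(\<lambda>x. D01 (\<lambda>x. w x * h x) x * b x) absolutely_integrable_on {0..1}"
    by (rule has_stieltjes_integral_by_parts(2)[OF _ b abs_cont_on_01_derivative(3,2)[OF ac_wh]]) auto
  \<comment> \<open>No boundary terms occur, since \<open>h\<close> vanishes at both ends.\<close>
  define J where "J = - integral {0..1} (\<lambda>x. D01 (\<lambda>x. w x * h x) x * b x)"
  have J: "has_path_integral b (\<lambda>x. w x * h x) J"
    using has_stieltjes_integral_by_parts(1)[OF _ b abs_cont_on_01_derivative(3,2)[OF ac_wh]]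
    unfolding has_path_integral_iff_stieltjes J_def by (simp add: h)
  have "((\<lambda>x. D01 w x * D01 h x - D01 (\<lambda>x. w x * h x) x * b x - D01 (\<lambda>x. q x * h x) x)
      has_integral (integral {0..1} (\<lambda>x. D01 w x * D01 h x) + J - (q 1 * h 1 - q 0 * h 0))) {0..1}"
    unfolding J_def add_uminus_conv_diff
    by (intro has_integral_diff integrable_integral abs_cont_on_01_derivative(2)[OF ac_qh]
        set_lebesgue_integral_eq_integral(1) int1' int2) auto
  then have "((\<lambda>x. f x * h x)
      has_integral (integral {0..1} (\<lambda>x. D01 w x * D01 h x) + J - (q 1 * h 1 - q 0 * h 0))) {0..1}"
  proof (rule has_integral_spike[OF N(1), rotated])
    fix x assume x: "x \<in> {0..1} - N"
    then have x': "x \<in> {0..1}" by blast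
    show "f x * h x = D01 w x * D01 h x - D01 (\<lambda>x. w x * h x) x * b x - D01 (\<lambda>x. q x * h x) x"
      unfolding prod[OF x w[OF x']] prod[OF x q[OF x']] Dw[OF x'] w'_def
      by (simp add: algebra_simps)
  qed
  then have "integral {0..1} (\<lambda>x. f x * h x) = integral {0..1} (\<lambda>x. D01 w x * D01 h x) + J"
    by (simp add: h integral_unique)
  moreover have "inner01 f h = integral {0..1} (\<lambda>x. f x * h x)"
    unfolding inner01_def
    by (intro set_lebesgue_integral_eq_integral(2) absolutely_integrable_continuous_real continuous_on_mult f hc)
  moreover have "(LINT x:{0..1}|lebesgue. D01 w x * D01 h x) = integral {0..1} (\<lambda>x. D01 w x * D01 h x)"
    by (rule set_lebesgue_integral_eq_integral(2)[OF int1'])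
  ultimately show ?thesis unfolding has_L_form_def using int1' J by auto
qed

section \<open>From a single path to almost every path\<close>

lemma H1_memI:
  assumes ac: "abs_cont_on 0 1 w" and "w 0 = 0" "w 1 = 0"
  shows "w \<in> H1"
proof -
  have c: "continuous_on {0..1} w" by (rule abs_cont_on_imp_continuous_on[OF ac])
  have "set_integrable lebesgue {0..1} w" by (rule absolutely_integrable_continuous_real[OF c])
  then have "set_borel_measurable lebesgue {0..1} w"
    unfolding set_integrable_def set_borel_measurable_def by (rule borel_measurable_integrable)
  moreover have "set_integrable lebesgue {0..1} (\<lambda>x. (w x)\<^sup>2)"
    by (intro absolutely_integrable_continuous_real continuous_on_power c)
  ultimately show ?thesis using assms by (simp add: H1_def H_def)
qed

text \<open>The assumptions on the path do not mention \<open>f\<close> or a test function, so one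
  exceptional null set will serve all of them simultaneously.\<close>

lemma green_operator_right_inverse_path:
  fixes b u v :: "real \<Rightarrow> real"
  assumes b: "continuous_on {0..1} b" and u: "continuous_on {0..1} u" and v: "continuous_on {0..1} v"
    and u_eq: "\<And>x. x \<in> \<rat> \<Longrightarrow> x \<in> {0..1} \<Longrightarrow>
       \<exists>I. has_path_integral b (\<lambda>y. K x y * u y) I \<and> u x - x = - I"
    and v_eq: "\<And>x. x \<in> \<rat> \<Longrightarrow> x \<in> {0..1} \<Longrightarrow>
       \<exists>I. has_path_integral b (\<lambda>y. K x y * v y) I \<and> v x + x - 1 = - I"
    and f: "f \<in> H1"
  shows "T u v f \<in> H1 \<and> (\<forall>h\<in>H1. has_L_form b (T u v f) h (inner01 f h))"
proof -
  \<comment> \<open>Both equations are brought to the common form \<open>p + r * x - I\<close>, with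
    \<open>p = 0, r = 1\<close> for \<open>u\<close> and \<open>p = 1, r = - 1\<close> for
    \<open>v\<close>.\<close>
  have u_eq': "\<exists>I. has_path_integral b (\<lambda>y. K x y * u y) I \<and> u x = 0 + 1 * x - I"
    if "x \<in> \<rat>" "x \<in> {0..1}" for x using u_eq[OF that] by (auto simp: algebra_simps)
  have v_eq': "\<exists>I. has_path_integral b (\<lambda>y. K x y * v y) I \<and> v x = 1 + (- 1) * x - I"
    if "x \<in> \<rat>" "x \<in> {0..1}" for x using v_eq[OF that] by (auto simp: algebra_simps)
  obtain qu where qu:
    "\<And>x. x \<in> {0..1} \<Longrightarrow> (u has_real_derivative qu x + u x * b x) (at x within {0..1})"
    "\<And>x. x \<in> {0..1} \<Longrightarrow> (qu has_real_derivative - b x * (qu x + u x * b x)) (at x within {0..1})"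
    by (rule kernel_equation_system[OF b u u_eq']) (assumption | rule that)+
  obtain qv where qv:
    "\<And>x. x \<in> {0..1} \<Longrightarrow> (v has_real_derivative qv x + v x * b x) (at x within {0..1})"
    "\<And>x. x \<in> {0..1} \<Longrightarrow> (qv has_real_derivative - b x * (qv x + v x * b x)) (at x within {0..1})"
    by (rule kernel_equation_system[OF b v v_eq']) (assumption | rule that)+
  have "u 0 = 0" "u 1 = 1" "v 0 = 1" "v 1 = 0"
    using u_eq'[of 0] u_eq'[of 1] v_eq'[of 0] v_eq'[of 1]
      kernel_equation_boundary[of 0 b] kernel_equation_boundary[of 1 b] by fastforce+
  then interpret path_solutions b u v qu qv
    by unfold_locales (use b qu qv in auto)
  have ac: "abs_cont_on 0 1 f" using f by (simp add: H1_def)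
  have fc: "continuous_on {0..1} f" by (rule abs_cont_on_imp_continuous_on[OF ac])
  obtain q where q:
    "\<And>x. x \<in> {0..1} \<Longrightarrow> (T u v f has_real_derivative q x + T u v f x * b x) (at x within {0..1})"
    "\<And>x. x \<in> {0..1} \<Longrightarrow> (q has_real_derivative - b x * (q x + T u v f x * b x) - f x) (at x within {0..1})"
    "T u v f 0 = 0" "T u v f 1 = 0"
    by (rule green_operator_system[OF fc]) (assumption | rule that)+
  have "continuous_on {0..1} (\<lambda>x. q x + T u v f x * b x)"
    by (intro continuous_intros b DERIV_continuous_on[OF q(1)] DERIV_continuous_on[OF q(2)])
  from abs_cont_on_continuously_differentiable[OF q(1) this] have "abs_cont_on 0 1 (T u v f)" by simp
  then have "T u v f \<in> H1" by (rule H1_memI[OF _ q(3,4)])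
  moreover have "has_L_form b (T u v f) h (inner01 f h)" if "h \<in> H1" for h
    using that by (intro has_L_form_system[OF b fc q(1,2)]) (auto simp: H1_def H_def)
  ultimately show ?thesis by blast
qed

theorem theorem7:
  fixes M :: "'w measure" and F :: "real \<Rightarrow> 'w measure"
    and B u v :: "real \<Rightarrow> 'w \<Rightarrow> real"
  assumes B: "brownian_motion M F B"
    and u_meas: "\<And>x. x \<in> {0..1} \<Longrightarrow> u x \<in> borel_measurable M"
    and u_diff: "AE \<omega> in M. \<forall>x\<in>{0..1}. (\<lambda>x. u x \<omega>) differentiable (at x within {0..1})"
    and u_sde: "\<And>x. x \<in> {0..1} \<Longrightarrow> AE \<omega> in M.
           \<exists>I. has_path_integral (\<lambda>y. B y \<omega>) (\<lambda>y. K x y * u y \<omega>) I \<and> u x \<omega> - x = - I"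
    and v_meas: "\<And>x. x \<in> {0..1} \<Longrightarrow> v x \<in> borel_measurable M"
    and v_diff: "AE \<omega> in M. \<forall>x\<in>{0..1}. (\<lambda>x. v x \<omega>) differentiable (at x within {0..1})"
    and v_sde: "\<And>x. x \<in> {0..1} \<Longrightarrow> AE \<omega> in M.
           \<exists>I. has_path_integral (\<lambda>y. B y \<omega>) (\<lambda>y. K x y * v y \<omega>) I \<and> v x \<omega> + x - 1 = - I"
  shows "AE \<omega> in M. \<forall>f\<in>H1.
           T (\<lambda>x. u x \<omega>) (\<lambda>x. v x \<omega>) f \<in> H1 \<and>
           (\<forall>h\<in>H1. has_L_form (\<lambda>x. B x \<omega>) (T (\<lambda>x. u x \<omega>) (\<lambda>x. v x \<omega>) f) h (inner01 f h))"
proof -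
  have b: "AE \<omega> in M. continuous_on {0..1} (\<lambda>t. B t \<omega>)"
    using B by (simp add: brownian_motion_def)
  have countable: "countable (\<rat> \<inter> {0..1::real})"
    by (intro countable_Int1 countable_rat)
  have u_eq: "AE \<omega> in M. \<forall>x\<in>\<rat> \<inter> {0..1}.
      \<exists>I. has_path_integral (\<lambda>y. B y \<omega>) (\<lambda>y. K x y * u y \<omega>) I \<and> u x \<omega> - x = - I"
    unfolding AE_ball_countable[OF countable] using u_sde by blast
  have v_eq: "AE \<omega> in M. \<forall>x\<in>\<rat> \<inter> {0..1}.
      \<exists>I. has_path_integral (\<lambda>y. B y \<omega>) (\<lambda>y. K x y * v y \<omega>) I \<and> v x \<omega> + x - 1 = - I"
    unfolding AE_ball_countable[OF countable] using v_sde by blast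
  show ?thesis
    using b u_diff v_diff u_eq v_eq
  proof eventually_elim
    case (elim \<omega>)
    \<comment> \<open>Continuity of the paths is what carries the equations from rational points to
      the whole interval.\<close>
    have "continuous_on {0..1} (\<lambda>x. u x \<omega>)" "continuous_on {0..1} (\<lambda>x. v x \<omega>)"
      using elim(2,3) by (auto intro!: differentiable_imp_continuous_on simp: differentiable_on_def)
    then show ?case
      using elim(1,4,5) by (intro ballI green_operator_right_inverse_path) auto
  qed
qed

end
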